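(* Let $\mathbb{K}$ be a field and let $G$ be an undirected connected multigraph, possibly with loops. The $K$-polynomial of the $G$-parking critical module $\mathrm{CPark}_G$ is the Tutte evaluation $T_G(1,t)$, where $T_G(x,y)$ is the Tutte polynomial of $G$.
   Context: Let $G$ have vertices $v_1,\dots,v_n$ and $\ell$ loops, and let $R=\mathbb{K}[x_1,\dots,x_n]$ be standard graded. Fix the vertex $v_2$ of $G$. For a nonempty $U\subseteq V(G)\setminus\{v_2\}$ put $m_U=\prod_{v_j\in U}x_j^{\deg_U(v_j)}$, where $\deg_U(v_j)$ is the number of edges of $G$ joining $v_j$ to a vertex of the complement $V(G)\setminus U$. The $G$-parking function ideal (with respect to $v_2$) is $M_G=\langle m_U:\emptyset\ne U\subseteq V(G)\setminus\{v_2\}\rangle$. The ring $R/M_G$ is Cohen–Macaulay of dimension one. The $G$-parking critical module is $\mathrm{CPark}_G:=\omega_{R/M_G}(\ell)$, where $\omega_{R/M_G}\cong\mathrm{Ext}^{n-1}_R(R/M_G,R(-n))$ is the graded canonical module of $R/M_G$ and twists are defined by $M(i)_j=M_{i+j}$. The $K$-polynomial of a finitely generated graded module over the (graded) polynomial ring is the numerator of its Hilbert series expressed as a rational function in reduced form.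
   Formalization: The K-polynomial is taken up to a power of t, since literally the claim fails (one edge on two vertices: Hilbert series t/(1-t), but T_G(1,t)=1); the exact Hilbert series t^(n-|E|-ℓ) T_G(1,t)/(1-t) is stated as well. *)

theory Defs
  imports
    "HOL-Library.Poly_Mapping"
    "HOL-Computational_Algebra.Formal_Laurent_Series"
    "HOL-Algebra.Algebra"
    "Jordan_Normal_Form.VS_Connect"
begin

section \<open>Multigraphs and the Tutte polynomial\<close>

text \<open>An edge is identified by a name and has a set of one (loop) or two end vertices, so parallel
  edges and several loops at one vertex are allowed.\<close>

record ('v, 'e) mgraph =
  verts :: "'v set"
  edges :: "'e set"
  ends :: "'e \<Rightarrow> 'v set"

definition multigraph :: "('v, 'e) mgraph \<Rightarrow> bool" where
  "multigraph G \<longleftrightarrow> finite (verts G) \<and> finite (edges G) \<and>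
     (\<forall>e\<in>edges G. ends G e \<subseteq> verts G \<and> (card (ends G e) = 1 \<or> card (ends G e) = 2))"

definition loops :: "('v, 'e) mgraph \<Rightarrow> 'e set" where
  "loops G = {e \<in> edges G. card (ends G e) = 1}"

definition adjacency :: "('v, 'e) mgraph \<Rightarrow> 'e set \<Rightarrow> ('v \<times> 'v) set" where
  "adjacency G A = {(u, w). \<exists>e\<in>A. ends G e = {u, w}}"

definition components :: "('v, 'e) mgraph \<Rightarrow> 'e set \<Rightarrow> 'v set set" where
  "components G A =
     verts G // {(u, w). u \<in> verts G \<and> w \<in> verts G \<and> (u, w) \<in> (adjacency G A)\<^sup>*}"

definition connected_mgraph :: "('v, 'e) mgraph \<Rightarrow> bool" where
  "connected_mgraph G \<longleftrightarrow>
     verts G \<noteq> {} \<and> (\<forall>u\<in>verts G. \<forall>w\<in>verts G. (u, w) \<in> (adjacency G (edges G))\<^sup>*)"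

definition edge_rank :: "('v, 'e) mgraph \<Rightarrow> 'e set \<Rightarrow> nat" where
  "edge_rank G A = card (verts G) - card (components G A)"

text \<open>The exponents are true differences: the rank of \<open>A\<close> is at most the rank of the whole
  edge set and at most the size of \<open>A\<close>.\<close>

definition tutte :: "('v, 'e) mgraph \<Rightarrow> 'a::comm_ring_1 \<Rightarrow> 'a \<Rightarrow> 'a" where
  "tutte G x y = (\<Sum>A\<in>Pow (edges G).
     (x - 1) ^ (edge_rank G (edges G) - edge_rank G A) * (y - 1) ^ (card A - edge_rank G A))"


section \<open>The standard graded polynomial ring\<close>

type_synonym ('v, 'k) mpoly = "('v \<Rightarrow>\<^sub>0 nat) \<Rightarrow>\<^sub>0 'k"

definition poly_ring :: "'v set \<Rightarrow> ('v, 'k::field) mpoly ring" where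
  "poly_ring V = \<lparr>carrier = {p. \<forall>m\<in>Poly_Mapping.keys p. Poly_Mapping.keys m \<subseteq> V},
     monoid.mult = (*), monoid.one = 1, ring.zero = 0, ring.add = (+)\<rparr>"

definition const_poly :: "'k::field \<Rightarrow> ('v, 'k) mpoly" where
  "const_poly c = Poly_Mapping.single 0 c"

definition var :: "'v \<Rightarrow> ('v, 'k::field) mpoly" where
  "var v = Poly_Mapping.single (Poly_Mapping.single v 1) 1"

definition mon_degree :: "('v \<Rightarrow>\<^sub>0 nat) \<Rightarrow> nat" where
  "mon_degree m = (\<Sum>v\<in>Poly_Mapping.keys m. Poly_Mapping.lookup m v)"

definition homogeneous :: "'v set \<Rightarrow> int \<Rightarrow> ('v, 'k::field) mpoly set" where
  "homogeneous V j =
     {p \<in> carrier (poly_ring V). \<forall>m\<in>Poly_Mapping.keys p. int (mon_degree m) = j}"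


section \<open>Graded modules\<close>

text \<open>Graded modules are module records extended by the family of their graded pieces. Module
  records inherit the components \<open>mult\<close> and \<open>one\<close> from ring records;
  these play no role.\<close>

record ('r, 'm) gmodule = "('r, 'm) module" +
  grade :: "int \<Rightarrow> 'm set"

definition twist :: "('r, 'm) gmodule \<Rightarrow> int \<Rightarrow> ('r, 'm) gmodule" where
  "twist M i = M\<lparr>grade := (\<lambda>j. grade M (i + j))\<rparr>"

definition regular_gmodule :: "'v set \<Rightarrow> (('v, 'k::field) mpoly, ('v, 'k) mpoly) gmodule" where
  "regular_gmodule V = \<lparr>carrier = carrier (poly_ring V), monoid.mult = undefined, monoid.one = undefined,
     ring.zero = 0, ring.add = (+), smult = (*), grade = homogeneous V\<rparr>"

definition restrict_gmodule :: "('r, 'm) gmodule \<Rightarrow> 'm set \<Rightarrow> ('r, 'm) gmodule" where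
  "restrict_gmodule M N = M\<lparr>carrier := N, grade := (\<lambda>j. grade M j \<inter> N)\<rparr>"

definition quotient_gmodule :: "('r, 'm) gmodule \<Rightarrow> 'm set \<Rightarrow> ('r, 'm set) gmodule" where
  "quotient_gmodule M N = \<lparr>carrier = a_rcosets\<^bsub>M\<^esub> N, monoid.mult = undefined, monoid.one = undefined,
     ring.zero = N, ring.add = set_add M,
     smult = (\<lambda>r C. \<Union>m\<in>C. N +>\<^bsub>M\<^esub> (r \<odot>\<^bsub>M\<^esub> m)),
     grade = (\<lambda>j. (\<lambda>m. N +>\<^bsub>M\<^esub> m) ` grade M j)\<rparr>"

text \<open>The free module with basis in degrees \<open>a ! 0, a ! 1, \<dots>\<close>, that is,
  the direct sum of the \<open>R(- a ! k)\<close>.\<close>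

definition free_gmodule ::
    "'v set \<Rightarrow> int list \<Rightarrow> (('v, 'k::field) mpoly, nat \<Rightarrow> ('v, 'k) mpoly) gmodule" where
  "free_gmodule V a =
     \<lparr>carrier = {f. (\<forall>k. f k \<in> carrier (poly_ring V)) \<and> (\<forall>k\<ge>length a. f k = 0)},
      monoid.mult = undefined, monoid.one = undefined, ring.zero = (\<lambda>_. 0), ring.add = (\<lambda>f g k. f k + g k),
      smult = (\<lambda>p f k. p * f k),
      grade = (\<lambda>j. {f. (\<forall>k<length a. f k \<in> homogeneous V (j - a ! k)) \<and>
                       (\<forall>k\<ge>length a. f k = 0)})\<rparr>"

definition graded_hom ::
    "'v set \<Rightarrow> (('v, 'k::field) mpoly, 'm) gmodule \<Rightarrow> (('v, 'k) mpoly, 'n) gmodule \<Rightarrow>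
      ('m \<Rightarrow> 'n) set" where
  "graded_hom V M N =
     {f \<in> LinearCombinations.module_hom (poly_ring V) M N. \<forall>j. f ` grade M j \<subseteq> grade N j}"

text \<open>The graded module of all linear maps. For finitely generated \<open>M\<close> it is the
  direct sum of its graded pieces.\<close>

definition Hom_gmodule ::
    "'v set \<Rightarrow> (('v, 'k::field) mpoly, 'm) gmodule \<Rightarrow> (('v, 'k) mpoly, 'n) gmodule \<Rightarrow>
      (('v, 'k) mpoly, 'm \<Rightarrow> 'n) gmodule" where
  "Hom_gmodule V M N =
     (let H = LinearCombinations.module_hom (poly_ring V) M N \<inter> extensional (carrier M) in
      \<lparr>carrier = H, monoid.mult = undefined, monoid.one = undefined,
       ring.zero = (\<lambda>x\<in>carrier M. \<zero>\<^bsub>N\<^esub>),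
       ring.add = (\<lambda>f g. \<lambda>x\<in>carrier M. f x \<oplus>\<^bsub>N\<^esub> g x),
       smult = (\<lambda>r f. \<lambda>x\<in>carrier M. r \<odot>\<^bsub>N\<^esub> f x),
       grade = (\<lambda>j. {f \<in> H. \<forall>i. f ` grade M i \<subseteq> grade N (i + j)})\<rparr>)"


section \<open>Free resolutions and Ext\<close>

text \<open>A graded resolution of \<open>M\<close> by finitely generated graded free modules
  \<open>F\<^sub>i = free_gmodule V (a i)\<close>, with differentials
  \<open>d i : F\<^sub>i\<^sub>+\<^sub>1 \<rightarrow> F\<^sub>i\<close> and augmentation
  \<open>\<epsilon> : F\<^sub>0 \<rightarrow> M\<close>. It may be infinite and need not be minimal.\<close>

definition graded_free_resolution ::
    "'v set \<Rightarrow> (('v, 'k::field) mpoly, 'm) gmodule \<Rightarrow> (nat \<Rightarrow> int list) \<Rightarrow>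
      (nat \<Rightarrow> (nat \<Rightarrow> ('v, 'k) mpoly) \<Rightarrow> (nat \<Rightarrow> ('v, 'k) mpoly)) \<Rightarrow>
      ((nat \<Rightarrow> ('v, 'k) mpoly) \<Rightarrow> 'm) \<Rightarrow> bool" where
  "graded_free_resolution V M a d \<epsilon> \<longleftrightarrow>
     (let F = (\<lambda>i. free_gmodule V (a i)) in
      \<epsilon> \<in> graded_hom V (F 0) M \<and> \<epsilon> ` carrier (F 0) = carrier M \<and>
      (\<forall>i. d i \<in> graded_hom V (F (Suc i)) (F i)) \<and>
      a_kernel (F 0) M \<epsilon> = d 0 ` carrier (F 1) \<and>
      (\<forall>i. a_kernel (F (Suc i)) (F i) (d i) = d (Suc i) ` carrier (F (Suc (Suc i)))))"

definition coboundary ::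
    "'v set \<Rightarrow> (nat \<Rightarrow> int list) \<Rightarrow>
      (nat \<Rightarrow> (nat \<Rightarrow> ('v, 'k::field) mpoly) \<Rightarrow> (nat \<Rightarrow> ('v, 'k) mpoly)) \<Rightarrow> nat \<Rightarrow>
      ((nat \<Rightarrow> ('v, 'k) mpoly) \<Rightarrow> 'n) \<Rightarrow> ((nat \<Rightarrow> ('v, 'k) mpoly) \<Rightarrow> 'n)" where
  "coboundary V a d i h =
     (\<lambda>x\<in>carrier (free_gmodule V (a (Suc i)) :: (('v, 'k) mpoly, _) gmodule). h (d i x))"

text \<open>\<open>Ext_gmodule V a d i N\<close> is the module \<open>Ext\<^sup>i(M, N)\<close>, computed as
  the \<open>i\<close>-th cohomology of \<open>Hom(F, N)\<close> for a resolution \<open>F\<close> of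
  \<open>M\<close> given by \<open>a\<close> and \<open>d\<close>.\<close>

definition Ext_gmodule ::
    "'v set \<Rightarrow> (nat \<Rightarrow> int list) \<Rightarrow>
      (nat \<Rightarrow> (nat \<Rightarrow> ('v, 'k::field) mpoly) \<Rightarrow> (nat \<Rightarrow> ('v, 'k) mpoly)) \<Rightarrow> nat \<Rightarrow>
      (('v, 'k) mpoly, 'n) gmodule \<Rightarrow>
      (('v, 'k) mpoly, ((nat \<Rightarrow> ('v, 'k) mpoly) \<Rightarrow> 'n) set) gmodule" where
  "Ext_gmodule V a d i N =
     (let C = (\<lambda>i. Hom_gmodule V (free_gmodule V (a i)) N);
          Z = a_kernel (C i) (C (Suc i)) (coboundary V a d i);
          B = (case i of 0 \<Rightarrow> {\<zero>\<^bsub>C 0\<^esub>} | Suc j \<Rightarrow> coboundary V a d j ` carrier (C j))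
      in quotient_gmodule (restrict_gmodule (C i) Z) B)"


section \<open>Hilbert series and K-polynomials\<close>

definition graded_piece :: "(('v, 'k::field) mpoly, 'm) gmodule \<Rightarrow> int \<Rightarrow> ('k, 'm) module" where
  "graded_piece M j = \<lparr>carrier = grade M j, monoid.mult = undefined, monoid.one = undefined,
     ring.zero = \<zero>\<^bsub>M\<^esub>, ring.add = add M, smult = (\<lambda>c m. const_poly c \<odot>\<^bsub>M\<^esub> m)\<rparr>"

definition hilbert_function :: "(('v, 'k::field) mpoly, 'm) gmodule \<Rightarrow> int \<Rightarrow> nat" where
  "hilbert_function M j = vectorspace.dim (class_ring :: 'k ring) (graded_piece M j)"

text \<open>Meaningful for finitely generated \<open>M\<close>, whose graded pieces are finite-dimensional
  and vanish in all sufficiently negative degrees.\<close>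

definition hilbert_series :: "(('v, 'k::field) mpoly, 'm) gmodule \<Rightarrow> int fls" where
  "hilbert_series M = Abs_fls (\<lambda>j. int (hilbert_function M j))"

definition laurent_polys :: "int fls set" where
  "laurent_polys = {f. finite {k. fls_nth f k \<noteq> 0}}"

text \<open>\<open>P\<close> is the numerator of the Hilbert series of \<open>M\<close> written as a
  reduced fraction \<open>P / Q\<close>. As modules live in degrees of either sign, fractions are formed
  over the ring of integer Laurent polynomials. Its units are the monomials \<open>\<plusminus>t\<^sup>k\<close>, so
  the reduced form, and hence \<open>P\<close>, is determined up to such a factor; requiring the lowest
  coefficient of \<open>Q\<close> to be 1 (the denominators \<open>(1 - t)\<^sup>d\<close> have this property)
  leaves only the factor \<open>t\<^sup>k\<close>.\<close>

definition is_K_polynomial :: "(('v, 'k::field) mpoly, 'm) gmodule \<Rightarrow> int fls \<Rightarrow> bool" where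
  "is_K_polynomial M P \<longleftrightarrow> P \<in> laurent_polys \<and>
     (\<exists>Q\<in>laurent_polys. fls_nth Q (fls_subdegree Q) = 1 \<and> hilbert_series M * Q = P \<and>
        (\<forall>D\<in>laurent_polys. \<forall>A\<in>laurent_polys. \<forall>B\<in>laurent_polys.
           P = D * A \<and> Q = D * B \<longrightarrow> (\<exists>E\<in>laurent_polys. D * E = 1)))"


section \<open>The parking critical module\<close>

definition cut_degree :: "('v, 'e) mgraph \<Rightarrow> 'v set \<Rightarrow> 'v \<Rightarrow> nat" where
  "cut_degree G U v = card {e \<in> edges G. \<exists>w\<in>verts G - U. ends G e = {v, w}}"

definition parking_ideal :: "('v, 'e) mgraph \<Rightarrow> 'v \<Rightarrow> ('v, 'k::field) mpoly set" where
  "parking_ideal G q = genideal (poly_ring (verts G))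
     {\<Prod>v\<in>U. var v ^ cut_degree G U v | U. U \<noteq> {} \<and> U \<subseteq> verts G - {q}}"

definition parking_quotient ::
    "('v, 'e) mgraph \<Rightarrow> 'v \<Rightarrow> (('v, 'k::field) mpoly, ('v, 'k) mpoly set) gmodule" where
  "parking_quotient G q = quotient_gmodule (regular_gmodule (verts G)) (parking_ideal G q)"

text \<open>The graded canonical module \<open>Ext\<^sup>n\<^sup>-\<^sup>1(S, R(-n))\<close> of a quotient
  \<open>S\<close> of \<open>R\<close> that is Cohen-Macaulay of dimension one, where \<open>n\<close> is the
  number of variables and \<open>a\<close>, \<open>d\<close> form a resolution of \<open>S\<close>.\<close>

definition canonical_gmodule where
  "canonical_gmodule V a d =
     Ext_gmodule V a d (card V - 1) (twist (regular_gmodule V) (- int (card V)))"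

definition CPark where
  "CPark G a d = twist (canonical_gmodule (verts G) a d) (int (card (loops G)))"

end

(* Deleting or contracting an edge between the root set and the rest turns T_G(1,y) into
the sum of y^(g - |f|) over the G-parking functions f, where g = |E| - |V| + 1; loops only enter
through g. On the algebraic side, the powers y_s = x_v^(deg v) (v different from q) form a regular
sequence of length n-1 in M_G, and Rees' dimension shifting identifies Ext^(n-1)(R/M_G, R) with
Hom(R/M_G, R/(y_1, ..., y_(n-1))) up to a twist, i.e. with ((y_1, ..., y_(n-1)) : M_G) modulo
(y_1, ..., y_(n-1)). This module has a basis of monomials, which under complementation of exponents
correspond to the parking functions. Hence the Hilbert series of CPark_G is
t^(1 - l - |f|)/(1 - t) summed over f. The fraction is reduced because the coefficients
of the series do not vanish for large degrees while the only irreducible factor available is 1 - t. *)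

theory Submission
  imports Defs
begin

section \<open>Parking functions and the Tutte polynomial\<close>

text \<open>The resolution is arbitrary: it may be infinite and non-minimal, and \<open>F 0\<close>
  may have rank above one. Hence Ext is computed on the given complex itself. Multiplication by an
  element of M_G is null-homotopic on it, and the transposed homotopy acts on cochains with
  coefficients in R/J for every ideal J; so y_s kills the cohomology. Pure powers are chosen as
  regular sequence because the ideals (y_1, ..., y_s) are then monomial, like M_G: regularity, the
  colon ideal and its basis become statements about exponents. The variable x_q occurs in no
  generator, and its free exponent produces the factor 1/(1 - t). A basis monomial has exponent deg
  v - 1 - f(v) at every v other than q, where deg v ignores loops. Together with the twists by -n,
  by l and by the sum of the deg v, this makes f contribute from degree 1 - l - |f| = (|V| - |E| -
  l) + (g - |f|) on. The unit t^(|V| - |E| - l) is moved into the denominator, which leaves exactly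
  T_G(1,t) as numerator.\<close>

definition reaching :: "('v, 'e) mgraph \<Rightarrow> 'v set \<Rightarrow> 'e set \<Rightarrow> bool" where
  "reaching G Q A \<longleftrightarrow> (\<forall>w\<in>verts G. \<exists>u\<in>Q. (u, w) \<in> (adjacency G A)\<^sup>*)"

text \<open>For \<open>Q = {q}\<close> these are the exponent vectors, away from q, of the monomials
  outside M_G. A larger \<open>Q\<close> stands for a root obtained by merging vertices. Prescribing
  0 elsewhere makes each function determined by its values off the root, so that the functions can
  be counted.\<close>

definition parking :: "('v, 'e) mgraph \<Rightarrow> 'v set \<Rightarrow> ('v \<Rightarrow> nat) set" where
  "parking G Q = {f. (\<forall>v. v \<notin> verts G - Q \<longrightarrow> f v = 0) \<and>
     (\<forall>U. U \<noteq> {} \<longrightarrow> U \<subseteq> verts G - Q \<longrightarrow> (\<exists>v\<in>U. f v < cut_degree G U v))}"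

lemma parkingI:
  assumes "\<And>v. v \<notin> verts G - Q \<Longrightarrow> f v = 0"
    and "\<And>U. U \<noteq> {} \<Longrightarrow> U \<subseteq> verts G - Q \<Longrightarrow> \<exists>v\<in>U. f v < cut_degree G U v"
  shows "f \<in> parking G Q"
  using assms unfolding parking_def by blast

lemma parking_eq_0: "f \<in> parking G Q \<Longrightarrow> v \<notin> verts G - Q \<Longrightarrow> f v = 0"
  unfolding parking_def by blast

lemma parkingE:
  assumes "f \<in> parking G Q" "U \<noteq> {}" "U \<subseteq> verts G - Q"
  obtains v where "v \<in> U" "f v < cut_degree G U v"
  using assms unfolding parking_def by blast

lemma cut_degree_le: "finite (edges G) \<Longrightarrow> cut_degree G U v \<le> card (edges G)"
  unfolding cut_degree_def by (rule card_mono) auto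

lemma parking_less_cut_degree:
  assumes "f \<in> parking G Q" "v \<in> verts G - Q"
  shows "f v < cut_degree G {v} v"
  by (rule parkingE[OF assms(1), of "{v}"]) (use assms(2) in auto)

lemma finite_parking:
  assumes "multigraph G"
  shows "finite (parking G Q)"
proof (rule finite_subset)
  show "parking G Q \<subseteq> {f. \<forall>v. (v \<in> verts G \<longrightarrow> f v \<in> {..card (edges G)}) \<and> (v \<notin> verts G \<longrightarrow> f v = 0)}"
  proof (intro subsetI CollectI allI conjI impI)
    fix f v assume f: "f \<in> parking G Q"
    show "f v \<in> {..card (edges G)}"
    proof (cases "v \<in> verts G - Q")
      case True
      then show ?thesis
        using parking_less_cut_degree[OF f True] cut_degree_le[of G "{v}" v] assms
        by (auto simp: multigraph_def)
    next
      case False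
      then show ?thesis using parking_eq_0[OF f False] by simp
    qed
    show "f v = 0" if "v \<notin> verts G" using parking_eq_0[OF f] that by auto
  qed
  show "finite {f. \<forall>v. (v \<in> verts G \<longrightarrow> f v \<in> {..card (edges G)}) \<and> (v \<notin> verts G \<longrightarrow> f v = 0)}"
    using assms by (intro finite_set_of_finite_funs) (auto simp: multigraph_def)
qed

text \<open>Evaluates the base case of the recursion: once all vertices belong to the root set,
  every edge set is counted.\<close>

lemma sum_power_card_Pow:
  fixes z :: "'a::comm_ring_1"
  assumes "finite E"
  shows "(\<Sum>A\<in>Pow E. z ^ card A) = (1 + z) ^ card E"
  using assms
proof induction
  case (insert e E)
  have "(\<Sum>A\<in>Pow (insert e E). z ^ card A) =
      (\<Sum>A\<in>Pow E. z ^ card A) + (\<Sum>A\<in>insert e ` Pow E. z ^ card A)"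
    unfolding Pow_insert using insert by (subst sum.union_disjoint) auto
  also have "(\<Sum>A\<in>insert e ` Pow E. z ^ card A) = (\<Sum>A\<in>Pow E. z ^ card (insert e A))"
    using insert by (subst sum.reindex) (auto simp: inj_on_def)
  also have "\<dots> = (\<Sum>A\<in>Pow E. z * z ^ card A)"
  proof (rule sum.cong)
    fix A assume "A \<in> Pow E"
    then have "finite A" "e \<notin> A" using insert finite_subset by auto
    then show "z ^ card (insert e A) = z * z ^ card A" by simp
  qed simp
  also have "\<dots> = z * (\<Sum>A\<in>Pow E. z ^ card A)" by (simp add: sum_distrib_left)
  finally show ?case using insert by (simp add: algebra_simps)
qed simp

context
  fixes G :: "('v, 'e) mgraph" and Q :: "'v set" and e :: 'e and a w :: 'v and G' :: "('v, 'e) mgraph"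
  assumes G: "multigraph G" and Q: "Q \<subseteq> verts G" and e: "e \<in> edges G"
    and aw: "ends G e = {a, w}" "a \<in> Q" "w \<in> verts G - Q"
  defines "G' \<equiv> G\<lparr>edges := edges G - {e}\<rparr>"
begin

text \<open>The end \<open>a\<close> of \<open>e\<close> lies in \<open>Q\<close> and hence never in
  \<open>U\<close>, so \<open>e\<close> leaves \<open>U\<close> exactly when \<open>w\<close> is in
  \<open>U\<close>, and it is counted only at \<open>w\<close>.\<close>

lemma cut_degree_delete:
  assumes "U \<subseteq> verts G - Q" "v \<in> U"
  shows "cut_degree G U v = cut_degree G' U v + (if v = w then 1 else 0)"
proof -
  let ?S = "{e' \<in> edges G. \<exists>x\<in>verts G - U. ends G e' = {v, x}}"
  let ?S' = "{e' \<in> edges G - {e}. \<exists>x\<in>verts G - U. ends G e' = {v, x}}"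
  have fin: "finite ?S'" using G by (auto simp: multigraph_def)
  have *: "e \<in> ?S \<longleftrightarrow> v = w"
  proof
    assume "v = w"
    then have "a \<in> verts G - U" "ends G e = {v, a}" using aw assms Q by auto
    then show "e \<in> ?S" using e by auto
  next
    assume "e \<in> ?S"
    then have "v \<in> {a, w}" using aw(1) by auto
    moreover have "v \<noteq> a" using assms aw by auto
    ultimately show "v = w" by auto
  qed
  have "?S = ?S' \<union> (if e \<in> ?S then {e} else {})" by auto
  then have "?S = (if v = w then insert e ?S' else ?S')" using * by auto
  then have "card ?S = card ?S' + (if v = w then 1 else 0)" using fin by auto
  then show ?thesis by (simp add: cut_degree_def G'_def)
qed

text \<open>If f vanishes at \<open>w\<close>, the condition for a set \<open>U\<close> containing
  \<open>w\<close> holds automatically, with \<open>w\<close> as witness, since \<open>e\<close>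
  contributes to its cut degree. Only the sets avoiding \<open>w\<close> remain, and their cut
  degrees do not see \<open>e\<close>.\<close>

lemma parking_contract: "{f \<in> parking G Q. f w = 0} = parking G' (insert w Q)"
proof (intro equalityI subsetI)
  fix f assume "f \<in> {f \<in> parking G Q. f w = 0}"
  then have f: "f \<in> parking G Q" and f0: "f w = 0" by auto
  show "f \<in> parking G' (insert w Q)"
  proof (rule parkingI)
    show "f v = 0" if "v \<notin> verts G' - insert w Q" for v
      using that f0 parking_eq_0[OF f, of v] by (cases "v = w") (auto simp: G'_def)
    show "\<exists>v\<in>U. f v < cut_degree G' U v" if asm: "U \<noteq> {}" "U \<subseteq> verts G' - insert w Q" for U
    proof -
      have U: "U \<subseteq> verts G - Q" "w \<notin> U" using asm by (auto simp: G'_def)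
      obtain v where v: "v \<in> U" "f v < cut_degree G U v" by (rule parkingE[OF f asm(1) U(1)])
      then have "v \<noteq> w" using U by blast
      then show ?thesis using v cut_degree_delete[OF U(1) v(1)] by auto
    qed
  qed
next
  fix f assume f: "f \<in> parking G' (insert w Q)"
  have f0: "f w = 0" by (rule parking_eq_0[OF f]) simp
  have "f \<in> parking G Q"
  proof (rule parkingI)
    show "f v = 0" if "v \<notin> verts G - Q" for v
      using that parking_eq_0[OF f, of v] by (simp add: G'_def)
    show "\<exists>v\<in>U. f v < cut_degree G U v" if U: "U \<noteq> {}" "U \<subseteq> verts G - Q" for U
    proof (cases "w \<in> U")
      case True
      then show ?thesis using f0 cut_degree_delete[OF U(2) True] by (intro bexI[of _ w]) auto
    next
      case False
      then have U': "U \<subseteq> verts G' - insert w Q" using U by (auto simp: G'_def)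
      obtain v where v: "v \<in> U" "f v < cut_degree G' U v" by (rule parkingE[OF f U(1) U'])
      then show ?thesis using cut_degree_delete[OF U(2) v(1)] by (intro bexI[of _ v]) auto
    qed
  qed
  then show "f \<in> {f \<in> parking G Q. f w = 0}" using f0 by simp
qed

text \<open>Lowering f by one at \<open>w\<close> compensates for the loss of \<open>e\<close>,
  which lowers the cut degree by one at \<open>w\<close> and nowhere else.\<close>

lemma parking_delete: "{f \<in> parking G Q. f w \<noteq> 0} = (\<lambda>f. f(w := Suc (f w))) ` parking G' Q"
proof (intro equalityI subsetI)
  fix f assume "f \<in> {f \<in> parking G Q. f w \<noteq> 0}"
  then have f: "f \<in> parking G Q" and f0: "f w \<noteq> 0" by auto
  let ?g = "f(w := f w - 1)"
  have "?g \<in> parking G' Q"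
  proof (rule parkingI)
    show "?g v = 0" if "v \<notin> verts G' - Q" for v
      using that parking_eq_0[OF f, of v] by (auto simp: G'_def)
    show "\<exists>v\<in>U. ?g v < cut_degree G' U v" if asm: "U \<noteq> {}" "U \<subseteq> verts G' - Q" for U
    proof -
      have U: "U \<subseteq> verts G - Q" using asm by (simp add: G'_def)
      obtain v where v: "v \<in> U" "f v < cut_degree G U v" by (rule parkingE[OF f asm(1) U])
      then show ?thesis using f0 cut_degree_delete[OF U v(1)] by (intro bexI[of _ v]) auto
    qed
  qed
  moreover have "f = ?g(w := Suc (?g w))" using f0 by auto
  ultimately show "f \<in> (\<lambda>f. f(w := Suc (f w))) ` parking G' Q" by blast
next
  fix f assume "f \<in> (\<lambda>f. f(w := Suc (f w))) ` parking G' Q"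
  then obtain g where g: "g \<in> parking G' Q" and f: "f = g(w := Suc (g w))" by auto
  have "f \<in> parking G Q"
  proof (rule parkingI)
    show "f v = 0" if "v \<notin> verts G - Q" for v
      using that parking_eq_0[OF g, of v] aw(3) by (auto simp: f G'_def)
    show "\<exists>v\<in>U. f v < cut_degree G U v" if U: "U \<noteq> {}" "U \<subseteq> verts G - Q" for U
    proof -
      have U': "U \<subseteq> verts G' - Q" using U by (simp add: G'_def)
      obtain v where v: "v \<in> U" "g v < cut_degree G' U v" by (rule parkingE[OF g U(1) U'])
      then show ?thesis using cut_degree_delete[OF U(2) v(1)] by (intro bexI[of _ v]) (auto simp: f)
    qed
  qed
  then show "f \<in> {f \<in> parking G Q. f w \<noteq> 0}" by (simp add: f)
qed

text \<open>Both ends of \<open>e\<close> lie in the enlarged root set, so a path using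
  \<open>e\<close> can be restarted right after its last use; conversely a path starting at
  \<open>w\<close> is prolonged through \<open>e\<close> to \<open>a\<close>.\<close>

lemma reaching_insert: "reaching G Q (insert e A) \<longleftrightarrow> reaching G' (insert w Q) A"
proof
  assume L: "reaching G Q (insert e A)"
  have "\<exists>u'\<in>insert w Q. (u', x) \<in> (adjacency G A)\<^sup>*" if "u \<in> Q" "(u, x) \<in> (adjacency G (insert e A))\<^sup>*" for u x
    using that(2)
  proof induction
    case base
    then show ?case using that(1) by auto
  next
    case (step y z)
    then obtain e' where e': "e' \<in> insert e A" "ends G e' = {y, z}" by (auto simp: adjacency_def)
    show ?case
    proof (cases "e' = e")
      case True
      then have "z \<in> {a, w}" using e' aw(1) by auto
      then show ?thesis using aw by auto
    next
      case False
      then have "(y, z) \<in> adjacency G A" using e' by (auto simp: adjacency_def)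
      then show ?thesis using step.IH by (meson rtrancl.rtrancl_into_rtrancl)
    qed
  qed
  then have "\<forall>x\<in>verts G. \<exists>u\<in>insert w Q. (u, x) \<in> (adjacency G A)\<^sup>*"
    using L unfolding reaching_def by blast
  then show "reaching G' (insert w Q) A" by (simp add: reaching_def adjacency_def G'_def)
next
  assume R: "reaching G' (insert w Q) A"
  have mono: "(adjacency G A)\<^sup>* \<subseteq> (adjacency G (insert e A))\<^sup>*"
    by (intro rtrancl_mono) (auto simp: adjacency_def)
  have aw': "(a, w) \<in> adjacency G (insert e A)" using aw by (auto simp: adjacency_def)
  show "reaching G Q (insert e A)"
    unfolding reaching_def
  proof
    fix x assume "x \<in> verts G"
    then obtain u where u: "u \<in> insert w Q" "(u, x) \<in> (adjacency G A)\<^sup>*"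
      using R by (auto simp: reaching_def adjacency_def G'_def)
    then have ux: "(u, x) \<in> (adjacency G (insert e A))\<^sup>*" using mono by auto
    show "\<exists>u\<in>Q. (u, x) \<in> (adjacency G (insert e A))\<^sup>*"
    proof (cases "u = w")
      case True
      then show ?thesis using ux aw' aw(2) by (meson converse_rtrancl_into_rtrancl)
    next
      case False
      then show ?thesis using u ux by auto
    qed
  qed
qed

end

text \<open>Contracting an edge \<open>{a, w}\<close> with \<open>a\<close> in the root set \<open>Q\<close> is encoded by adding \<open>w\<close> to \<open>Q\<close>.\<close>

lemma reaching_sum_eq_parking_sum:
  fixes y :: "'a::comm_ring_1" and G :: "('v, 'e) mgraph"
  assumes "multigraph G" "Q \<subseteq> verts G"
  shows "(\<forall>f\<in>parking G Q. card (verts G - Q) + sum f (verts G) \<le> card (edges G)) \<and>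
    (\<Sum>A | A \<subseteq> edges G \<and> reaching G Q A. (y - 1) ^ (card A - card (verts G - Q))) =
    (\<Sum>f\<in>parking G Q. y ^ (card (edges G) - card (verts G - Q) - sum f (verts G)))"
  using assms
proof (induction "card (edges G)" arbitrary: G Q rule: less_induct)
  case less
  have fin: "finite (verts G)" "finite (edges G)" using less.prems by (auto simp: multigraph_def)
  \<comment> \<open>In the case \<open>cut\<close> both sums are empty: no edge set reaches beyond
    \<open>Q\<close>, and all cut degrees of the full complement of \<open>Q\<close> are 0. In the
    case \<open>edge\<close> deletion and contraction apply.\<close>
  consider (root) "verts G - Q = {}"
    | (cut) "verts G - Q \<noteq> {}" "\<And>e a w. e \<in> edges G \<Longrightarrow> a \<in> Q \<Longrightarrow> w \<in> verts G - Q \<Longrightarrow> ends G e \<noteq> {a, w}"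
    | (edge) e a w where "e \<in> edges G" "ends G e = {a, w}" "a \<in> Q" "w \<in> verts G - Q"
    by blast
  then show ?case
  proof cases
    case root
    then have QV: "Q = verts G" using less.prems by auto
    have "parking G Q = {\<lambda>_. 0}"
      using root parking_eq_0[of _ G Q] by (auto intro!: parkingI)
    moreover have "reaching G Q A" for A unfolding reaching_def QV by blast
    moreover have "{A. A \<subseteq> edges G} = Pow (edges G)" by auto
    ultimately show ?thesis using sum_power_card_Pow[OF fin(2), of "y - 1"] by (simp add: QV)
  next
    case cut
    have "cut_degree G (verts G - Q) v = 0" if "v \<in> verts G - Q" for v
    proof -
      have "{e \<in> edges G. \<exists>w\<in>verts G - (verts G - Q). ends G e = {v, w}} = {}"
        using cut(2)[of _ _ v] that by (auto simp: insert_commute)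
      then show ?thesis unfolding cut_degree_def by (metis card.empty)
    qed
    then have p: "parking G Q = {}" using cut(1) by (auto elim!: parkingE[of _ G Q "verts G - Q"])
    have "\<not> reaching G Q A" if A: "A \<subseteq> edges G" for A
    proof
      assume R: "reaching G Q A"
      obtain w where w: "w \<in> verts G - Q" using cut(1) by auto
      obtain u where u: "u \<in> Q" "(u, w) \<in> (adjacency G A)\<^sup>*" using R w by (auto simp: reaching_def)
      from u(2) have "w \<in> Q"
      proof induction
        case base
        show ?case by fact
      next
        case (step x z)
        then obtain e where e: "e \<in> A" "ends G e = {x, z}" by (auto simp: adjacency_def)
        then have "z \<in> verts G" using less.prems(1) A by (auto simp: multigraph_def)
        then show ?case using cut(2)[of e x z] e step A by auto
      qed
      then show False using w by auto
    qed
    then have "{A. A \<subseteq> edges G \<and> reaching G Q A} = {}" by auto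
    then show ?thesis using p by (metis (no_types, lifting) empty_iff sum.empty)
  next
    case edge
    define G' where "G' = G\<lparr>edges := edges G - {e}\<rparr>"
    note ctx = less.prems edge
    have G'_sel: "verts G' = verts G" "edges G' = edges G - {e}" "ends G' = ends G" by (simp_all add: G'_def)
    have cG': "card (edges G') = card (edges G) - 1" "card (edges G) > 0"
      unfolding G'_sel using edge(1) fin(2) card_gt_0_iff[of "edges G"] by auto
    have mG': "multigraph G'" using less.prems(1) by (auto simp: multigraph_def G'_sel)
    have wQ: "insert w Q \<subseteq> verts G'" using less.prems edge by (auto simp: G'_sel)
    have cW: "card (verts G - insert w Q) = card (verts G - Q) - 1" "card (verts G - Q) > 0"
    proof -
      have "verts G - insert w Q = (verts G - Q) - {w}" by auto
      then show "card (verts G - insert w Q) = card (verts G - Q) - 1" using edge(4) by simp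
      show "card (verts G - Q) > 0" using edge(4) fin card_gt_0_iff[of "verts G - Q"] by blast
    qed
    note IHc = less.hyps[of G' "insert w Q", OF _ mG' wQ]
    note IHd = less.hyps[of G' Q, OF _ mG']
    have lt: "card (edges G') < card (edges G)" using cG' by simp
    have IHc1: "\<And>f. f \<in> parking G' (insert w Q) \<Longrightarrow> card (verts G - insert w Q) + sum f (verts G) \<le> card (edges G')"
      and IHc2: "(\<Sum>A | A \<subseteq> edges G' \<and> reaching G' (insert w Q) A. (y - 1) ^ (card A - card (verts G - insert w Q))) =
        (\<Sum>f\<in>parking G' (insert w Q). y ^ (card (edges G') - card (verts G - insert w Q) - sum f (verts G)))"
      using IHc[OF lt] unfolding G'_sel by auto
    have IHd1: "\<And>f. f \<in> parking G' Q \<Longrightarrow> card (verts G - Q) + sum f (verts G) \<le> card (edges G')"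
      and IHd2: "(\<Sum>A | A \<subseteq> edges G' \<and> reaching G' Q A. (y - 1) ^ (card A - card (verts G - Q))) =
        (\<Sum>f\<in>parking G' Q. y ^ (card (edges G') - card (verts G - Q) - sum f (verts G)))"
      using IHd[OF lt] less.prems(2) unfolding G'_sel by auto
    have rG': "reaching G' Q A = reaching G Q A" for A by (simp add: reaching_def adjacency_def G'_sel)
    have pc: "{f \<in> parking G Q. f w = 0} = parking G' (insert w Q)"
      unfolding G'_def by (rule parking_contract[OF ctx])
    have pd: "{f \<in> parking G Q. f w \<noteq> 0} = (\<lambda>f. f(w := Suc (f w))) ` parking G' Q"
      unfolding G'_def by (rule parking_delete[OF ctx])
    have sum_upd: "sum (g(w := Suc (g w))) (verts G) = Suc (sum g (verts G))" for g :: "'v \<Rightarrow> nat"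
    proof -
      have "sum (g(w := Suc (g w))) (verts G) = Suc (g w) + sum g (verts G - {w})"
        using edge(4) fin by (subst sum.remove[of _ w]) (auto intro!: sum.cong)
      also have "\<dots> = Suc (sum g (verts G))" using edge(4) fin by (subst (2) sum.remove[of _ w]) auto
      finally show ?thesis .
    qed
    \<comment> \<open>The bound makes the exponents on the right true differences; later it bounds
      below the degrees in which the Hilbert series lives.\<close>
    have bound: "card (verts G - Q) + sum f (verts G) \<le> card (edges G)" if f: "f \<in> parking G Q" for f
    proof (cases "f w = 0")
      case True
      then have "f \<in> parking G' (insert w Q)" using f pc by blast
      from IHc1[OF this] show ?thesis using cW cG' by linarith
    next
      case False
      then obtain g where "g \<in> parking G' Q" and fg: "f = g(w := Suc (g w))" using pd f by blast
      then show ?thesis using IHd1[of g] cG' unfolding fg sum_upd by linarith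
    qed
    let ?n = "card (verts G - Q)" and ?m = "card (edges G)"
    have "(\<Sum>f\<in>parking G Q. y ^ (?m - ?n - sum f (verts G))) =
        (\<Sum>f\<in>{f \<in> parking G Q. f w = 0} \<union> {f \<in> parking G Q. f w \<noteq> 0}. y ^ (?m - ?n - sum f (verts G)))"
      by (rule sum.cong) auto
    also have "\<dots> = (\<Sum>f\<in>{f \<in> parking G Q. f w = 0}. y ^ (?m - ?n - sum f (verts G))) +
        (\<Sum>f\<in>{f \<in> parking G Q. f w \<noteq> 0}. y ^ (?m - ?n - sum f (verts G)))"
      by (rule sum.union_disjoint) (simp_all add: finite_parking[OF less.prems(1)] disjoint_iff)
    also have "(\<Sum>f\<in>{f \<in> parking G Q. f w = 0}. y ^ (?m - ?n - sum f (verts G))) =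
        (\<Sum>f\<in>parking G' (insert w Q). y ^ (card (edges G') - card (verts G - insert w Q) - sum f (verts G)))"
    proof (unfold pc, rule sum.cong)
      \<comment> \<open>Contraction loses one edge and one non-root vertex, so the exponent stays
        the same.\<close>
      have "?m - ?n - s = card (edges G') - card (verts G - insert w Q) - s" for s
        using cW cG' by linarith
      then show "y ^ (?m - ?n - sum f (verts G)) =
          y ^ (card (edges G') - card (verts G - insert w Q) - sum f (verts G))" for f :: "'v \<Rightarrow> nat"
        by simp
    qed simp
    also have "\<dots> = (\<Sum>A | A \<subseteq> edges G' \<and> reaching G' (insert w Q) A. (y - 1) ^ (card A - card (verts G - insert w Q)))"
      by (rule IHc2[symmetric])
    also have "\<dots> = (\<Sum>A\<in>insert e ` {A. A \<subseteq> edges G' \<and> reaching G' (insert w Q) A}. (y - 1) ^ (card A - ?n))"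
    proof -
      have inj: "inj_on (insert e) {A. A \<subseteq> edges G' \<and> reaching G' (insert w Q) A}"
        by (auto simp: inj_on_def G'_sel)
      show ?thesis
        unfolding sum.reindex[OF inj]
      proof (rule sum.cong)
        fix A assume "A \<in> {A. A \<subseteq> edges G' \<and> reaching G' (insert w Q) A}"
        then have "finite A" "e \<notin> A" using fin finite_subset[of A "edges G"] by (auto simp: G'_sel)
        then show "(y - 1) ^ (card A - card (verts G - insert w Q)) = ((\<lambda>A. (y - 1) ^ (card A - ?n)) \<circ> insert e) A"
          using cW by simp
      qed simp
    qed
    also have "(\<Sum>f\<in>{f \<in> parking G Q. f w \<noteq> 0}. y ^ (?m - ?n - sum f (verts G))) =
        (\<Sum>f\<in>parking G' Q. y ^ (card (edges G') - ?n - sum f (verts G)))"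
    proof -
      have inj: "inj_on (\<lambda>f. f(w := Suc (f w))) (parking G' Q)"
      proof (rule inj_onI)
        fix f g :: "'v \<Rightarrow> nat" assume eq: "f(w := Suc (f w)) = g(w := Suc (g w))"
        show "f = g"
        proof
          fix v show "f v = g v" using fun_cong[OF eq, of v] by (cases "v = w") auto
        qed
      qed
      show ?thesis
        unfolding pd sum.reindex[OF inj]
      proof (rule sum.cong)
        \<comment> \<open>Deletion loses one edge while f loses one unit at \<open>w\<close>, so
          again the exponent stays the same.\<close>
        have "?m - ?n - Suc s = card (edges G') - ?n - s" for s using cG' by linarith
        then show "((\<lambda>f. y ^ (?m - ?n - sum f (verts G))) \<circ> (\<lambda>f. f(w := Suc (f w)))) f =
            y ^ (card (edges G') - ?n - sum f (verts G))" for f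
          by (simp only: o_apply sum_upd)
      qed simp
    qed
    also have "\<dots> = (\<Sum>A | A \<subseteq> edges G' \<and> reaching G' Q A. (y - 1) ^ (card A - ?n))"
      by (rule IHd2[symmetric])
    also have "(\<Sum>A\<in>insert e ` {A. A \<subseteq> edges G' \<and> reaching G' (insert w Q) A}. (y - 1) ^ (card A - ?n)) + \<dots> =
        (\<Sum>A\<in>insert e ` {A. A \<subseteq> edges G' \<and> reaching G' (insert w Q) A} \<union>
          {A. A \<subseteq> edges G' \<and> reaching G' Q A}. (y - 1) ^ (card A - ?n))"
    proof (rule sum.union_disjoint[symmetric])
      have "finite {A. A \<subseteq> edges G' }" using fin by (simp add: G'_sel)
      then show "finite {A. A \<subseteq> edges G' \<and> reaching G' Q A}"
        and "finite (insert e ` {A. A \<subseteq> edges G' \<and> reaching G' (insert w Q) A})"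
        by (auto elim!: rev_finite_subset)
    qed (auto simp: G'_sel)
    also have "insert e ` {A. A \<subseteq> edges G' \<and> reaching G' (insert w Q) A} \<union>
          {A. A \<subseteq> edges G' \<and> reaching G' Q A} = {A. A \<subseteq> edges G \<and> reaching G Q A}" (is "?L = ?R")
    proof (intro equalityI subsetI)
      fix A assume "A \<in> ?L"
      then show "A \<in> ?R"
        using reaching_insert[OF ctx, folded G'_def] edge(1) by (auto simp: G'_sel rG')
    next
      fix A assume A: "A \<in> ?R"
      show "A \<in> ?L"
      proof (cases "e \<in> A")
        case True
        then have "A = insert e (A - {e})" by auto
        then have "reaching G' (insert w Q) (A - {e})" 
          using reaching_insert[OF ctx, folded G'_def, of "A - {e}"] A by auto
        then have "A - {e} \<in> {A. A \<subseteq> edges G' \<and> reaching G' (insert w Q) A}" using A by (auto simp: G'_sel)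
        then have "insert e (A - {e}) \<in> insert e ` {A. A \<subseteq> edges G' \<and> reaching G' (insert w Q) A}" by (rule imageI)
        then show ?thesis using \<open>A = insert e (A - {e})\<close> by simp
      next
        case False
        then show ?thesis using A by (auto simp: G'_sel rG')
      qed
    qed
    finally show ?thesis using bound by simp
  qed
qed

section \<open>Connectedness and the Tutte polynomial at x = 1\<close>

lemma adjacency_sym: "sym (adjacency G A)"
  by (auto simp: sym_def adjacency_def insert_commute)

text \<open>Reaching everything from a single root is connectedness of the spanning subgraph; this
  links the rank in the Tutte polynomial to the recursion, where larger root sets express
  connectedness after merging.\<close>

lemma components_eq_singleton_iff:
  assumes "q \<in> verts G"
  shows "card (components G A) = 1 \<longleftrightarrow> reaching G {q} A"
proof -
  let ?r = "{(u, w). u \<in> verts G \<and> w \<in> verts G \<and> (u, w) \<in> (adjacency G A)\<^sup>*}"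
  have eq: "equiv (verts G) ?r"
    using sym_rtrancl[OF adjacency_sym, of G A]
    by (auto simp: equiv_def refl_on_def sym_def intro!: transI elim: rtrancl_trans)
  show ?thesis
  proof
    assume "card (components G A) = 1"
    then obtain C where C: "components G A = {C}" by (auto simp: card_1_singleton_iff)
    have "(q, w) \<in> ?r" if "w \<in> verts G" for w
    proof -
      have "?r `` {q} \<in> {C}" "?r `` {w} \<in> {C}"
        unfolding C[symmetric] components_def using quotientI[OF assms] quotientI[OF that] by blast+
      then show ?thesis using eq_equiv_class_iff[OF eq assms that] by auto
    qed
    then show "reaching G {q} A" by (auto simp: reaching_def)
  next
    assume R: "reaching G {q} A"
    have "components G A = {?r `` {q}}"
    proof -
      have "?r `` {w} = ?r `` {q}" if "w \<in> verts G" for w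
        using R that assms eq_equiv_class_iff[OF eq that assms] eq_equiv_class_iff[OF eq assms that]
        by (auto simp: reaching_def)
      then have "(\<lambda>w. ?r `` {w}) ` verts G = (\<lambda>w. ?r `` {q}) ` verts G" by (rule image_cong[OF refl])
      also have "\<dots> = {?r `` {q}}" using assms by (simp only: image_constant)
      finally show ?thesis by (simp only: components_def quotient_def UNION_singleton_eq_range)
    qed
    then show "card (components G A) = 1" by simp
  qed
qed

text \<open>At x = 1 the first factor is a power of 0. It is 1 for edge sets of full rank, as the
  exponent is then 0, and 0 otherwise; so the sum runs over the connected spanning
  subgraphs.\<close>

lemma tutte_1_eq_parking_sum:
  fixes y :: "'a::comm_ring_1"
  assumes G: "multigraph G" and con: "connected_mgraph G" and q: "q \<in> verts G"
  shows "tutte G 1 y = (\<Sum>f\<in>parking G {q}. y ^ (card (edges G) - (card (verts G) - 1) - sum f (verts G)))"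
proof -
  have fin: "finite (verts G)" "finite (edges G)" using G by (auto simp: multigraph_def)
  have n: "card (verts G) \<ge> 1" using q fin by (auto simp: Suc_le_eq card_gt_0_iff)
  have cq: "card (verts G - {q}) = card (verts G) - 1" using q fin by simp
  have "reaching G {q} (edges G)" using con q by (auto simp: connected_mgraph_def reaching_def)
  then have "card (components G (edges G)) = 1" using components_eq_singleton_iff[OF q] by blast
  then have rE: "edge_rank G (edges G) = card (verts G) - 1" by (simp only: edge_rank_def)
  have *: "(1 - 1 :: 'a) ^ (edge_rank G (edges G) - edge_rank G A) * (y - 1) ^ (card A - edge_rank G A) =
      (if reaching G {q} A then (y - 1) ^ (card A - card (verts G - {q})) else 0)" for A
  proof (cases "reaching G {q} A")
    case True
    then have "card (components G A) = 1" using components_eq_singleton_iff[OF q] by blast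
    then have "edge_rank G A = card (verts G) - 1" by (simp only: edge_rank_def)
    then show ?thesis using True rE cq by simp
  next
    case False
    then have "card (components G A) \<noteq> 1" using components_eq_singleton_iff[OF q] by blast
    \<comment> \<open>With this bound the natural subtraction in \<open>edge_rank\<close> is a true
      difference, so having two or more components strictly lowers the rank.\<close>
    moreover have "card (components G A) \<le> card (verts G)"
      unfolding components_def quotient_def using fin card_image_le[of "verts G"]
      by (simp add: UNION_singleton_eq_range)
    moreover have "card (components G A) \<noteq> 0"
      using q fin by (auto simp: components_def quotient_def card_eq_0_iff)
    ultimately have "edge_rank G (edges G) - edge_rank G A > 0" using rE by (auto simp: edge_rank_def)
    then have "(1 - 1 :: 'a) ^ (edge_rank G (edges G) - edge_rank G A) = 0" by (simp add: zero_power)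
    then show ?thesis using False by simp
  qed
  have "tutte G 1 y = (\<Sum>A\<in>{A \<in> Pow (edges G). reaching G {q} A}. (y - 1) ^ (card A - card (verts G - {q})))"
    unfolding tutte_def * using fin by (subst sum.inter_filter) auto
  also have "{A \<in> Pow (edges G). reaching G {q} A} = {A. A \<subseteq> edges G \<and> reaching G {q} A}" by auto
  also have "(\<Sum>A\<in>\<dots>. (y - 1) ^ (card A - card (verts G - {q}))) =
      (\<Sum>f\<in>parking G {q}. y ^ (card (edges G) - card (verts G - {q}) - sum f (verts G)))"
    using reaching_sum_eq_parking_sum[OF G, of "{q}" y] q by blast
  finally show ?thesis unfolding cq .
qed

text \<open>The bound |f| \<le> g obtained along with the sum identity; it does not mention the ring
  element, for which \<open>0::int\<close> is an arbitrary choice.\<close>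

lemma parking_sum_le:
  assumes "multigraph G" "q \<in> verts G" "f \<in> parking G {q}"
  shows "card (verts G) + sum f (verts G) \<le> card (edges G) + 1"
  using reaching_sum_eq_parking_sum[of G "{q}" "0::int"] assms by (auto simp: card_Diff_singleton_if)

text \<open>A path from a set \<open>U\<close> to the root must leave \<open>U\<close>, so some
  vertex of \<open>U\<close> has positive cut degree. This parking function later keeps the
  coefficients of the Hilbert series nonzero in large degrees.\<close>

lemma zero_in_parking:
  assumes G: "multigraph G" and con: "connected_mgraph G" and q: "q \<in> verts G"
  shows "(\<lambda>_. 0) \<in> parking G {q}"
proof -
  have "\<exists>v\<in>U. 0 < cut_degree G U v" if U: "U \<noteq> {}" "U \<subseteq> verts G - {q}" for U
  proof (rule ccontr)
    assume "\<not> ?thesis"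
    then have no: "cut_degree G U v = 0" if "v \<in> U" for v using that by auto
    obtain u where u: "u \<in> U" using U by auto
    have "(u, q) \<in> (adjacency G (edges G))\<^sup>*" using con u U q by (auto simp: connected_mgraph_def)
    then have "q \<in> U"
    proof induction
      case (step x z)
      then obtain e where e: "e \<in> edges G" "ends G e = {x, z}" by (auto simp: adjacency_def)
      then have z: "z \<in> verts G" using G by (auto simp: multigraph_def)
      have "finite (edges G)" using G by (simp add: multigraph_def)
      then have "{e \<in> edges G. \<exists>w\<in>verts G - U. ends G e = {x, w}} = {}"
        using no[OF step.IH] by (simp add: cut_degree_def)
      then show ?case using e z by auto
    qed (use u in auto)
    then show False using U by auto
  qed
  then show ?thesis by (intro parkingI) auto
qed

section \<open>Polynomials with prescribed monomials\<close>

text \<open>The ring, its graded pieces, M_G and the ideals of pure powers are all spanned by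
  monomials; this one notion turns membership in any of them into a condition on the
  support.\<close>

definition mon_span :: "('v \<Rightarrow>\<^sub>0 nat) set \<Rightarrow> ('v, 'k::field) mpoly set" where
  "mon_span S = {p. Poly_Mapping.keys p \<subseteq> S}"

lemma mon_span_0 [simp, intro]: "0 \<in> mon_span S"
  by (simp add: mon_span_def)

lemma mon_span_add [intro]: "p \<in> mon_span S \<Longrightarrow> p' \<in> mon_span S \<Longrightarrow> p + p' \<in> mon_span S"
  using Poly_Mapping.keys_add[of p p'] unfolding mon_span_def by blast

lemma keys_uminus [simp]: "Poly_Mapping.keys (- p) = Poly_Mapping.keys (p :: 'a \<Rightarrow>\<^sub>0 'b::ab_group_add)"
  by (auto simp: in_keys_iff)

lemma mon_span_uminus [intro]: "p \<in> mon_span S \<Longrightarrow> - p \<in> mon_span S"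
  unfolding mon_span_def by simp

lemma mon_span_diff [intro]: "p \<in> mon_span S \<Longrightarrow> p' \<in> mon_span S \<Longrightarrow> p - p' \<in> mon_span S"
  using mon_span_add[OF _ mon_span_uminus] by fastforce

lemma mon_span_sum [intro]: "(\<And>x. x \<in> A \<Longrightarrow> f x \<in> mon_span S) \<Longrightarrow> sum f A \<in> mon_span S"
  by (induction A rule: infinite_finite_induct) auto

lemma mon_span_mult:
  assumes "p \<in> mon_span S" "p' \<in> mon_span T" "\<And>m m'. m \<in> S \<Longrightarrow> m' \<in> T \<Longrightarrow> m + m' \<in> U"
  shows "p * p' \<in> mon_span U"
proof -
  have "Poly_Mapping.keys (p * p') \<subseteq> {m + m' | m m'. m \<in> Poly_Mapping.keys p \<and> m' \<in> Poly_Mapping.keys p'}"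
    by (rule keys_mult)
  then show ?thesis using assms unfolding mon_span_def by blast
qed

lemma mon_span_mono: "S \<subseteq> T \<Longrightarrow> p \<in> mon_span S \<Longrightarrow> p \<in> mon_span T"
  unfolding mon_span_def by blast

lemma single_in_mon_span: "m \<in> S \<Longrightarrow> Poly_Mapping.single m c \<in> mon_span S"
  by (auto simp: mon_span_def)

lemma poly_mapping_eq_sum_single:
  assumes "Poly_Mapping.keys p \<subseteq> A" "finite A"
  shows "p = (\<Sum>m\<in>A. Poly_Mapping.single m (Poly_Mapping.lookup p m))"
proof (rule poly_mapping_eqI)
  fix k
  have "(\<Sum>m\<in>A. Poly_Mapping.lookup (Poly_Mapping.single m (Poly_Mapping.lookup p m)) k) =
      (\<Sum>m\<in>A. if m = k then Poly_Mapping.lookup p m else 0)"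
    by (intro sum.cong) (auto simp: lookup_single when_def)
  also have "\<dots> = Poly_Mapping.lookup p k" using assms by (auto simp: in_keys_iff)
  finally show "Poly_Mapping.lookup p k =
      Poly_Mapping.lookup (\<Sum>m\<in>A. Poly_Mapping.single m (Poly_Mapping.lookup p m)) k"
    by (simp add: lookup_sum)
qed

text \<open>The linear projection along the remaining monomials. It provides homogeneous components
  as well as the parts inside and outside a monomial ideal.\<close>

definition mon_proj :: "('v \<Rightarrow>\<^sub>0 nat) set \<Rightarrow> ('v, 'k::field) mpoly \<Rightarrow> ('v, 'k) mpoly" where
  "mon_proj S p = (\<Sum>m\<in>Poly_Mapping.keys p \<inter> S. Poly_Mapping.single m (Poly_Mapping.lookup p m))"

lemma lookup_mon_proj:
  "Poly_Mapping.lookup (mon_proj S p) m = (if m \<in> S then Poly_Mapping.lookup p m else 0)"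
proof -
  have "Poly_Mapping.lookup (mon_proj S p) m =
      (\<Sum>m'\<in>Poly_Mapping.keys p \<inter> S. if m' = m then Poly_Mapping.lookup p m' else 0)"
    unfolding mon_proj_def lookup_sum by (intro sum.cong) (auto simp: lookup_single when_def)
  also have "\<dots> = (if m \<in> S then Poly_Mapping.lookup p m else 0)"
    by (auto simp: in_keys_iff)
  finally show ?thesis .
qed

lemma mon_proj_add: "mon_proj S (p + p') = mon_proj S p + mon_proj S p'"
  by (rule poly_mapping_eqI) (simp add: lookup_mon_proj lookup_add)

lemma mon_proj_diff: "mon_proj S (p - p') = mon_proj S p - mon_proj S p'"
  by (rule poly_mapping_eqI) (simp add: lookup_mon_proj lookup_minus)

lemma mon_proj_0 [simp]: "mon_proj S 0 = 0"
  by (rule poly_mapping_eqI) (simp add: lookup_mon_proj)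

lemma mon_proj_sum: "mon_proj S (sum f A) = (\<Sum>x\<in>A. mon_proj S (f x))"
  by (induction A rule: infinite_finite_induct) (auto simp: mon_proj_add)

lemma mon_proj_in: "p \<in> mon_span T \<Longrightarrow> mon_proj S p \<in> mon_span (S \<inter> T)"
  by (auto simp: mon_span_def in_keys_iff lookup_mon_proj split: if_splits)

lemma mon_proj_id: "p \<in> mon_span S \<Longrightarrow> mon_proj S p = p"
  by (rule poly_mapping_eqI) (auto simp: lookup_mon_proj mon_span_def in_keys_iff)

lemma mon_proj_eq_0: "p \<in> mon_span T \<Longrightarrow> S \<inter> T = {} \<Longrightarrow> mon_proj S p = 0"
  by (rule poly_mapping_eqI) (auto simp: lookup_mon_proj mon_span_def in_keys_iff)

lemma mon_proj_split: "p = mon_proj S p + mon_proj (- S) p"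
  by (rule poly_mapping_eqI) (simp add: lookup_mon_proj lookup_add)

text \<open>Multiplication by a monomial shifts exponents injectively, so no terms can collide or
  cancel.\<close>

lemma lookup_single_mult:
  "Poly_Mapping.lookup (Poly_Mapping.single m c * p) (m + m') = c * Poly_Mapping.lookup p (m' :: 'v \<Rightarrow>\<^sub>0 nat)"
  for p :: "('v, 'k::field) mpoly"
proof -
  have p: "p = (\<Sum>n\<in>Poly_Mapping.keys p. Poly_Mapping.single n (Poly_Mapping.lookup p n))"
    by (rule poly_mapping_eq_sum_single) auto
  have "Poly_Mapping.lookup (Poly_Mapping.single m c * p) (m + m') =
      (\<Sum>n\<in>Poly_Mapping.keys p. Poly_Mapping.lookup (Poly_Mapping.single (m + n) (c * Poly_Mapping.lookup p n)) (m + m'))"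
    by (subst p) (simp add: sum_distrib_left lookup_sum mult_single)
  also have "\<dots> = (\<Sum>n\<in>Poly_Mapping.keys p. if n = m' then c * Poly_Mapping.lookup p n else 0)"
    by (intro sum.cong) (auto simp: lookup_single when_def)
  also have "\<dots> = c * Poly_Mapping.lookup p m'" by (auto simp: in_keys_iff)
  finally show ?thesis .
qed

lemma lookup_const_poly_mult:
  "Poly_Mapping.lookup (const_poly c * p) m = c * Poly_Mapping.lookup p m"
  using lookup_single_mult[of 0 c p m] by (simp add: const_poly_def)

lemma const_poly_mult_in: "p \<in> mon_span S \<Longrightarrow> const_poly c * p \<in> mon_span S"
  by (auto simp: mon_span_def in_keys_iff lookup_const_poly_mult)

lemma const_poly_add: "const_poly (c + c') = const_poly c + const_poly c'"
  by (simp add: const_poly_def single_add)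

lemma const_poly_mult: "const_poly (c * c') = const_poly c * const_poly c'"
  by (simp add: const_poly_def mult_single)

lemma const_poly_0 [simp]: "const_poly 0 = 0"
  by (simp add: const_poly_def)

lemma mon_degree_eq_sum:
  assumes "finite A" "Poly_Mapping.keys m \<subseteq> A"
  shows "mon_degree m = (\<Sum>v\<in>A. Poly_Mapping.lookup m v)"
  unfolding mon_degree_def using assms by (intro sum.mono_neutral_left) (auto simp: in_keys_iff)

lemma mon_degree_add: "mon_degree (m + m') = mon_degree m + mon_degree m'"
proof -
  let ?A = "Poly_Mapping.keys m \<union> Poly_Mapping.keys m'"
  have "mon_degree (m + m') = (\<Sum>v\<in>?A. Poly_Mapping.lookup (m + m') v)"
    using Poly_Mapping.keys_add[of m m'] by (intro mon_degree_eq_sum) auto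
  then show ?thesis
    by (simp add: mon_degree_eq_sum[of ?A m] mon_degree_eq_sum[of ?A m'] lookup_add sum.distrib)
qed

lemma keys_add_nat: "Poly_Mapping.keys (m + m') = Poly_Mapping.keys m \<union> Poly_Mapping.keys (m' :: 'v \<Rightarrow>\<^sub>0 nat)"
  by (auto simp: in_keys_iff lookup_add)

lemma carrier_poly_ring: "carrier (poly_ring V) = mon_span {m. Poly_Mapping.keys m \<subseteq> V}"
  by (auto simp: poly_ring_def mon_span_def)

lemma homogeneous_eq_mon_span:
  "homogeneous V j = mon_span {m. Poly_Mapping.keys m \<subseteq> V \<and> int (mon_degree m) = j}"
  unfolding homogeneous_def carrier_poly_ring by (auto simp: mon_span_def)

lemma homogeneous_subset: "p \<in> homogeneous V j \<Longrightarrow> p \<in> carrier (poly_ring V)"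
  by (simp add: homogeneous_def)

lemma homogeneous_mult:
  "p \<in> homogeneous V i \<Longrightarrow> p' \<in> homogeneous V j \<Longrightarrow> p * p' \<in> homogeneous V (i + j)"
  unfolding homogeneous_eq_mon_span
  by (erule (1) mon_span_mult) (auto simp: keys_add_nat mon_degree_add)

lemma carrier_mult:
  "p \<in> carrier (poly_ring V) \<Longrightarrow> p' \<in> carrier (poly_ring V) \<Longrightarrow> p * p' \<in> carrier (poly_ring V)"
  unfolding carrier_poly_ring by (erule (1) mon_span_mult) (auto simp: keys_add_nat)

lemma one_homogeneous: "1 \<in> homogeneous V 0"
  by (simp add: homogeneous_eq_mon_span mon_span_def mon_degree_def)

definition hom_comp :: "int \<Rightarrow> ('v, 'k::field) mpoly \<Rightarrow> ('v, 'k) mpoly" where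
  "hom_comp j = mon_proj {m. int (mon_degree m) = j}"

lemma hom_comp_in: "p \<in> carrier (poly_ring V) \<Longrightarrow> hom_comp j p \<in> homogeneous V j"
  unfolding carrier_poly_ring homogeneous_eq_mon_span hom_comp_def
  by (drule mon_proj_in) (auto elim!: mon_span_mono[rotated])

lemma hom_comp_id: "p \<in> homogeneous V j \<Longrightarrow> hom_comp j p = p"
  unfolding homogeneous_eq_mon_span hom_comp_def
  by (rule mon_proj_id) (auto elim!: mon_span_mono[rotated])

text \<open>The components of \<open>p'\<close> in degrees other than \<open>j - i\<close>
  contribute nothing to degree \<open>j\<close> of the product. This is what allows arbitrary lifts
  to be replaced by homogeneous ones.\<close>

lemma hom_comp_mult:
  assumes "p \<in> homogeneous V i"
  shows "hom_comp j (p' * p) = hom_comp (j - i) p' * p"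
proof -
  let ?S = "{m. int (mon_degree m) = j - i}" and ?P = "{m. int (mon_degree m) = i}"
  have p: "p \<in> mon_span ?P" using assms unfolding homogeneous_eq_mon_span by (auto elim!: mon_span_mono[rotated])
  have 1: "mon_proj ?S p' * p \<in> mon_span {m. int (mon_degree m) = j}"
    using mon_proj_in[of p' UNIV ?S] by (intro mon_span_mult[OF _ p, of _ ?S]) (auto simp: mon_span_def mon_degree_add)
  have 2: "mon_proj (- ?S) p' * p \<in> mon_span (- {m. int (mon_degree m) = j})"
    using mon_proj_in[of p' UNIV "- ?S"]
    by (intro mon_span_mult[OF _ p, of _ "- ?S"]) (auto simp: mon_span_def mon_degree_add)
  have "p' * p = mon_proj ?S p' * p + mon_proj (- ?S) p' * p"
    by (subst mon_proj_split[of p' ?S]) (rule distrib_right)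
  then show ?thesis
    unfolding hom_comp_def
    by (simp add: mon_proj_add mon_proj_id[OF 1] mon_proj_eq_0[OF 2])
qed

text \<open>The second conclusion keeps the support of the quotient under control, from which its
  variables and its degree are read off later.\<close>

lemma mon_span_divide:
  assumes "\<And>m. m \<in> Poly_Mapping.keys p \<Longrightarrow> \<exists>m'. m = n + m'"
  shows "\<exists>p'. p = Poly_Mapping.single n 1 * p' \<and>
    (\<forall>m'\<in>Poly_Mapping.keys p'. n + m' \<in> Poly_Mapping.keys (p :: ('v, 'k::field) mpoly))"
proof -
  define p' where "p' = (\<Sum>m\<in>Poly_Mapping.keys p. Poly_Mapping.single (m - n) (Poly_Mapping.lookup p m))"
  have nm: "n + (m - n) = m" if "m \<in> Poly_Mapping.keys p" for m
    using assms[OF that] by auto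
  have "Poly_Mapping.single n 1 * p' = (\<Sum>m\<in>Poly_Mapping.keys p. Poly_Mapping.single m (Poly_Mapping.lookup p m))"
    unfolding p'_def sum_distrib_left by (intro sum.cong) (auto simp: mult_single nm)
  also have "\<dots> = p" by (rule poly_mapping_eq_sum_single[symmetric]) auto
  finally have p: "p = Poly_Mapping.single n 1 * p'" ..
  moreover have "n + m' \<in> Poly_Mapping.keys p" if "m' \<in> Poly_Mapping.keys p'" for m'
    using that lookup_single_mult[of n 1 p' m'] p by (auto simp: in_keys_iff)
  ultimately show ?thesis by blast
qed

section \<open>Free complexes and null-homotopies\<close>

definition vpair :: "nat \<Rightarrow> (nat \<Rightarrow> 'r::comm_ring_1) \<Rightarrow> (nat \<Rightarrow> 'r) \<Rightarrow> 'r" where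
  "vpair b f c = (\<Sum>k<b. f k * c k)"

definition evec :: "nat \<Rightarrow> nat \<Rightarrow> 'r::comm_ring_1" where
  "evec k = (\<lambda>l. if l = k then 1 else 0)"

text \<open>\<open>D i k\<close> is the image in \<open>F i\<close> of the \<open>k\<close>-th basis vector of \<open>F (i + 1)\<close>. A linear map
  from \<open>F i\<close> to the polynomial ring is represented by the vector of its values on the basis, so
  that \<open>vpair\<close> evaluates it.\<close>

locale free_complex =
  fixes V :: "'v set" and a :: "nat \<Rightarrow> int list"
    and D :: "nat \<Rightarrow> nat \<Rightarrow> nat \<Rightarrow> ('v, 'k::field) mpoly"
  assumes D_homogeneous: "k < length (a (Suc i)) \<Longrightarrow> l < length (a i) \<Longrightarrow>
      D i k l \<in> homogeneous V (a (Suc i) ! k - a i ! l)"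
    and D_eq_0: "k < length (a (Suc i)) \<Longrightarrow> length (a i) \<le> l \<Longrightarrow> D i k l = 0"
begin

abbreviation R where "R \<equiv> carrier (poly_ring V) :: ('v, 'k) mpoly set"

abbreviation rk where "rk i \<equiv> length (a i)"

definition F :: "nat \<Rightarrow> (nat \<Rightarrow> ('v, 'k) mpoly) set" where
  "F i = {f. (\<forall>k. f k \<in> R) \<and> (\<forall>k\<ge>rk i. f k = 0)}"

definition grF :: "nat \<Rightarrow> int \<Rightarrow> (nat \<Rightarrow> ('v, 'k) mpoly) set" where
  "grF i t = {f. (\<forall>k<rk i. f k \<in> homogeneous V (t - a i ! k)) \<and> (\<forall>k\<ge>rk i. f k = 0)}"

definition diff :: "nat \<Rightarrow> (nat \<Rightarrow> ('v, 'k) mpoly) \<Rightarrow> nat \<Rightarrow> ('v, 'k) mpoly" where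
  "diff i f = (\<lambda>l. vpair (rk (Suc i)) f (\<lambda>k. D i k l))"

text \<open>The \<open>k\<close>-th basis vector has degree \<open>a i ! k\<close>, so a map of
  degree \<open>j\<close> to the ring sends it to degree \<open>j + a i ! k\<close>.\<close>

definition cochain :: "nat \<Rightarrow> int \<Rightarrow> (nat \<Rightarrow> ('v, 'k) mpoly) set" where
  "cochain i j = {c. (\<forall>k<rk i. c k \<in> homogeneous V (j + a i ! k)) \<and> (\<forall>k\<ge>rk i. c k = 0)}"

text \<open>Precomposition with \<open>diff\<close>, in coordinates. The value 0 beyond the rank
  makes the coordinate vector of a map unique.\<close>

definition delta :: "nat \<Rightarrow> (nat \<Rightarrow> ('v, 'k) mpoly) \<Rightarrow> nat \<Rightarrow> ('v, 'k) mpoly" where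
  "delta i c = (\<lambda>k. if k < rk (Suc i) then vpair (rk i) (D i k) c else 0)"

lemma R_0 [simp]: "0 \<in> R" and R_1 [simp]: "1 \<in> R"
  using homogeneous_subset[OF one_homogeneous] by (auto simp: carrier_poly_ring)

lemma R_add: "p \<in> R \<Longrightarrow> p' \<in> R \<Longrightarrow> p + p' \<in> R"
  and R_diff: "p \<in> R \<Longrightarrow> p' \<in> R \<Longrightarrow> p - p' \<in> R"
  and R_sum: "(\<And>x. x \<in> A \<Longrightarrow> g x \<in> R) \<Longrightarrow> sum g A \<in> R"
  unfolding carrier_poly_ring by auto

lemma hom_0 [simp]: "0 \<in> homogeneous V j"
  and hom_diff: "p \<in> homogeneous V j \<Longrightarrow> p' \<in> homogeneous V j \<Longrightarrow> p - p' \<in> homogeneous V j"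
  and hom_sum: "(\<And>x. x \<in> A \<Longrightarrow> g x \<in> homogeneous V j) \<Longrightarrow> sum g A \<in> homogeneous V j"
  unfolding homogeneous_eq_mon_span by auto

lemma D_R: "k < rk (Suc i) \<Longrightarrow> D i k l \<in> R"
  using D_homogeneous[of k i l] D_eq_0[of k i l] by (cases "l < rk i") (auto intro: homogeneous_subset)

lemma D_in_F: "k < rk (Suc i) \<Longrightarrow> D i k \<in> F i"
  using D_R D_eq_0 by (auto simp: F_def)

lemma grF_subset: "f \<in> grF i t \<Longrightarrow> f \<in> F i"
proof -
  assume f: "f \<in> grF i t"
  have "f k \<in> R" for k
    using f homogeneous_subset[of "f k"] by (cases "k < rk i") (auto simp: grF_def)
  then show ?thesis using f by (simp add: F_def grF_def)
qed

lemma cochain_subset: "f \<in> cochain i t \<Longrightarrow> f \<in> F i"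
proof -
  assume f: "f \<in> cochain i t"
  have "f k \<in> R" for k
    using f homogeneous_subset[of "f k"] by (cases "k < rk i") (auto simp: cochain_def)
  then show ?thesis using f by (simp add: F_def cochain_def)
qed

lemma vpair_R: "f \<in> F i \<Longrightarrow> (\<And>k. k < b \<Longrightarrow> c k \<in> R) \<Longrightarrow> vpair b f c \<in> R"
  unfolding vpair_def F_def by (auto intro!: R_sum carrier_mult)

lemma diff_in_F:
  assumes "f \<in> F (Suc i)"
  shows "diff i f \<in> F i"
  using assms D_eq_0[of _ i] D_R[of _ i] unfolding diff_def
  by (auto simp: F_def[of i] intro!: vpair_R) (auto simp: vpair_def)

text \<open>Adjointness of \<open>delta\<close> and \<open>diff\<close>, by exchanging two finite
  sums.\<close>

lemma vpair_delta:
  "vpair (rk (Suc i)) f (delta i c) = vpair (rk i) (diff i f) c"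
proof -
  have "vpair (rk (Suc i)) f (delta i c) = (\<Sum>k<rk (Suc i). \<Sum>l<rk i. f k * (D i k l * c l))"
    unfolding vpair_def delta_def by (intro sum.cong) (auto simp: sum_distrib_left vpair_def)
  also have "\<dots> = (\<Sum>l<rk i. \<Sum>k<rk (Suc i). f k * (D i k l * c l))" by (rule sum.swap)
  also have "\<dots> = vpair (rk i) (diff i f) c"
    unfolding vpair_def diff_def by (intro sum.cong) (auto simp: sum_distrib_right mult.assoc)
  finally show ?thesis .
qed

lemma vpair_hom:
  assumes "\<And>k. k < b \<Longrightarrow> f k \<in> homogeneous V (s - u k)" "\<And>k. k < b \<Longrightarrow> c k \<in> homogeneous V (t + u k)"
  shows "vpair b f c \<in> homogeneous V (s + t)"
  unfolding vpair_def
proof (rule hom_sum)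
  fix k assume "k \<in> {..<b}"
  then show "f k * c k \<in> homogeneous V (s + t)"
    using homogeneous_mult[OF assms(1,2), of k k] by simp
qed

lemma delta_in_cochain:
  assumes "c \<in> cochain i j"
  shows "delta i c \<in> cochain (Suc i) j"
proof -
  have "vpair (rk i) (D i k) c \<in> homogeneous V (j + a (Suc i) ! k)" if "k < rk (Suc i)" for k
    using assms D_homogeneous[OF that] unfolding cochain_def
    by (subst add.commute, intro vpair_hom[where u = "\<lambda>l. a i ! l"]) auto
  then show ?thesis unfolding delta_def cochain_def by auto
qed

lemma delta_in_F:
  assumes "c \<in> F i"
  shows "delta i c \<in> F (Suc i)"
  using assms D_in_F[of _ i] unfolding delta_def
  by (auto simp: F_def[of "Suc i"] intro!: vpair_R) (auto simp: F_def)

lemma delta_diff: "delta i (\<lambda>k. c k - c' k) = (\<lambda>k. delta i c k - delta i c' k)"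
  by (auto simp: delta_def vpair_def sum_subtractf algebra_simps)

lemma delta_add: "delta i (\<lambda>k. c k + c' k) = (\<lambda>k. delta i c k + delta i c' k)"
  by (auto simp: delta_def vpair_def sum.distrib algebra_simps)

lemma delta_0 [simp]: "delta i (\<lambda>k. 0) = (\<lambda>k. 0)"
  by (auto simp: delta_def vpair_def)

lemma delta_mult: "delta i (\<lambda>k. p * c k) = (\<lambda>k. p * delta i c k)"
  by (auto simp: delta_def vpair_def sum_distrib_left algebra_simps)

lemma delta_sum: "delta i (\<lambda>k. \<Sum>x\<in>A. c x k) = (\<lambda>k. \<Sum>x\<in>A. delta i (c x) k)"
  by (induction A rule: infinite_finite_induct) (auto simp: delta_add)

lemma cochain_diff: "c \<in> cochain i j \<Longrightarrow> c' \<in> cochain i j \<Longrightarrow> (\<lambda>k. c k - c' k) \<in> cochain i j"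
  by (auto simp: cochain_def intro!: hom_diff)

lemma cochain_mult:
  "p \<in> homogeneous V e \<Longrightarrow> c \<in> cochain i j \<Longrightarrow> (\<lambda>k. p * c k) \<in> cochain i (j + e)"
  using homogeneous_mult[of p V e] unfolding cochain_def
  by (simp add: add.commute add.left_commute) (metis add.commute add.left_commute)

lemma cochain_0 [simp]: "(\<lambda>k. 0) \<in> cochain i j"
  by (auto simp: cochain_def)

lemma const_poly_homogeneous: "const_poly c \<in> homogeneous V 0"
  using const_poly_mult_in[OF one_homogeneous[unfolded homogeneous_eq_mon_span], of c]
  unfolding homogeneous_eq_mon_span by simp

lemma cochain_scale: "c \<in> cochain i j \<Longrightarrow> (\<lambda>k. const_poly r * c k) \<in> cochain i j"
  using cochain_mult[OF const_poly_homogeneous, of c i j r] by simp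

lemma cochain_sum: "(\<And>x. x \<in> A \<Longrightarrow> c x \<in> cochain i j) \<Longrightarrow> (\<lambda>k. \<Sum>x\<in>A. c x k) \<in> cochain i j"
  by (auto simp: cochain_def intro!: hom_sum)

lemma evec_in_F: "k < rk i \<Longrightarrow> evec k \<in> F i"
  by (auto simp: evec_def F_def)

lemma vpair_evec: "k < b \<Longrightarrow> vpair b (\<lambda>l. p * evec k l) c = p * c k"
proof -
  assume k: "k < b"
  have "vpair b (\<lambda>l. p * evec k l) c = (\<Sum>l<b. if l = k then p * c k else 0)"
    unfolding vpair_def evec_def by (intro sum.cong) auto
  then show ?thesis using k by simp
qed

lemma vpair_diff: "vpair b (\<lambda>l. f l - g l) c = vpair b f c - vpair b g c"
  by (simp add: vpair_def sum_subtractf algebra_simps)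

lemma vpair_mult: "vpair b (\<lambda>l. p * f l) c = p * vpair b f c"
  by (simp add: vpair_def sum_distrib_left algebra_simps)

lemma vpair_sum: "vpair b (\<lambda>l. \<Sum>x\<in>A. f x l) c = (\<Sum>x\<in>A. vpair b (f x) c)"
  unfolding vpair_def sum_distrib_right by (rule sum.swap)

lemma diff_evec: "k < rk (Suc i) \<Longrightarrow> diff i (\<lambda>l. p * evec k l) = (\<lambda>l. p * D i k l)"
  unfolding diff_def by (simp add: vpair_evec)

lemma F_mult: "p \<in> R \<Longrightarrow> f \<in> F i \<Longrightarrow> (\<lambda>l. p * f l) \<in> F i"
  by (auto simp: F_def intro!: carrier_mult)

lemma F_diff: "f \<in> F i \<Longrightarrow> g \<in> F i \<Longrightarrow> (\<lambda>l. f l - g l) \<in> F i"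
  by (auto simp: F_def intro!: R_diff)

end

text \<open>The augmentation \<open>F 0 \<rightarrow> R/M\<close> sends the \<open>k\<close>-th basis vector to
  the class of \<open>ep k\<close>.\<close>

locale free_res = free_complex V a D
  for V :: "'v set" and a and D :: "nat \<Rightarrow> nat \<Rightarrow> nat \<Rightarrow> ('v, 'k::field) mpoly" +
  fixes ep :: "nat \<Rightarrow> ('v, 'k) mpoly" and M :: "('v, 'k) mpoly set"
  assumes exact: "f \<in> F (Suc i) \<Longrightarrow> diff i f = (\<lambda>_. 0) \<longleftrightarrow> f \<in> diff (Suc i) ` F (Suc (Suc i))"
    and exact_0: "f \<in> F 0 \<Longrightarrow> vpair (rk 0) f ep \<in> M \<longleftrightarrow> f \<in> diff 0 ` F 1"
    and ep_homogeneous: "k < rk 0 \<Longrightarrow> ep k \<in> homogeneous V (a 0 ! k)"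
    and M_mult: "p \<in> M \<Longrightarrow> r \<in> R \<Longrightarrow> r * p \<in> M"
    and unit: "\<exists>u\<in>grF 0 0. vpair (rk 0) u ep - 1 \<in> M"
begin

lemma diff_diff: "f \<in> F (Suc (Suc i)) \<Longrightarrow> diff i (diff (Suc i) f) = (\<lambda>_. 0)"
  using exact[of "diff (Suc i) f" i] diff_in_F by blast

lemma diff_D: "k < rk (Suc (Suc i)) \<Longrightarrow> diff i (D (Suc i) k) = (\<lambda>_. 0)"
  using diff_diff[OF evec_in_F, of k i] diff_evec[of k "Suc i" 1] by simp

lemma delta_delta: "delta (Suc i) (delta i c) = (\<lambda>_. 0)"
proof
  fix k
  show "delta (Suc i) (delta i c) k = 0"
  proof (cases "k < rk (Suc (Suc i))")
    case True
    then show ?thesis using diff_D[OF True]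
      by (simp add: delta_def[of "Suc i"] vpair_delta) (simp add: vpair_def)
  qed (simp add: delta_def)
qed

text \<open>Since the entries of \<open>D\<close> are homogeneous, \<open>diff\<close> commutes with
  taking homogeneous components, so the right components of any preimage again form a
  preimage.\<close>

lemma graded_lift:
  assumes "f \<in> grF i t" "f \<in> diff i ` F (Suc i)"
  shows "\<exists>g\<in>grF (Suc i) t. diff i g = f"
proof -
  obtain g where g: "g \<in> F (Suc i)" "f = diff i g" using assms(2) by blast
  define g' where "g' k = (if k < rk (Suc i) then hom_comp (t - a (Suc i) ! k) (g k) else 0)" for k
  have g': "g' \<in> grF (Suc i) t"
    using g(1) by (auto simp: grF_def g'_def F_def intro!: hom_comp_in)
  have "diff i g' l = f l" for l
  proof (cases "l < rk i")
    case True
    have "diff i g' l = (\<Sum>k<rk (Suc i). hom_comp (t - a i ! l) (g k * D i k l))"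
      unfolding diff_def vpair_def
      by (intro sum.cong) (auto simp: g'_def hom_comp_mult[OF D_homogeneous[OF _ True]])
    also have "\<dots> = hom_comp (t - a i ! l) (f l)"
      unfolding g(2) diff_def vpair_def hom_comp_def by (simp add: mon_proj_sum)
    also have "\<dots> = f l" using assms(1) True by (intro hom_comp_id) (auto simp: grF_def)
    finally show ?thesis .
  next
    case False
    have "f l = 0" using assms(1) False by (auto simp: grF_def)
    moreover have "diff i g' l = 0"
      using diff_in_F[OF grF_subset[OF g']] False by (auto simp: F_def)
    ultimately show ?thesis by simp
  qed
  then show ?thesis using g' by blast
qed

text \<open>The identity d s + s d = y for a map s of degree \<open>e\<close> from
  \<open>F i\<close> to \<open>F (i + 1)\<close>, written on basis vectors: \<open>S i m\<close> is
  the image of the \<open>m\<close>-th one, and the sum over \<open>m\<close> is s applied to its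
  differential.\<close>

definition null_homotopy :: "('v, 'k) mpoly \<Rightarrow> int \<Rightarrow> (nat \<Rightarrow> nat \<Rightarrow> nat \<Rightarrow> ('v, 'k) mpoly) \<Rightarrow> bool" where
  "null_homotopy y e S \<longleftrightarrow> (\<forall>i m. m < rk i \<longrightarrow> S i m \<in> grF (Suc i) (a i ! m + e)) \<and>
     (\<forall>m<rk 0. diff 0 (S 0 m) = (\<lambda>l. y * evec m l)) \<and>
     (\<forall>i k. k < rk (Suc i) \<longrightarrow>
       diff (Suc i) (S (Suc i) k) = (\<lambda>l. y * evec k l - (\<Sum>m<rk i. D i k m * S i m l)))"

lemma null_homotopyD:
  assumes "null_homotopy y e S"
  shows "m < rk i \<Longrightarrow> S i m \<in> grF (Suc i) (a i ! m + e)"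
    and "m < rk 0 \<Longrightarrow> diff 0 (S 0 m) = (\<lambda>l. y * evec m l)"
    and "k < rk (Suc i) \<Longrightarrow>
      diff (Suc i) (S (Suc i) k) = (\<lambda>l. y * evec k l - (\<Sum>m<rk i. D i k m * S i m l))"
  using assms unfolding null_homotopy_def by auto

text \<open>Multiplication by \<open>y\<close> is zero on R/M, so it is null-homotopic on a free
  resolution. The homotopy is built stage by stage: y - s d is a cycle, hence by exactness a
  boundary, and it has a homogeneous preimage.\<close>

lemma ex_null_homotopy:
  assumes y: "y \<in> M" "y \<in> homogeneous V e"
  shows "\<exists>S. null_homotopy y e S"
proof -
  have yR: "y \<in> R" using y(2) by (rule homogeneous_subset)
  \<comment> \<open>The last part of the invariant \<open>P\<close> says d s d = y d, exactly what
    makes y - s d a cycle at the next stage. \<open>Q\<close> is the homotopy identity linking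
    consecutive stages.\<close>
  define P where "P = (\<lambda>i s. (\<forall>m<rk i. s m \<in> grF (Suc i) (a i ! m + e)) \<and>
     (i = 0 \<longrightarrow> (\<forall>m<rk 0. diff 0 (s m) = (\<lambda>l. y * evec m l))) \<and>
     (\<forall>k<rk (Suc i). \<forall>l. (\<Sum>m<rk i. D i k m * diff i (s m) l) = y * D i k l))"
  define Q where "Q = (\<lambda>i s s'. \<forall>k<rk (Suc i).
     diff (Suc i) (s' k) = (\<lambda>l. y * evec k l - (\<Sum>m<rk i. D i k m * s m l)))"
  have sum_evec: "(\<Sum>m<b. p m * (y * evec m l)) = (if l < b then y * p l else 0)" for b p l
  proof -
    have "(\<Sum>m<b. p m * (y * evec m l)) = (\<Sum>m<b. if m = l then y * p l else 0)"
      by (intro sum.cong) (auto simp: evec_def)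
    then show ?thesis by simp
  qed
  have y_evec: "(\<lambda>l. y * evec k l) \<in> grF i (a i ! k + e)" if "k < rk i" for i k
    using that y(2) by (auto simp: grF_def evec_def)
  have "\<exists>S. \<forall>i. P i (S i) \<and> Q i (S i) (S (Suc i))"
  proof (rule dependent_nat_choice[where P = P and Q = Q])
    have "\<exists>g\<in>grF (Suc 0) (a 0 ! m + e). diff 0 g = (\<lambda>l. y * evec m l)" if m: "m < rk 0" for m
    proof (rule graded_lift)
      show gr: "(\<lambda>l. y * evec m l) \<in> grF 0 (a 0 ! m + e)" by (rule y_evec[OF m])
      \<comment> \<open>The augmentation maps \<open>y\<close> times the \<open>m\<close>-th basis
        vector to the class of \<open>y * ep m\<close>, which is 0 because \<open>y\<close> lies in
        \<open>M\<close>.\<close>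
      have "vpair (rk 0) (\<lambda>l. y * evec m l) ep \<in> M"
        unfolding vpair_evec[OF m]
        using M_mult[OF y(1) homogeneous_subset[OF ep_homogeneous[OF m]]] by (simp add: mult.commute)
      then show "(\<lambda>l. y * evec m l) \<in> diff 0 ` F (Suc 0)" using exact_0[OF grF_subset[OF gr]] by simp
    qed
    then obtain s where s: "\<And>m. m < rk 0 \<Longrightarrow> s m \<in> grF (Suc 0) (a 0 ! m + e)"
      "\<And>m. m < rk 0 \<Longrightarrow> diff 0 (s m) = (\<lambda>l. y * evec m l)" by metis
    have "P 0 s"
      unfolding P_def using s D_eq_0[of _ 0] by (auto simp: sum_evec)
    then show "\<exists>s. P 0 s" by blast
  next
    fix s i assume s: "P i s"
    have sF: "s m \<in> F (Suc i)" if "m < rk i" for m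
      using s that grF_subset by (auto simp: P_def)
    have "\<exists>g\<in>grF (Suc (Suc i)) (a (Suc i) ! k + e).
        diff (Suc i) g = (\<lambda>l. y * evec k l - (\<Sum>m<rk i. D i k m * s m l))" if k: "k < rk (Suc i)" for k
    proof (rule graded_lift)
      let ?x = "\<lambda>l. y * evec k l - (\<Sum>m<rk i. D i k m * s m l)"
      have "(\<Sum>m<rk i. D i k m * s m l) \<in> homogeneous V (a (Suc i) ! k + e - a (Suc i) ! l)"
        if l: "l < rk (Suc i)" for l
      proof (rule hom_sum)
        fix m assume m: "m \<in> {..<rk i}"
        then have "s m l \<in> homogeneous V (a i ! m + e - a (Suc i) ! l)"
          using s l by (auto simp: P_def grF_def)
        from homogeneous_mult[OF D_homogeneous[OF k, of m] this] m
        show "D i k m * s m l \<in> homogeneous V (a (Suc i) ! k + e - a (Suc i) ! l)"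
          by (simp add: algebra_simps)
      qed
      moreover have "s m l = 0" if "rk (Suc i) \<le> l" "m < rk i" for l m
        using sF[OF that(2)] that(1) by (auto simp: F_def)
      ultimately show gr: "?x \<in> grF (Suc i) (a (Suc i) ! k + e)"
        using y_evec[OF k] by (auto simp: grF_def intro!: hom_diff)
      have "diff i ?x l = 0" for l
      proof -
        have "diff i ?x l = diff i (\<lambda>l. y * evec k l) l - (\<Sum>m<rk i. D i k m * diff i (s m) l)"
          unfolding diff_def by (simp add: vpair_diff vpair_sum vpair_mult)
        then show ?thesis using s k by (simp add: diff_evec[OF k] P_def)
      qed
      then show "?x \<in> diff (Suc i) ` F (Suc (Suc i))" using exact[OF grF_subset[OF gr]] by auto
    qed
    then have "\<forall>k. \<exists>g. k < rk (Suc i) \<longrightarrow> g \<in> grF (Suc (Suc i)) (a (Suc i) ! k + e) \<and>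
        diff (Suc i) g = (\<lambda>l. y * evec k l - (\<Sum>m<rk i. D i k m * s m l))" by blast
    from choice[OF this] obtain s' where
      "\<forall>k. k < rk (Suc i) \<longrightarrow> s' k \<in> grF (Suc (Suc i)) (a (Suc i) ! k + e) \<and>
        diff (Suc i) (s' k) = (\<lambda>l. y * evec k l - (\<Sum>m<rk i. D i k m * s m l))" ..
    then have s': "\<And>k. k < rk (Suc i) \<Longrightarrow> s' k \<in> grF (Suc (Suc i)) (a (Suc i) ! k + e)"
      "\<And>k. k < rk (Suc i) \<Longrightarrow> diff (Suc i) (s' k) = (\<lambda>l. y * evec k l - (\<Sum>m<rk i. D i k m * s m l))" by blast+
    \<comment> \<open>The invariant for the next stage: d s' d = y d - s d d, and d d = 0.\<close>
    have "(\<Sum>k<rk (Suc i). D (Suc i) k' k * diff (Suc i) (s' k) l) = y * D (Suc i) k' l"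
      if k': "k' < rk (Suc (Suc i))" for k' l
    proof -
      have "(\<Sum>k<rk (Suc i). D (Suc i) k' k * diff (Suc i) (s' k) l) =
          (\<Sum>k<rk (Suc i). D (Suc i) k' k * (y * evec k l)) -
          (\<Sum>k<rk (Suc i). D (Suc i) k' k * vpair (rk i) (D i k) (\<lambda>m. s m l))"
        unfolding sum_subtractf[symmetric]
        by (intro sum.cong) (auto simp: s'(2) vpair_def right_diff_distrib)
      also have "(\<Sum>k<rk (Suc i). D (Suc i) k' k * vpair (rk i) (D i k) (\<lambda>m. s m l)) =
          vpair (rk (Suc i)) (D (Suc i) k') (delta i (\<lambda>m. s m l))"
        unfolding vpair_def[of "rk (Suc i)"] by (intro sum.cong) (auto simp: delta_def)
      also have "\<dots> = 0" unfolding vpair_delta diff_D[OF k'] by (simp add: vpair_def)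
      finally show ?thesis using D_eq_0[OF k', of l] by (auto simp: sum_evec)
    qed
    then have "P (Suc i) s'" using s'(1) by (auto simp: P_def)
    moreover have "Q i s s'" using s'(2) by (auto simp: Q_def)
    ultimately show "\<exists>s'. P (Suc i) s' \<and> Q i s s'" by blast
  qed
  then obtain S where S: "\<And>i. P i (S i)" "\<And>i. Q i (S i) (S (Suc i))" by blast
  then have "null_homotopy y e S"
    unfolding null_homotopy_def P_def Q_def by blast
  then show ?thesis by blast
qed

end

section \<open>Cohomology modulo a regular sequence of powers\<close>

definition comb :: "'x set \<Rightarrow> ('x \<Rightarrow> 'k) \<Rightarrow> ('x \<Rightarrow> nat \<Rightarrow> ('v, 'k::field) mpoly) \<Rightarrow> nat \<Rightarrow> ('v, 'k) mpoly" where
  "comb I \<alpha> z = (\<lambda>k. \<Sum>x\<in>I. const_poly (\<alpha> x) * z x k)"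

text \<open>For finite \<open>I\<close>: the classes of the \<open>z x\<close> form a basis of Z/B
  over the field, expressed through representatives so that no quotient space has to be formed. The
  index set is kept through all shifts, so dimensions can be compared by way of
  \<open>I\<close>.\<close>

definition quotient_basis :: "(nat \<Rightarrow> ('v, 'k::field) mpoly) set \<Rightarrow> (nat \<Rightarrow> ('v, 'k) mpoly) set \<Rightarrow> 'x set \<Rightarrow>
    ('x \<Rightarrow> nat \<Rightarrow> ('v, 'k) mpoly) \<Rightarrow> bool" where
  "quotient_basis Z B I z \<longleftrightarrow> (\<forall>x\<in>I. z x \<in> Z) \<and> (\<forall>c\<in>Z. \<exists>\<alpha>. (\<lambda>k. c k - comb I \<alpha> z k) \<in> B) \<and>
     (\<forall>\<alpha>. comb I \<alpha> z \<in> B \<longrightarrow> (\<forall>x\<in>I. \<alpha> x = 0))"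

text \<open>Distinctness of the variables makes their powers a regular sequence; membership of the
  powers in \<open>M\<close> supplies a null-homotopy for each of them.\<close>

locale regular_res = free_res V a D ep M
  for V :: "'v set" and a and D :: "nat \<Rightarrow> nat \<Rightarrow> nat \<Rightarrow> ('v, 'k::field) mpoly" and ep M +
  fixes N :: nat and vs :: "nat \<Rightarrow> 'v" and e :: "nat \<Rightarrow> nat"
  assumes vs_inj: "inj_on vs {..<N}"
    and vs_V: "s < N \<Longrightarrow> vs s \<in> V"
    and power_in_M: "s < N \<Longrightarrow> Poly_Mapping.single (Poly_Mapping.single (vs s) (e s)) 1 \<in> M"
begin

definition y :: "nat \<Rightarrow> ('v, 'k) mpoly" where
  "y s = Poly_Mapping.single (Poly_Mapping.single (vs s) (e s)) 1"

text \<open>The monomials of the ideal generated by \<open>y 0\<close>, ...,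
  \<open>y (s - 1)\<close>.\<close>

definition Jm :: "nat \<Rightarrow> ('v \<Rightarrow>\<^sub>0 nat) set" where
  "Jm s = {m. Poly_Mapping.keys m \<subseteq> V \<and> (\<exists>i<s. e i \<le> Poly_Mapping.lookup m (vs i))}"

definition J :: "nat \<Rightarrow> ('v, 'k) mpoly set" where
  "J s = mon_span (Jm s)"

lemma y_homogeneous: "s < N \<Longrightarrow> y s \<in> homogeneous V (int (e s))"
  unfolding y_def homogeneous_eq_mon_span using vs_V[of s]
  by (intro single_in_mon_span) (auto simp: mon_degree_def)

lemma y_R: "s < N \<Longrightarrow> y s \<in> R"
  using y_homogeneous homogeneous_subset by blast

lemma J_0 [simp]: "0 \<in> J s"
  and J_add: "p \<in> J s \<Longrightarrow> p' \<in> J s \<Longrightarrow> p + p' \<in> J s"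
  and J_diff: "p \<in> J s \<Longrightarrow> p' \<in> J s \<Longrightarrow> p - p' \<in> J s"
  and J_uminus: "p \<in> J s \<Longrightarrow> - p \<in> J s"
  and J_sum: "(\<And>x. x \<in> A \<Longrightarrow> f x \<in> J s) \<Longrightarrow> sum f A \<in> J s"
  unfolding J_def by auto

lemma J_mult: "r \<in> R \<Longrightarrow> p \<in> J s \<Longrightarrow> r * p \<in> J s"
  unfolding J_def carrier_poly_ring
  by (erule (1) mon_span_mult) (auto simp: keys_add_nat Jm_def lookup_add intro: trans_le_add2)

lemma J_mono: "p \<in> J s \<Longrightarrow> p \<in> J (Suc s)"
  unfolding J_def by (erule mon_span_mono[rotated]) (auto simp: Jm_def less_Suc_eq)

lemma y_mult_J: "s < N \<Longrightarrow> p \<in> R \<Longrightarrow> y s * p \<in> J (Suc s)"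
  unfolding J_def carrier_poly_ring y_def
  by (rule mon_span_mult[where S = "{Poly_Mapping.single (vs s) (e s)}"])
    (auto simp: Jm_def keys_add_nat lookup_add lookup_single intro: single_in_mon_span vs_V split: if_splits)

text \<open>Multiplication by a power of \<open>vs s\<close> leaves the exponents of the variables
  \<open>vs i\<close> with \<open>i < s\<close> unchanged, and these alone decide membership in
  \<open>J s\<close>.\<close>

lemma J_regular:
  assumes "s < N" "p \<in> R" "y s * p \<in> J s"
  shows "p \<in> J s"
proof -
  let ?n = "Poly_Mapping.single (vs s) (e s)"
  have "m \<in> Jm s" if "m \<in> Poly_Mapping.keys p" for m
  proof -
    have "?n + m \<in> Poly_Mapping.keys (y s * p)"
      using that lookup_single_mult[of ?n 1 p m] by (simp add: y_def in_keys_iff)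
    then have "?n + m \<in> Jm s" using assms(3) by (auto simp: J_def mon_span_def)
    then obtain i where i: "i < s" "e i \<le> Poly_Mapping.lookup (?n + m) (vs i)" by (auto simp: Jm_def)
    have "vs i \<noteq> vs s" using i(1) assms(1) inj_onD[OF vs_inj, of i s] by auto
    then have "e i \<le> Poly_Mapping.lookup m (vs i)" using i by (simp add: lookup_add lookup_single)
    then show ?thesis using i that assms(2) by (auto simp: Jm_def carrier_poly_ring mon_span_def)
  qed
  then show ?thesis by (auto simp: J_def mon_span_def)
qed

text \<open>A monomial of \<open>J (Suc s)\<close> outside \<open>J s\<close> must be divisible by
  \<open>y s\<close>; dividing that part of \<open>p\<close> keeps it homogeneous.\<close>

lemma J_SucE:
  assumes "p \<in> J (Suc s)" "p \<in> homogeneous V t"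
  shows "\<exists>p'\<in>homogeneous V (t - int (e s)). p - y s * p' \<in> J s"
proof -
  let ?n = "Poly_Mapping.single (vs s) (e s)"
  let ?p = "mon_proj (- Jm s) p"
  have k: "m \<in> Jm (Suc s) - Jm s \<and> int (mon_degree m) = t" if "m \<in> Poly_Mapping.keys ?p" for m
    using that assms
    by (auto simp: in_keys_iff lookup_mon_proj J_def homogeneous_eq_mon_span mon_span_def split: if_splits)
  have div: "\<exists>m'. m = ?n + m'" if m: "m \<in> Poly_Mapping.keys ?p" for m
  proof
    have "e s \<le> Poly_Mapping.lookup m (vs s)" using k[OF m] by (auto simp: Jm_def less_Suc_eq)
    then show "m = ?n + (m - ?n)"
      by (intro poly_mapping_eqI) (auto simp: lookup_add lookup_minus lookup_single when_def)
  qed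
  from mon_span_divide[OF div] obtain p' where p'_both: "?p = Poly_Mapping.single ?n 1 * p' \<and>
      (\<forall>m'\<in>Poly_Mapping.keys p'. ?n + m' \<in> Poly_Mapping.keys ?p)" ..
  note p' = conjunct1[OF p'_both] bspec[OF conjunct2[OF p'_both]]
  have "p' \<in> homogeneous V (t - int (e s))"
    unfolding homogeneous_eq_mon_span mon_span_def
  proof (intro CollectI subsetI conjI)
    fix m' assume "m' \<in> Poly_Mapping.keys p'"
    from k[OF p'(2)[OF this]] have m': "Poly_Mapping.keys (?n + m') \<subseteq> V" "int (mon_degree (?n + m')) = t"
      by (auto simp: Jm_def)
    show "v \<in> V" if "v \<in> Poly_Mapping.keys m'" for v using m'(1) that by (auto simp: keys_add_nat)
    show "int (mon_degree m') = t - int (e s)"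
      using m'(2) unfolding mon_degree_add by (simp add: mon_degree_def split: if_splits)
  qed
  moreover have "p - y s * p' = mon_proj (Jm s) p"
    using mon_proj_split[of p "Jm s"] p'(1) by (simp add: y_def algebra_simps)
  then have "p - y s * p' \<in> J s"
    using mon_proj_in[of p UNIV "Jm s"] by (simp add: J_def mon_span_def)
  ultimately show ?thesis by blast
qed

text \<open>Vanishing modulo \<open>J s\<close>. Cochains with coefficients in R/J_s are always
  represented by lifts to R, and their equations hold up to \<open>inJ s\<close>.\<close>

definition inJ :: "nat \<Rightarrow> (nat \<Rightarrow> ('v, 'k) mpoly) \<Rightarrow> bool" where
  "inJ s c \<longleftrightarrow> (\<forall>k. c k \<in> J s)"

lemma inJ_delta: "inJ s c \<Longrightarrow> inJ s (delta i c)"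
  unfolding inJ_def delta_def vpair_def by (auto intro!: J_sum J_mult D_R)

lemma inJ_diff: "inJ s c \<Longrightarrow> inJ s c' \<Longrightarrow> inJ s (\<lambda>k. c k - c' k)"
  and inJ_add: "inJ s c \<Longrightarrow> inJ s c' \<Longrightarrow> inJ s (\<lambda>k. c k + c' k)"
  and inJ_uminus: "inJ s c \<Longrightarrow> inJ s (\<lambda>k. - c k)"
  and inJ_sum: "(\<And>x. x \<in> A \<Longrightarrow> inJ s (h x)) \<Longrightarrow> inJ s (\<lambda>k. \<Sum>x\<in>A. h x k)"
  and inJ_mult: "r \<in> R \<Longrightarrow> inJ s c \<Longrightarrow> inJ s (\<lambda>k. r * c k)"
  unfolding inJ_def by (auto intro: J_diff J_add J_uminus J_sum J_mult)

lemma inJ_regular: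
  assumes "s < N" "c \<in> F i" "inJ s (\<lambda>k. y s * c k)"
  shows "inJ s c"
  using assms J_regular unfolding inJ_def F_def by blast

lemma inJ_Suc_lift:
  assumes "s < N" "c \<in> cochain i (j + int (e s))" "inJ (Suc s) c"
  shows "\<exists>u\<in>cochain i j. inJ s (\<lambda>k. c k - y s * u k)"
proof -
  have "\<exists>p\<in>homogeneous V (j + a i ! k). c k - y s * p \<in> J s" if "k < rk i" for k
    using J_SucE[of "c k" s "j + int (e s) + a i ! k"] assms that
    by (auto simp: inJ_def cochain_def algebra_simps)
  then obtain u where u: "\<And>k. k < rk i \<Longrightarrow> u k \<in> homogeneous V (j + a i ! k)"
    "\<And>k. k < rk i \<Longrightarrow> c k - y s * u k \<in> J s" by metis
  show ?thesis
    using u assms(2) by (intro bexI[of _ "\<lambda>k. if k < rk i then u k else 0"]) (auto simp: inJ_def cochain_def)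
qed

section \<open>Cohomology with coefficients in R/J_s and dimension shifting\<close>

definition bnd :: "nat \<Rightarrow> int \<Rightarrow> (nat \<Rightarrow> ('v, 'k) mpoly) set" where
  "bnd i j = (case i of 0 \<Rightarrow> {\<lambda>_. 0} | Suc i' \<Rightarrow> delta i' ` cochain i' j)"

text \<open>\<open>Z i s j\<close> modulo \<open>B i s j\<close> is the degree \<open>j\<close> part
  of Ext^i(R/M, R/J_s), in terms of lifts to R: a cocycle is a cochain whose coboundary has all
  entries in \<open>J s\<close>. For \<open>s = 0\<close> the ideal is zero and the coefficients are
  R itself.\<close>

definition Z :: "nat \<Rightarrow> nat \<Rightarrow> int \<Rightarrow> (nat \<Rightarrow> ('v, 'k) mpoly) set" where
  "Z i s j = {c \<in> cochain i j. inJ s (delta i c)}"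

definition B :: "nat \<Rightarrow> nat \<Rightarrow> int \<Rightarrow> (nat \<Rightarrow> ('v, 'k) mpoly) set" where
  "B i s j = {c \<in> cochain i j. \<exists>g\<in>bnd i j. inJ s (\<lambda>k. c k - g k)}"

lemma bnd_cochain: "g \<in> bnd i j \<Longrightarrow> g \<in> cochain i j"
  by (auto simp: bnd_def delta_in_cochain split: nat.splits)

lemma delta_bnd: "g \<in> bnd i j \<Longrightarrow> delta i g = (\<lambda>_. 0)"
  by (auto simp: bnd_def delta_delta split: nat.splits)

text \<open>Multiplication by \<open>y s\<close> is zero on cohomology: transposing d s + s d = y
  and applying it to the cocycle \<open>c\<close> leaves only the term containing the coboundary of
  \<open>c\<close>, which is in \<open>J s\<close>.\<close>

lemma kill:
  assumes s: "s < N" and c: "c \<in> Z (Suc i) s j"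
  shows "\<exists>g\<in>cochain i (j + int (e s)). inJ s (\<lambda>k. delta i g k - y s * c k)"
proof -
  have yM: "y s \<in> M" using power_in_M[OF s] by (simp add: y_def)
  obtain S where "null_homotopy (y s) (int (e s)) S"
    using ex_null_homotopy[OF yM y_homogeneous[OF s]] by blast
  note S = null_homotopyD[OF this]
  \<comment> \<open>The composite of \<open>c\<close> with the homotopy.\<close>
  define g where "g m = (if m < rk i then vpair (rk (Suc i)) (S i m) c else 0)" for m
  have "vpair (rk (Suc i)) (S i m) c \<in> homogeneous V (a i ! m + int (e s) + j)" if "m < rk i" for m
    using S(1)[OF that] c
    by (intro vpair_hom[where u = "\<lambda>k. a (Suc i) ! k"]) (auto simp: grF_def Z_def cochain_def)
  then have "g \<in> cochain i (j + int (e s))" by (auto simp: cochain_def g_def algebra_simps)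
  moreover have "inJ s (\<lambda>k. delta i g k - y s * c k)"
    unfolding inJ_def
  proof
    fix k
    show "delta i g k - y s * c k \<in> J s"
    proof (cases "k < rk (Suc i)")
      case k: True
      have "delta i g k = (\<Sum>m<rk i. D i k m * vpair (rk (Suc i)) (S i m) c)"
        using k by (auto simp: delta_def vpair_def g_def intro!: sum.cong)
      also have "\<dots> = vpair (rk (Suc i)) (\<lambda>l. \<Sum>m<rk i. D i k m * S i m l) c"
        by (simp add: vpair_sum vpair_mult)
      also have "(\<lambda>l. \<Sum>m<rk i. D i k m * S i m l) = (\<lambda>l. y s * evec k l - diff (Suc i) (S (Suc i) k) l)"
        by (simp add: S(3)[OF k])
      also have "vpair (rk (Suc i)) \<dots> c =
          y s * c k - vpair (rk (Suc (Suc i))) (S (Suc i) k) (delta (Suc i) c)"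
        by (simp add: vpair_diff vpair_evec[OF k] vpair_delta)
      finally have eq: "delta i g k - y s * c k = - vpair (rk (Suc (Suc i))) (S (Suc i) k) (delta (Suc i) c)"
        by simp
      have "S (Suc i) k \<in> F (Suc (Suc i))" using grF_subset[OF S(1)[OF k]] .
      then have "vpair (rk (Suc (Suc i))) (S (Suc i) k) (delta (Suc i) c) \<in> J s"
        using c by (auto simp: vpair_def Z_def inJ_def F_def intro!: J_sum J_mult)
      then show ?thesis unfolding eq by (rule J_uminus)
    next
      case False
      then show ?thesis using c by (auto simp: delta_def Z_def cochain_def)
    qed
  qed
  ultimately show ?thesis by blast
qed

text \<open>In cohomological degree 0 there are no coboundaries to correct by, so
  \<open>y s * c\<close> itself is 0 modulo \<open>J s\<close>, and \<open>y s\<close> can be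
  cancelled. Thus Hom(R/M, R/J_s) = 0.\<close>

lemma kill_0:
  assumes s: "s < N" and c: "c \<in> Z 0 s j"
  shows "inJ s c"
proof (rule inJ_regular[OF s, of _ 0])
  have yM: "y s \<in> M" using power_in_M[OF s] by (simp add: y_def)
  obtain S where "null_homotopy (y s) (int (e s)) S"
    using ex_null_homotopy[OF yM y_homogeneous[OF s]] by blast
  note S = null_homotopyD[OF this]
  show "c \<in> F 0" using c cochain_subset by (auto simp: Z_def)
  show "inJ s (\<lambda>k. y s * c k)"
    unfolding inJ_def
  proof
    fix k
    show "y s * c k \<in> J s"
    proof (cases "k < rk 0")
      case k: True
      have "S 0 k \<in> F (Suc 0)" using grF_subset[OF S(1)[OF k]] .
      then have "vpair (rk (Suc 0)) (S 0 k) (delta 0 c) \<in> J s"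
        using c by (auto simp: vpair_def Z_def inJ_def F_def intro!: J_sum J_mult)
      then show ?thesis by (simp add: vpair_delta S(2)[OF k] vpair_evec[OF k])
    next
      case False
      then show ?thesis using c by (auto simp: Z_def cochain_def)
    qed
  qed
qed

text \<open>The connecting map on cocycles: the coboundary of \<open>c\<close> vanishes modulo
  \<open>J (Suc s)\<close> and so is \<open>y s\<close> times some \<open>c'\<close> modulo
  \<open>J s\<close>. That \<open>c'\<close> is a cocycle follows by cancelling
  \<open>y s\<close>.\<close>

lemma Z_lift:
  assumes s: "s < N" and c: "c \<in> Z i (Suc s) (j + int (e s))"
  shows "\<exists>c'\<in>Z (Suc i) s j. inJ s (\<lambda>k. delta i c k - y s * c' k)"
proof -
  obtain c' where c': "c' \<in> cochain (Suc i) j" "inJ s (\<lambda>k. delta i c k - y s * c' k)"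
    using inJ_Suc_lift[OF s delta_in_cochain[of c i "j + int (e s)"]] c by (auto simp: Z_def)
  have "inJ s (\<lambda>k. - (y s * delta (Suc i) c' k))"
    using inJ_delta[OF c'(2), of "Suc i"] by (simp add: delta_diff delta_delta delta_mult)
  from inJ_uminus[OF this] have "inJ s (\<lambda>k. y s * delta (Suc i) c' k)" by simp
  then have "inJ s (delta (Suc i) c')"
    using inJ_regular[OF s cochain_subset[OF delta_in_cochain[OF c'(1)]]] by blast
  then show ?thesis using c' by (auto simp: Z_def)
qed

text \<open>Ext^i(R/M, R/J_s) = 0 below the length \<open>N - s\<close> of the remaining regular
  sequence. Going down in \<open>i\<close> requires going up in \<open>s\<close>, so
  \<open>s\<close> and \<open>j\<close> are left arbitrary in the induction.\<close>

lemma cohomology_vanishes: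
  "s + i < N \<Longrightarrow> Z i s j \<subseteq> B i s j"
proof (induction i arbitrary: s j)
  case 0
  show ?case
  proof
    fix c assume c: "c \<in> Z 0 s j"
    have "inJ s c" using kill_0[of s c j] c 0 by simp
    then show "c \<in> B 0 s j" using c by (auto simp: B_def Z_def bnd_def)
  qed
next
  case (Suc i)
  then have s: "s < N" by simp
  show ?case
  proof
    fix c assume c: "c \<in> Z (Suc i) s j"
    obtain g where g: "g \<in> cochain i (j + int (e s))" "inJ s (\<lambda>k. delta i g k - y s * c k)"
      using kill[OF s c] by blast
    have cF: "c \<in> F (Suc i)" using c cochain_subset by (auto simp: Z_def)
    \<comment> \<open>\<open>g\<close> has coboundary \<open>y s * c\<close> modulo
      \<open>J s\<close>, so it is a cocycle modulo \<open>J (Suc s)\<close> one degree lower, where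
      the induction hypothesis applies.\<close>
    have "delta i g k = (delta i g k - y s * c k) + y s * c k" for k by simp
    then have "inJ (Suc s) (delta i g)"
      using g(2) cF J_mono y_mult_J[OF s] J_add unfolding inJ_def F_def by (metis (no_types, lifting) mem_Collect_eq)
    then have "g \<in> Z i (Suc s) (j + int (e s))" using g by (auto simp: Z_def)
    then have "g \<in> B i (Suc s) (j + int (e s))" using Suc.IH[of "Suc s"] Suc.prems by auto
    then obtain w where w: "w \<in> bnd i (j + int (e s))" "inJ (Suc s) (\<lambda>k. g k - w k)" by (auto simp: B_def)
    obtain u where u: "u \<in> cochain i j" "inJ s (\<lambda>k. g k - w k - y s * u k)"
      using inJ_Suc_lift[OF s cochain_diff[OF g(1) bnd_cochain[OF w(1)]] w(2)] by blast
    have "inJ s (\<lambda>k. delta i g k - y s * delta i u k)"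
      using inJ_delta[OF u(2), of i] by (simp add: delta_diff delta_mult delta_bnd[OF w(1)])
    \<comment> \<open>After correction by a coboundary \<open>g\<close> is \<open>y s * u\<close>,
      so \<open>y s\<close> can be cancelled and \<open>c\<close> is the coboundary of
      \<open>u\<close> modulo \<open>J s\<close>.\<close>
    from inJ_diff[OF this g(2)] have "inJ s (\<lambda>k. y s * (c k - delta i u k))" by (simp add: algebra_simps)
    then have "inJ s (\<lambda>k. c k - delta i u k)"
      using inJ_regular[OF s F_diff[OF cF cochain_subset[OF delta_in_cochain[OF u(1)]]]] by blast
    then show "c \<in> B (Suc i) s j" using c u(1) by (auto simp: B_def bnd_def Z_def)
  qed
qed

lemma comb_cochain: "(\<And>x. x \<in> I \<Longrightarrow> z x \<in> cochain i j) \<Longrightarrow> comb I \<alpha> z \<in> cochain i j"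
  unfolding comb_def by (intro cochain_sum cochain_scale)

lemma const_R: "const_poly r \<in> R"
  using const_poly_homogeneous homogeneous_subset by blast

lemma delta_comb: "delta i (comb I \<alpha> z) = comb I \<alpha> (\<lambda>x. delta i (z x))"
  unfolding comb_def by (simp add: delta_sum delta_mult)

text \<open>The connecting map of \<open>0 \<rightarrow> R/J\<^sub>s \<rightarrow> R/J\<^sub>s \<rightarrow> R/J\<^sub>s\<^sub>+\<^sub>1 \<rightarrow> 0\<close>, the
  first map being multiplication by \<open>y s\<close>, is an isomorphism on cohomology (Rees), as
  \<open>y s\<close> kills cohomology and the groups in degree \<open>i\<close> vanish.\<close>

lemma quotient_basis_shift:
  assumes sN: "s + i < N" and qb: "quotient_basis (Z i (Suc s) (j + int (e s))) (B i (Suc s) (j + int (e s))) I z"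
  shows "\<exists>z'. quotient_basis (Z (Suc i) s j) (B (Suc i) s j) I z'"
proof -
  have s: "s < N" using sN by simp
  let ?t = "j + int (e s)"
  have zZ: "\<And>x. x \<in> I \<Longrightarrow> z x \<in> Z i (Suc s) ?t"
    and span: "\<And>c. c \<in> Z i (Suc s) ?t \<Longrightarrow> \<exists>\<alpha>. (\<lambda>k. c k - comb I \<alpha> z k) \<in> B i (Suc s) ?t"
    and ind: "\<And>\<alpha> x. comb I \<alpha> z \<in> B i (Suc s) ?t \<Longrightarrow> x \<in> I \<Longrightarrow> \<alpha> x = 0"
    using qb unfolding quotient_basis_def by blast+
  obtain z' where z': "\<And>x. x \<in> I \<Longrightarrow> z' x \<in> Z (Suc i) s j"
    "\<And>x. x \<in> I \<Longrightarrow> inJ s (\<lambda>k. delta i (z x) k - y s * z' x k)"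
    using Z_lift[OF s zZ] by metis
  have zc: "comb I \<alpha> z \<in> cochain i ?t" for \<alpha> using zZ by (intro comb_cochain) (auto simp: Z_def)
  have z'c: "comb I \<alpha> z' \<in> cochain (Suc i) j" for \<alpha> using z' by (intro comb_cochain) (auto simp: Z_def)
  have dcomb: "inJ s (\<lambda>k. delta i (comb I \<alpha> z) k - y s * comb I \<alpha> z' k)" for \<alpha>
  proof -
    have "inJ s (\<lambda>k. \<Sum>x\<in>I. const_poly (\<alpha> x) * (delta i (z x) k - y s * z' x k))"
      using z'(2) by (intro inJ_sum inJ_mult const_R)
    then show ?thesis
      by (simp add: delta_comb) (simp add: comb_def sum_distrib_left algebra_simps sum_subtractf)
  qed
  have "\<exists>\<alpha>. (\<lambda>k. c k - comb I \<alpha> z' k) \<in> B (Suc i) s j" if c: "c \<in> Z (Suc i) s j" for c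
  proof -
    obtain g where g: "g \<in> cochain i ?t" "inJ s (\<lambda>k. delta i g k - y s * c k)"
      using kill[OF s c] by blast
    have cF: "c \<in> F (Suc i)" and cC: "c \<in> cochain (Suc i) j" using c cochain_subset by (auto simp: Z_def)
    \<comment> \<open>Spanning, the surjectivity of the connecting map: \<open>g\<close> represents
      a class modulo \<open>J (Suc s)\<close> that is sent to the class of \<open>c\<close>.\<close>
    have "delta i g k = (delta i g k - y s * c k) + y s * c k" for k by simp
    then have "inJ (Suc s) (delta i g)"
      using g(2) cF J_mono y_mult_J[OF s] J_add unfolding inJ_def F_def by (metis (no_types, lifting) mem_Collect_eq)
    then have "g \<in> Z i (Suc s) ?t" using g by (auto simp: Z_def)
    then obtain \<alpha> where "(\<lambda>k. g k - comb I \<alpha> z k) \<in> B i (Suc s) ?t" using span by blast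
    then obtain w where w: "w \<in> bnd i ?t" "inJ (Suc s) (\<lambda>k. g k - comb I \<alpha> z k - w k)" by (auto simp: B_def)
    obtain u where u: "u \<in> cochain i j" "inJ s (\<lambda>k. g k - comb I \<alpha> z k - w k - y s * u k)"
      using inJ_Suc_lift[OF s cochain_diff[OF cochain_diff[OF g(1) zc] bnd_cochain[OF w(1)]] w(2)] by blast
    have "inJ s (\<lambda>k. delta i g k - delta i (comb I \<alpha> z) k - y s * delta i u k)"
      using inJ_delta[OF u(2), of i] by (simp add: delta_diff delta_mult delta_bnd[OF w(1)])
    from inJ_diff[OF inJ_add[OF this dcomb[of \<alpha>]] g(2)]
    have "inJ s (\<lambda>k. y s * (c k - comb I \<alpha> z' k - delta i u k))" by (simp add: algebra_simps)
    then have "inJ s (\<lambda>k. c k - comb I \<alpha> z' k - delta i u k)"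
      using inJ_regular[OF s F_diff[OF F_diff[OF cF cochain_subset[OF z'c]]
        cochain_subset[OF delta_in_cochain[OF u(1)]]]] by blast
    then show ?thesis using cC u(1) cochain_diff[OF cC z'c]
      by (intro exI[of _ \<alpha>]) (auto simp: B_def bnd_def Z_def)
  qed
  moreover have "\<alpha> x = 0" if \<alpha>: "comb I \<alpha> z' \<in> B (Suc i) s j" and x: "x \<in> I" for \<alpha> x
  proof -
    obtain g where g: "g \<in> cochain i j" "inJ s (\<lambda>k. comb I \<alpha> z' k - delta i g k)"
      using \<alpha> by (auto simp: B_def bnd_def)
    \<comment> \<open>Independence, the injectivity of the connecting map: subtracting
      \<open>y s * g\<close> turns \<open>comb I \<alpha> z\<close> into a cocycle modulo
      \<open>J s\<close> itself. By vanishing it is a coboundary, and modulo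
      \<open>J (Suc s)\<close> the subtracted term disappears again.\<close>
    let ?h = "\<lambda>k. comb I \<alpha> z k - y s * g k"
    have h: "?h \<in> cochain i ?t" by (intro cochain_diff zc cochain_mult y_homogeneous s g(1))
    have "inJ s (delta i ?h)"
    proof -
      have "inJ s (\<lambda>k. delta i (comb I \<alpha> z) k - y s * delta i g k)"
        using inJ_add[OF dcomb[of \<alpha>] inJ_mult[OF y_R[OF s] g(2)]] by (simp add: algebra_simps)
      then show ?thesis by (simp add: delta_diff delta_mult)
    qed
    then have "?h \<in> B i s ?t" using h cohomology_vanishes[OF sN, of ?t] by (auto simp: Z_def)
    then obtain w where w: "w \<in> bnd i ?t" "inJ s (\<lambda>k. ?h k - w k)" by (auto simp: B_def)
    have "g \<in> F i" using g(1) by (rule cochain_subset)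
    then have "inJ (Suc s) (\<lambda>k. y s * g k)" using y_mult_J[OF s] by (auto simp: inJ_def F_def)
    moreover have "inJ (Suc s) (\<lambda>k. ?h k - w k)" using w(2) J_mono by (auto simp: inJ_def)
    ultimately have "inJ (Suc s) (\<lambda>k. (?h k - w k) + y s * g k)" by (intro inJ_add)
    then have "inJ (Suc s) (\<lambda>k. comb I \<alpha> z k - w k)" by (simp add: algebra_simps)
    then have "comb I \<alpha> z \<in> B i (Suc s) ?t" using w(1) zc by (auto simp: B_def)
    then show ?thesis using ind x by blast
  qed
  ultimately show ?thesis using z'(1) unfolding quotient_basis_def by blast
qed

text \<open>Each shift trades one element \<open>y s\<close> of the sequence for one cohomological
  degree and lowers the internal degree by \<open>e s\<close>; after \<open>N\<close> shifts
  Hom(R/M, R/J_N) has become Ext^N(R/M, R).\<close>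

lemma quotient_basis_top:
  assumes "quotient_basis (Z 0 N (j + (\<Sum>s<N. int (e s)))) (B 0 N (j + (\<Sum>s<N. int (e s)))) I z"
  shows "\<exists>z'. quotient_basis (Z N 0 j) (B N 0 j) I z'"
proof -
  have "i \<le> N \<Longrightarrow> \<exists>z'. quotient_basis (Z i (N - i) (j + (\<Sum>s<N - i. int (e s)))) (B i (N - i) (j + (\<Sum>s<N - i. int (e s)))) I z'" for i
  proof (induction i)
    case 0
    then show ?case using assms by auto
  next
    case (Suc i)
    then obtain z' where z': "quotient_basis (Z i (N - i) (j + (\<Sum>s<N - i. int (e s)))) (B i (N - i) (j + (\<Sum>s<N - i. int (e s)))) I z'"
      by auto
    have eq: "N - i = Suc (N - Suc i)" using Suc by simp
    have "N - Suc i + i < N" using Suc by simp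
    from quotient_basis_shift[OF this, of "j + (\<Sum>s<N - Suc i. int (e s))"] z'
    show ?case unfolding eq by (simp add: add.assoc)
  qed
  from this[of N] show ?thesis by simp
qed

text \<open>In degree 0 the cohomology with coefficients in \<open>R/J\<^sub>N\<close> is \<open>Hom(R/M, R/J\<^sub>N)\<close>, that is,
  \<open>(J\<^sub>N : M)/J\<^sub>N\<close>.\<close>

lemma quotient_basis_colon:
  assumes M: "M = mon_span Mm" and Mm: "Mm \<subseteq> {m. Poly_Mapping.keys m \<subseteq> V}"
    and I: "I = {m. Poly_Mapping.keys m \<subseteq> V \<and> int (mon_degree m) = j \<and> m \<notin> Jm N \<and> (\<forall>m'\<in>Mm. m' + m \<in> Jm N)}"
    and fin: "finite I"
  shows "quotient_basis (Z 0 N j) (B 0 N j) I (\<lambda>m k. if k < rk 0 then ep k * Poly_Mapping.single m 1 else 0)"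
    (is "quotient_basis _ _ _ ?z")
proof -
  \<comment> \<open>\<open>u\<close> lifts the unit of R/M. It takes the place of the basis vector
    1, as \<open>F 0\<close> need not be R.\<close>
  obtain u where u: "u \<in> grF 0 0" "vpair (rk 0) u ep - 1 \<in> M" using unit by blast
  have uF: "u \<in> F 0" using u(1) by (rule grF_subset)
  \<comment> \<open>A cocycle modulo \<open>J N\<close> sends the kernel of the augmentation, which
    is the image of the differential, into \<open>J N\<close>.\<close>
  have cycle: "vpair (rk 0) f c \<in> J N" if f: "f \<in> F 0" "vpair (rk 0) f ep \<in> M" and c: "inJ N (delta 0 c)" for f c
  proof -
    obtain g where g: "g \<in> F 1" "f = diff 0 g" using exact_0[OF f(1)] f(2) by auto
    have "vpair (rk 0) f c = vpair (rk (Suc 0)) g (delta 0 c)" by (simp add: g vpair_delta)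
    also have "\<dots> \<in> J N" using g c by (auto simp: vpair_def inJ_def F_def intro!: J_sum J_mult)
    finally show ?thesis .
  qed
  have single_colon: "p * Poly_Mapping.single m c \<in> J N" if "m \<in> I" "p \<in> M" for p m c
    using that unfolding M J_def
    by (intro mon_span_mult[where T = "{m}" and S = Mm]) (auto intro: single_in_mon_span simp: I)
  have single_R: "Poly_Mapping.single m c \<in> R" if "m \<in> I" for m c
    using that by (auto simp: carrier_poly_ring I intro: single_in_mon_span)
  have epR: "ep k \<in> R" if "k < rk 0" for k using ep_homogeneous[OF that] by (rule homogeneous_subset)
  have comb_z: "comb I \<alpha> ?z = (\<lambda>k. if k < rk 0 then ep k * (\<Sum>m\<in>I. Poly_Mapping.single m (\<alpha> m)) else 0)" for \<alpha>
  proof -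
    have "const_poly (\<alpha> m) * (ep k * Poly_Mapping.single m 1) = ep k * Poly_Mapping.single m (\<alpha> m)" for m k
    proof -
      have "const_poly (\<alpha> m) * Poly_Mapping.single m 1 = Poly_Mapping.single m (\<alpha> m)"
        by (simp add: const_poly_def mult_single)
      then show ?thesis by (metis mult.left_commute)
    qed
    then show ?thesis by (auto simp: comb_def sum_distrib_left fun_eq_iff)
  qed
  have "?z m \<in> Z 0 N j" if m: "m \<in> I" for m
  proof -
    have hm: "Poly_Mapping.single m 1 \<in> homogeneous V j"
      using m by (auto simp: I homogeneous_eq_mon_span intro: single_in_mon_span)
    have "?z m \<in> cochain 0 j"
      using homogeneous_mult[OF hm ep_homogeneous] by (auto simp: cochain_def mult.commute)
    moreover have "inJ N (delta 0 (?z m))"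
      unfolding inJ_def
    proof
      fix k
      show "delta 0 (?z m) k \<in> J N"
      proof (cases "k < rk (Suc 0)")
        case k: True
        have "D 0 k = diff 0 (evec k)" using diff_evec[OF k, of 1] by simp
        then have "vpair (rk 0) (D 0 k) ep \<in> M"
          using exact_0[OF D_in_F[OF k]] evec_in_F[OF k] by auto
        from single_colon[OF m this, of 1] have "vpair (rk 0) (D 0 k) ep * Poly_Mapping.single m 1 \<in> J N" .
        also have "vpair (rk 0) (D 0 k) ep * Poly_Mapping.single m 1 = delta 0 (?z m) k"
          using k by (simp add: delta_def vpair_def sum_distrib_right mult.assoc)
        finally show ?thesis .
      qed (simp add: delta_def)
    qed
    ultimately show ?thesis by (simp add: Z_def)
  qed
  moreover have "\<exists>\<alpha>. (\<lambda>k. c k - comb I \<alpha> ?z k) \<in> B 0 N j" if c: "c \<in> Z 0 N j" for c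
  proof -
    \<comment> \<open>A map from R/M to R/J_N is determined by the image of 1, here the value of
      \<open>c\<close> on \<open>u\<close>.\<close>
    define r where "r = vpair (rk 0) u c"
    have r: "r \<in> homogeneous V j"
      unfolding r_def using u(1) c
      by (subst add_0_left[of j, symmetric], intro vpair_hom[where u = "\<lambda>k. a 0 ! k"])
        (auto simp: grF_def Z_def cochain_def)
    have Mr: "p * r \<in> J N" if p: "p \<in> M" for p
    proof -
      have pR: "p \<in> R" using p M Mm mon_span_mono unfolding carrier_poly_ring by blast
      have "vpair (rk 0) (\<lambda>l. p * u l) ep = p + p * (vpair (rk 0) u ep - 1)"
        by (simp add: vpair_mult algebra_simps)
      also have "\<dots> \<in> M" using p M_mult[OF u(2) pR] unfolding M by auto
      finally have "vpair (rk 0) (\<lambda>l. p * u l) c \<in> J N"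
        using cycle[OF F_mult[OF pR uF]] c by (auto simp: Z_def)
      then show ?thesis by (simp add: vpair_mult r_def)
    qed
    \<comment> \<open>Since \<open>J N\<close> and \<open>M\<close> are monomial, multiplying
      \<open>r\<close> by a monomial of \<open>M\<close> puts each shifted monomial of
      \<open>r\<close> into \<open>J N\<close> separately.\<close>
    have keys_r: "m \<in> I" if m: "m \<in> Poly_Mapping.keys r" "m \<notin> Jm N" for m
    proof -
      have "m' + m \<in> Jm N" if "m' \<in> Mm" for m'
      proof -
        have "Poly_Mapping.single m' 1 \<in> M" unfolding M using that by (rule single_in_mon_span)
        from Mr[OF this] have "Poly_Mapping.keys (Poly_Mapping.single m' 1 * r) \<subseteq> Jm N"
          by (simp add: J_def mon_span_def)
        moreover have "m' + m \<in> Poly_Mapping.keys (Poly_Mapping.single m' 1 * r)"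
          using m(1) lookup_single_mult[of m' 1 r m] by (simp add: in_keys_iff)
        ultimately show ?thesis by blast
      qed
      then show ?thesis using m r by (auto simp: I homogeneous_eq_mon_span mon_span_def)
    qed
    let ?w = "\<Sum>m\<in>I. Poly_Mapping.single m (Poly_Mapping.lookup r m)"
    have lw: "Poly_Mapping.lookup ?w m = (if m \<in> I then Poly_Mapping.lookup r m else 0)" for m
    proof -
      have "Poly_Mapping.lookup ?w m = (\<Sum>m'\<in>I. if m' = m then Poly_Mapping.lookup r m else 0)"
        unfolding lookup_sum by (intro sum.cong) (auto simp: lookup_single when_def)
      then show ?thesis using fin by simp
    qed
    have rw: "r - ?w \<in> J N"
      unfolding J_def mon_span_def
    proof (intro CollectI subsetI)
      fix m assume "m \<in> Poly_Mapping.keys (r - ?w)"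
      then have "m \<notin> I" "m \<in> Poly_Mapping.keys r"
        by (auto simp: in_keys_iff lookup_minus lw split: if_splits)
      then show "m \<in> Jm N" using keys_r by blast
    qed
    \<comment> \<open>The \<open>k\<close>-th basis vector and \<open>ep k * u\<close> have the same
      image in R/M, so \<open>c\<close> takes the same value on both modulo
      \<open>J N\<close>.\<close>
    have ck: "c k - ep k * r \<in> J N" if k: "k < rk 0" for k
    proof -
      let ?f = "\<lambda>l. 1 * evec k l - ep k * u l"
      have f: "?f \<in> F 0" using F_diff[OF F_mult[OF R_1 evec_in_F[OF k]] F_mult[OF epR[OF k] uF]] .
      have "vpair (rk 0) ?f ep = - (ep k * (vpair (rk 0) u ep - 1))"
        unfolding vpair_diff vpair_mult using vpair_evec[OF k, of 1 ep] by (simp add: algebra_simps)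
      also have "\<dots> \<in> M" using M_mult[OF u(2) epR[OF k]] unfolding M by auto
      finally have "vpair (rk 0) ?f c \<in> J N" using cycle[OF f] c by (auto simp: Z_def)
      then show ?thesis unfolding vpair_diff vpair_mult r_def using vpair_evec[OF k, of 1 c] by simp
    qed
    let ?c = "\<lambda>k. c k - comb I (Poly_Mapping.lookup r) ?z k"
    have cC: "c \<in> cochain 0 j" using c by (simp add: Z_def)
    have "?c k \<in> J N" for k
    proof (cases "k < rk 0")
      case True
      have eq: "?c k = (c k - ep k * r) + ep k * (r - ?w)" using True by (simp add: comb_z algebra_simps)
      show ?thesis unfolding eq by (rule J_add[OF ck[OF True] J_mult[OF epR[OF True] rw]])
    next
      case False
      then show ?thesis using cC by (simp add: comb_z cochain_def)
    qed
    moreover have "?c \<in> cochain 0 j"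
      using \<open>\<And>m. m \<in> I \<Longrightarrow> ?z m \<in> Z 0 N j\<close>
      by (intro cochain_diff[OF cC] comb_cochain) (simp add: Z_def)
    ultimately have "?c \<in> B 0 N j" by (simp add: B_def bnd_def inJ_def)
    then show ?thesis by blast
  qed
  moreover have "\<alpha> m = 0" if \<alpha>: "comb I \<alpha> ?z \<in> B 0 N j" and m: "m \<in> I" for \<alpha> m
  proof -
    let ?w = "\<Sum>m\<in>I. Poly_Mapping.single m (\<alpha> m)"
    have epw: "ep k * ?w \<in> J N" if "k < rk 0" for k
      using \<alpha> that by (auto simp: B_def bnd_def inJ_def comb_z split: if_splits)
    have "(\<Sum>k<rk 0. u k * (ep k * ?w)) \<in> J N"
    proof (rule J_sum)
      fix k assume "k \<in> {..<rk 0}"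
      then show "u k * (ep k * ?w) \<in> J N" using uF by (intro J_mult epw) (auto simp: F_def)
    qed
    also have "(\<Sum>k<rk 0. u k * (ep k * ?w)) = vpair (rk 0) u ep * ?w"
      by (simp add: vpair_def sum_distrib_right mult.assoc)
    finally have 1: "vpair (rk 0) u ep * ?w \<in> J N" .
    have "(\<Sum>m\<in>I. (vpair (rk 0) u ep - 1) * Poly_Mapping.single m (\<alpha> m)) \<in> J N"
      using u(2) by (intro J_sum single_colon)
    then have 2: "(vpair (rk 0) u ep - 1) * ?w \<in> J N" by (simp only: sum_distrib_left)
    \<comment> \<open>The augmentation of \<open>u\<close> is 1 only modulo \<open>M\<close>; the
      error lies in \<open>M\<close> and is sent into \<open>J N\<close> by \<open>?w\<close>, whose
      monomials come from \<open>I\<close>.\<close>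
    have "vpair (rk 0) u ep * ?w - (vpair (rk 0) u ep - 1) * ?w = ?w" by (simp only: left_diff_distrib) simp
    then have "?w \<in> J N" using J_diff[OF 1 2] by (simp only:)
    then have "Poly_Mapping.keys ?w \<subseteq> Jm N" by (simp only: J_def mon_span_def mem_Collect_eq)
    moreover have "m \<notin> Jm N" using m by (simp add: I)
    ultimately have "m \<notin> Poly_Mapping.keys ?w" by blast
    moreover have "Poly_Mapping.lookup ?w m = \<alpha> m"
    proof -
      have "Poly_Mapping.lookup ?w m = (\<Sum>m'\<in>I. if m' = m then \<alpha> m else 0)"
        unfolding lookup_sum by (intro sum.cong) (auto simp: lookup_single when_def)
      then show ?thesis using fin m by simp
    qed
    ultimately show ?thesis by (simp only: in_keys_iff not_not)
  qed
  ultimately show ?thesis unfolding quotient_basis_def by blast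
qed

end

section \<open>Dimensions and the parking ideal\<close>

text \<open>The graded pieces are bare records whose vector space axioms are not known beforehand. A
  bijection from the coordinate space that respects the operations transports the axioms and the
  dimension at once.\<close>

lemma dim_eq_of_linear_bij:
  fixes W :: "('k::field, 'm) module" and \<phi> :: "'k Matrix.vec \<Rightarrow> 'm"
  assumes bij: "bij_betw \<phi> (carrier_vec n) (carrier W)"
    and add: "\<And>u v. u \<in> carrier_vec n \<Longrightarrow> v \<in> carrier_vec n \<Longrightarrow> \<phi> (u + v) = \<phi> u \<oplus>\<^bsub>W\<^esub> \<phi> v"
    and zero: "\<phi> (0\<^sub>v n) = \<zero>\<^bsub>W\<^esub>"
    and scale: "\<And>r v. v \<in> carrier_vec n \<Longrightarrow> \<phi> (r \<cdot>\<^sub>v v) = r \<odot>\<^bsub>W\<^esub> \<phi> v"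
  shows "vectorspace.dim class_ring W = n"
proof -
  interpret V: vec_space "TYPE('k)" n .
  have cW: "carrier W = \<phi> ` carrier_vec n" using bij by (simp add: bij_betw_def)
  have ag: "abelian_group W"
  proof (rule abelian_groupI)
    show "x \<oplus>\<^bsub>W\<^esub> y \<in> carrier W" if "x \<in> carrier W" "y \<in> carrier W" for x y
      using that by (auto simp: cW add[symmetric])
    show "\<zero>\<^bsub>W\<^esub> \<in> carrier W" unfolding cW zero[symmetric] by (rule imageI) simp
    show "(x \<oplus>\<^bsub>W\<^esub> y) \<oplus>\<^bsub>W\<^esub> z = x \<oplus>\<^bsub>W\<^esub> (y \<oplus>\<^bsub>W\<^esub> z)"
      if "x \<in> carrier W" "y \<in> carrier W" "z \<in> carrier W" for x y z
      using that by (auto simp: cW add[symmetric] assoc_add_vec)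
    show "x \<oplus>\<^bsub>W\<^esub> y = y \<oplus>\<^bsub>W\<^esub> x" if "x \<in> carrier W" "y \<in> carrier W" for x y
      using that by (auto simp: cW add[symmetric] comm_add_vec)
    show "\<zero>\<^bsub>W\<^esub> \<oplus>\<^bsub>W\<^esub> x = x" if "x \<in> carrier W" for x
      using that by (auto simp: cW add[symmetric] zero[symmetric])
    show "\<exists>y\<in>carrier W. y \<oplus>\<^bsub>W\<^esub> x = \<zero>\<^bsub>W\<^esub>" if x: "x \<in> carrier W" for x
    proof -
      obtain v where v: "v \<in> carrier_vec n" "x = \<phi> v" using x cW by auto
      have "\<phi> (- v) \<oplus>\<^bsub>W\<^esub> x = \<zero>\<^bsub>W\<^esub>"
        using v by (simp add: add[symmetric] zero[symmetric])
      then show ?thesis using v cW by auto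
    qed
  qed
  have mod: "module class_ring W"
  proof (rule module.intro)
    show "cring (class_ring :: 'k ring)" ..
    show "abelian_group W" by (rule ag)
    show "module_axioms class_ring W"
    proof (unfold_locales)
      show "a \<odot>\<^bsub>W\<^esub> x \<in> carrier W" if "x \<in> carrier W" for a x
        using that by (auto simp: cW scale[symmetric])
      show "(a \<oplus>\<^bsub>class_ring\<^esub> b) \<odot>\<^bsub>W\<^esub> x = a \<odot>\<^bsub>W\<^esub> x \<oplus>\<^bsub>W\<^esub> b \<odot>\<^bsub>W\<^esub> x"
        if "x \<in> carrier W" for a b x
        using that by (auto simp: cW scale[symmetric] add[symmetric] add_smult_distrib_vec)
      show "a \<odot>\<^bsub>W\<^esub> (x \<oplus>\<^bsub>W\<^esub> y) = a \<odot>\<^bsub>W\<^esub> x \<oplus>\<^bsub>W\<^esub> a \<odot>\<^bsub>W\<^esub> y"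
        if "x \<in> carrier W" "y \<in> carrier W" for a x y
        using that by (auto simp: cW scale[symmetric] add[symmetric] smult_add_distrib_vec)
      show "(a \<otimes>\<^bsub>class_ring\<^esub> b) \<odot>\<^bsub>W\<^esub> x = a \<odot>\<^bsub>W\<^esub> (b \<odot>\<^bsub>W\<^esub> x)"
        if "x \<in> carrier W" for a b x
        using that by (auto simp: cW scale[symmetric] smult_smult_assoc)
      show "\<one>\<^bsub>class_ring\<^esub> \<odot>\<^bsub>W\<^esub> x = x" if "x \<in> carrier W" for x
        using that by (auto simp: cW scale[symmetric])
    qed
  qed
  have vs: "vectorspace class_ring W"
    by (rule vectorspace.intro[OF mod]) (rule class_field)
  interpret lm: linear_map class_ring "module_vec TYPE('k) n" W \<phi>
  proof (intro linear_map.intro mod_hom.intro mod_hom_axioms.intro)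
    show "vectorspace class_ring (module_vec TYPE('k) n)" ..
    show "module class_ring (module_vec TYPE('k) n)" ..
    show "vectorspace class_ring W" "module class_ring W" by fact+
    show "\<phi> \<in> LinearCombinations.module_hom class_ring (module_vec TYPE('k) n) W"
      using cW by (auto simp: LinearCombinations.module_hom_def module_vec_simps add scale)
  qed
  have "V.dim = vectorspace.dim class_ring W"
    using bij by (intro lm.dim_eq) (auto simp: bij_betw_def module_vec_simps)
  then show ?thesis by (simp add: V.dim_is_n)
qed

section \<open>The polynomial ring as a ring record, and the parking ideal as a span of
  monomials\<close>

lemma poly_ring_simps [simp]:
  "monoid.mult (poly_ring V) = (*)" "monoid.one (poly_ring V) = 1"
  "ring.zero (poly_ring V) = 0" "ring.add (poly_ring V) = (+)"
  by (simp_all add: poly_ring_def)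

lemma cring_poly_ring: "cring (poly_ring V :: ('v, 'k::field) mpoly ring)"
proof (rule cringI)
  let ?R = "poly_ring V :: ('v, 'k) mpoly ring"
  show "abelian_group ?R"
  proof (rule abelian_groupI)
    show "\<exists>y\<in>carrier ?R. y \<oplus>\<^bsub>?R\<^esub> x = \<zero>\<^bsub>?R\<^esub>" if "x \<in> carrier ?R" for x
      using that by (intro bexI[of _ "- x"]) (auto simp: carrier_poly_ring)
  qed (auto simp: carrier_poly_ring algebra_simps)
  show "comm_monoid ?R"
    by (rule comm_monoidI)
      (auto simp: carrier_mult homogeneous_subset[OF one_homogeneous] algebra_simps)
qed (auto simp: algebra_simps)

text \<open>The monomials divisible by some generator m_U. Divisibility is tested only at the
  vertices of \<open>U\<close>, since m_U involves no other variable.\<close>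

definition parking_monomials :: "('v, 'e) mgraph \<Rightarrow> 'v \<Rightarrow> ('v \<Rightarrow>\<^sub>0 nat) set" where
  "parking_monomials G q = {m. Poly_Mapping.keys m \<subseteq> verts G \<and>
     (\<exists>U. U \<noteq> {} \<and> U \<subseteq> verts G - {q} \<and> (\<forall>v\<in>U. cut_degree G U v \<le> Poly_Mapping.lookup m v))}"

lemma prod_var_power:
  assumes "finite U"
  shows "(\<Prod>v\<in>U. var v ^ c v) = (Poly_Mapping.single (\<Sum>v\<in>U. Poly_Mapping.single v (c v)) 1 :: ('v, 'k::field) mpoly)"
  using assms
proof induction
  case empty
  then show ?case by simp
next
  case (insert v U)
  have "var v ^ n = (Poly_Mapping.single (Poly_Mapping.single v n) 1 :: ('v, 'k) mpoly)" for n
    by (induction n) (simp_all add: var_def mult_single single_add[symmetric])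
  then show ?case using insert by (simp add: mult_single)
qed

lemma lookup_sum_single:
  assumes "finite U"
  shows "Poly_Mapping.lookup (\<Sum>v\<in>U. Poly_Mapping.single v (c v)) w = (if w \<in> U then c w else (0::nat))"
proof -
  have "Poly_Mapping.lookup (\<Sum>v\<in>U. Poly_Mapping.single v (c v)) w = (\<Sum>v\<in>U. if v = w then c w else 0)"
    unfolding lookup_sum by (intro sum.cong) (auto simp: lookup_single when_def)
  then show ?thesis using assms by simp
qed

lemma keys_sum_single:
  assumes "finite U"
  shows "Poly_Mapping.keys (\<Sum>v\<in>U. Poly_Mapping.single v (c v :: nat)) \<subseteq> U"
proof
  fix v assume "v \<in> Poly_Mapping.keys (\<Sum>v\<in>U. Poly_Mapping.single v (c v))"
  then show "v \<in> U" unfolding in_keys_iff lookup_sum_single[OF assms] by (cases "v \<in> U") auto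
qed

lemma carrier_mult_parking:
  fixes G :: "('v, 'e) mgraph"
  assumes r: "r \<in> carrier (poly_ring (verts G))" and p: "p \<in> mon_span (parking_monomials G q)"
  shows "r * p \<in> mon_span (parking_monomials G q)"
proof (rule mon_span_mult[OF r[unfolded carrier_poly_ring] p])
  fix m m' :: "'v \<Rightarrow>\<^sub>0 nat"
  assume m: "m \<in> {m. Poly_Mapping.keys m \<subseteq> verts G}" "m' \<in> parking_monomials G q"
  obtain U where U: "U \<noteq> {}" "U \<subseteq> verts G - {q}" "\<And>v. v \<in> U \<Longrightarrow> cut_degree G U v \<le> Poly_Mapping.lookup m' v"
    and m': "Poly_Mapping.keys m' \<subseteq> verts G"
    using m(2) unfolding parking_monomials_def by blast
  have "\<forall>v\<in>U. cut_degree G U v \<le> Poly_Mapping.lookup (m + m') v"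
    using U(3) by (simp add: lookup_add trans_le_add2)
  moreover have "Poly_Mapping.keys (m + m') \<subseteq> verts G" using m(1) m' by (simp add: keys_add_nat)
  ultimately show "m + m' \<in> parking_monomials G q" using U(1,2) unfolding parking_monomials_def by blast
qed

text \<open>The span is an ideal and contains the generators; conversely each of its monomials is a
  multiple of some m_U and so lies in every ideal containing the generators.\<close>

lemma parking_ideal_eq:
  assumes "finite (verts G)"
  shows "(parking_ideal G q :: ('v, 'k::field) mpoly set) = mon_span (parking_monomials G q)"
    (is "?P = ?M")
proof -
  let ?R = "poly_ring (verts G) :: ('v, 'k) mpoly ring"
  let ?mon = "\<lambda>U. \<Sum>v\<in>U. Poly_Mapping.single v (cut_degree G U v)"
  let ?S = "{\<Prod>v\<in>U. var v ^ cut_degree G U v | U. U \<noteq> {} \<and> U \<subseteq> verts G - {q}} :: ('v, 'k) mpoly set"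
  interpret cring ?R by (rule cring_poly_ring)
  have fin: "finite U" if "U \<subseteq> verts G - {q}" for U using that assms finite_subset by blast
  have keys_mon: "Poly_Mapping.keys (?mon U) \<subseteq> verts G" if "U \<subseteq> verts G - {q}" for U
    using keys_sum_single[OF fin[OF that], of "cut_degree G U"] that by blast
  show ?thesis
  proof
    have R: "p \<in> carrier ?R" if "p \<in> mon_span (parking_monomials G q)" for p
      using that unfolding carrier_poly_ring
      by (rule mon_span_mono[rotated]) (simp add: parking_monomials_def Collect_mono)
    note mult_in = carrier_mult_parking[of _ G]
    have "ideal (mon_span (parking_monomials G q)) ?R"
    proof (rule idealI)
      show "ring ?R" ..
      show "subgroup (mon_span (parking_monomials G q)) (add_monoid ?R)"
      proof (rule add.subgroupI)
        show "mon_span (parking_monomials G q) \<subseteq> carrier ?R" using R by blast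
        show "mon_span (parking_monomials G q) \<noteq> ({} :: ('v, 'k) mpoly set)" using mon_span_0 by blast
        show "\<ominus>\<^bsub>?R\<^esub> p \<in> mon_span (parking_monomials G q)" if p: "p \<in> mon_span (parking_monomials G q)" for p
        proof -
          have "- p \<in> mon_span (parking_monomials G q)" using p by (rule mon_span_uminus)
          moreover have "\<ominus>\<^bsub>?R\<^esub> p = - p"
            using R[OF p] R[OF \<open>- p \<in> mon_span (parking_monomials G q)\<close>] by (intro minus_equality) simp_all
          ultimately show ?thesis by simp
        qed
        show "p \<oplus>\<^bsub>?R\<^esub> p' \<in> mon_span (parking_monomials G q)"
          if "p \<in> mon_span (parking_monomials G q)" "p' \<in> mon_span (parking_monomials G q)" for p p'
          using mon_span_add[OF that] by simp
      qed
      show "x \<otimes>\<^bsub>?R\<^esub> p \<in> mon_span (parking_monomials G q)" if "p \<in> mon_span (parking_monomials G q)" "x \<in> carrier ?R" for p x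
        using mult_in[OF that(2,1)] by simp
      show "p \<otimes>\<^bsub>?R\<^esub> x \<in> mon_span (parking_monomials G q)" if "p \<in> mon_span (parking_monomials G q)" "x \<in> carrier ?R" for p x
        using mult_in[OF that(2,1)] by (simp add: mult.commute)
    qed
    moreover have "?S \<subseteq> mon_span (parking_monomials G q)"
    proof
      fix p assume "p \<in> ?S"
      then obtain U where U: "U \<noteq> {}" "U \<subseteq> verts G - {q}" "p = (\<Prod>v\<in>U. var v ^ cut_degree G U v)" by blast
      have "?mon U \<in> parking_monomials G q"
        using U(1,2) keys_mon[OF U(2)]
        unfolding parking_monomials_def
        by (intro CollectI conjI exI[of _ U]) (simp_all add: lookup_sum_single[OF fin[OF U(2)]])
      then show "p \<in> mon_span (parking_monomials G q)"
        unfolding U(3) prod_var_power[OF fin[OF U(2)]] by (rule single_in_mon_span)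
    qed
    ultimately have "mon_span (parking_monomials G q) \<in> {I. ideal I ?R \<and> ?S \<subseteq> I}"
      by (intro CollectI conjI)
    then show "?P \<subseteq> ?M"
      unfolding parking_ideal_def genideal_def by (rule Inter_lower)
  next
    show "?M \<subseteq> ?P"
      unfolding parking_ideal_def genideal_def
    proof (intro subsetI InterI)
      fix p I assume p: "p \<in> ?M" and "I \<in> {I. ideal I ?R \<and> ?S \<subseteq> I}"
      then have I: "ideal I ?R" "?S \<subseteq> I" by (simp_all only: mem_Collect_eq)
      interpret I: ideal I ?R by (rule I(1))
      have I0: "0 \<in> I" using I.zero_closed by simp
      have Iadd: "x + y \<in> I" if "x \<in> I" "y \<in> I" for x y using I.a_closed[OF that] by simp
      have sum_I: "(\<And>x. x \<in> A \<Longrightarrow> f x \<in> I) \<Longrightarrow> sum f A \<in> I" for f :: "('v \<Rightarrow>\<^sub>0 nat) \<Rightarrow> ('v, 'k) mpoly" and A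
        using I0 Iadd by (induction A rule: infinite_finite_induct) auto
      have "Poly_Mapping.single m (Poly_Mapping.lookup p m) \<in> I" if "m \<in> Poly_Mapping.keys p" for m
      proof -
        have "m \<in> parking_monomials G q" using p that by (auto simp: mon_span_def)
        then obtain U where U: "U \<noteq> {}" "U \<subseteq> verts G - {q}" "\<forall>v\<in>U. cut_degree G U v \<le> Poly_Mapping.lookup m v"
          and mV: "Poly_Mapping.keys m \<subseteq> verts G"
          unfolding parking_monomials_def by blast
        have m: "m = (m - ?mon U) + ?mon U"
          using U(3) fin[OF U(2)] by (intro poly_mapping_eqI) (auto simp: lookup_add lookup_minus lookup_sum_single)
        have "Poly_Mapping.single (?mon U) 1 \<in> ?S"
          unfolding prod_var_power[OF fin[OF U(2)], symmetric] using U(1,2) by blast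
        then have g: "Poly_Mapping.single (?mon U) 1 \<in> I" using I(2) by blast
        have "Poly_Mapping.keys (m - ?mon U) \<subseteq> verts G" 
          using mV by (auto simp: in_keys_iff lookup_minus)
        then have "Poly_Mapping.single (m - ?mon U) (Poly_Mapping.lookup p m) \<in> carrier ?R"
          by (auto simp: carrier_poly_ring intro: single_in_mon_span)
        from I.I_l_closed[OF g this]
        have "Poly_Mapping.single ((m - ?mon U) + ?mon U) (Poly_Mapping.lookup p m) \<in> I" by (simp add: mult_single)
        then show ?thesis by (simp only: m[symmetric])
      qed
      then have "(\<Sum>m\<in>Poly_Mapping.keys p. Poly_Mapping.single m (Poly_Mapping.lookup p m)) \<in> I" by (rule sum_I)
      then show "p \<in> I" using poly_mapping_eq_sum_single[of p "Poly_Mapping.keys p"] by simp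
    qed
  qed
qed

section \<open>The resolution of the parking quotient\<close>

lemma free_gmodule_simps [simp]:
  "ring.add (free_gmodule V b) = (\<lambda>f g k. f k + g k)"
  "module.smult (free_gmodule V b) = (\<lambda>p f k. p * f k)"
  "ring.zero (free_gmodule V b) = (\<lambda>_. 0)"
  by (simp_all add: free_gmodule_def)

text \<open>A linear map on a free module is determined by its values on the basis. The relation
  \<open>rel\<close> lets one induction serve three kinds of target: a coordinate of a free module,
  the ring, and the classes modulo M_G.\<close>

lemma free_gmodule_hom_induct:
  fixes c :: "nat \<Rightarrow> ('v, 'k::field) mpoly" and rel :: "'m \<Rightarrow> ('v, 'k) mpoly \<Rightarrow> bool"
  assumes h: "h \<in> LinearCombinations.module_hom (poly_ring V) (free_gmodule V b) M"
    and f: "f \<in> carrier (free_gmodule V b)"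
    and zero: "rel (h (\<lambda>_. 0)) 0"
    and add: "\<And>x y p p'. x \<in> carrier M \<Longrightarrow> y \<in> carrier M \<Longrightarrow> rel x p \<Longrightarrow> rel y p' \<Longrightarrow> rel (x \<oplus>\<^bsub>M\<^esub> y) (p + p')"
    and scale: "\<And>r x p. r \<in> carrier (poly_ring V) \<Longrightarrow> x \<in> carrier M \<Longrightarrow> rel x p \<Longrightarrow> rel (r \<odot>\<^bsub>M\<^esub> x) (r * p)"
    and basis: "\<And>k. k < length b \<Longrightarrow> rel (h (evec k)) (c k)"
  shows "rel (h f) (vpair (length b) f c)"
proof -
  let ?F = "free_gmodule V b :: (('v, 'k) mpoly, _) gmodule"
  \<comment> \<open>The truncations of \<open>f\<close>, each obtained from the previous one by
    adding one multiple of a basis vector.\<close>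
  define g where "g m = (\<lambda>k. if k < m then f k else 0)" for m
  have fR: "f k \<in> carrier (poly_ring V)" for k using f by (simp add: free_gmodule_def)
  have R0: "0 \<in> carrier (poly_ring V :: ('v, 'k) mpoly ring)" and R1: "1 \<in> carrier (poly_ring V :: ('v, 'k) mpoly ring)"
    by (auto simp: carrier_poly_ring mon_span_def)
  have gF: "g m \<in> carrier ?F" if "m \<le> length b" for m
    using f that R0 by (auto simp: free_gmodule_def g_def)
  have eF: "evec k \<in> carrier ?F" if "k < length b" for k
    using that R0 R1 by (auto simp: free_gmodule_def evec_def)
  have "m \<le> length b \<Longrightarrow> rel (h (g m)) (\<Sum>k<m. f k * c k)" for m
  proof (induction m)
    case 0
    have "g 0 = (\<lambda>_. 0)" by (simp add: g_def)
    then show ?case using zero by simp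
  next
    case (Suc m)
    have sF: "f m \<odot>\<^bsub>?F\<^esub> evec m \<in> carrier ?F"
      using Suc.prems fR[of m] R0 by (auto simp: free_gmodule_def evec_def)
    have "g (Suc m) = g m \<oplus>\<^bsub>?F\<^esub> (f m \<odot>\<^bsub>?F\<^esub> evec m)"
      by (auto simp: g_def evec_def less_Suc_eq)
    then have "h (g (Suc m)) = h (g m) \<oplus>\<^bsub>M\<^esub> (f m \<odot>\<^bsub>M\<^esub> h (evec m))"
      using module_hom_add[OF h gF sF] module_hom_smult[OF h fR eF] Suc.prems by simp
    moreover have "rel (h (g m) \<oplus>\<^bsub>M\<^esub> (f m \<odot>\<^bsub>M\<^esub> h (evec m))) ((\<Sum>k<m. f k * c k) + f m * c m)"
    proof (rule add)
      show "h (g m) \<in> carrier M" using module_hom_closed[OF h] gF[of m] Suc.prems by auto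
      show "f m \<odot>\<^bsub>M\<^esub> h (evec m) \<in> carrier M"
        using module_hom_closed[OF h] sF module_hom_smult[OF h fR eF, of m m] Suc.prems by (auto simp: Pi_iff)
      show "rel (h (g m)) (\<Sum>k<m. f k * c k)" using Suc by simp
      show "rel (f m \<odot>\<^bsub>M\<^esub> h (evec m)) (f m * c m)"
        using module_hom_closed[OF h] eF[of m] Suc.prems by (intro scale fR basis) auto
    qed
    ultimately show ?case by (simp add: add.commute)
  qed
  moreover have "g (length b) = f" using f by (auto simp: g_def free_gmodule_def)
  ultimately show ?thesis unfolding vpair_def by (metis order_refl)
qed

lemma (in free_complex) carrier_free_gmodule: "carrier (free_gmodule V (a i)) = F i"
  by (simp add: free_gmodule_def F_def)

lemma (in free_complex) grade_free_gmodule: "gmodule.grade (free_gmodule V (a i)) t = grF i t"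
  by (auto simp: free_gmodule_def grF_def)

definition residue :: "('v, 'k::field) mpoly set \<Rightarrow> ('v, 'k) mpoly \<Rightarrow> ('v, 'k) mpoly set" where
  "residue M p = (\<lambda>m. m + p) ` M"

lemma a_r_coset_regular: "M +>\<^bsub>regular_gmodule V\<^esub> p = residue M p"
  by (auto simp: a_r_coset_def r_coset_def regular_gmodule_def residue_def)

lemma a_rcosets_eq: "a_rcosets\<^bsub>M\<^esub> N = (\<lambda>x. N +>\<^bsub>M\<^esub> x) ` carrier M"
  by (auto simp: A_RCOSETS_def RCOSETS_def a_r_coset_def)

lemma carrier_parking_quotient:
  "carrier (parking_quotient G q :: (('v, 'k::field) mpoly, _) gmodule) =
    residue (parking_ideal G q) ` carrier (poly_ring (verts G))"
proof -
  have "carrier (regular_gmodule V :: (('v, 'k) mpoly, _) gmodule) = carrier (poly_ring V)" for V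
    by (simp add: regular_gmodule_def)
  then show ?thesis
    by (simp add: parking_quotient_def quotient_gmodule_def a_rcosets_eq a_r_coset_regular)
qed

lemma residue_eq_iff: "residue (mon_span S) p = residue (mon_span S) p' \<longleftrightarrow> p - p' \<in> mon_span S"
proof
  assume "residue (mon_span S) p = residue (mon_span S) p'"
  then have "0 + p \<in> residue (mon_span S) p'" unfolding residue_def using mon_span_0 by blast
  then show "p - p' \<in> mon_span S" by (auto simp: residue_def)
next
  assume *: "p - p' \<in> mon_span S"
  show "residue (mon_span S) p = residue (mon_span S) p'"
  proof (intro equalityI subsetI)
    fix x assume "x \<in> residue (mon_span S) p"
    then obtain m where "m \<in> mon_span S" "x = m + p" by (auto simp: residue_def)
    then show "x \<in> residue (mon_span S) p'"
      using mon_span_add[OF _ *, of m] unfolding residue_def by (intro image_eqI[of _ _ "m + (p - p')"]) auto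
  next
    fix x assume "x \<in> residue (mon_span S) p'"
    then obtain m where "m \<in> mon_span S" "x = m + p'" by (auto simp: residue_def)
    then show "x \<in> residue (mon_span S) p"
      using mon_span_diff[OF _ *, of m] unfolding residue_def by (intro image_eqI[of _ _ "m - (p - p')"]) auto
  qed
qed

lemma residue_add: "set_add (regular_gmodule V) (residue (mon_span S) p) (residue (mon_span S) p') = residue (mon_span S) (p + p')"
proof -
  have set_add: "set_add (regular_gmodule V) A B = (\<Union>x\<in>A. \<Union>y\<in>B. {x + y})" for A B :: "('a, 'b) mpoly set"
    by (simp add: set_add_def set_mult_def regular_gmodule_def)
  show ?thesis
    unfolding set_add
  proof (intro equalityI subsetI)
    fix x assume "x \<in> (\<Union>x\<in>residue (mon_span S) p. \<Union>y\<in>residue (mon_span S) p'. {x + y})"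
    then obtain m m' where "m \<in> mon_span S" "m' \<in> mon_span S" "x = (m + p) + (m' + p')"
      by (auto simp: residue_def)
    then show "x \<in> residue (mon_span S) (p + p')"
      unfolding residue_def using mon_span_add[of m S m'] by (intro image_eqI[of _ _ "m + m'"]) auto
  next
    fix x assume "x \<in> residue (mon_span S) (p + p')"
    then obtain m where m: "m \<in> mon_span S" "x = (m + p) + (0 + p')" by (auto simp: residue_def add.assoc)
    moreover have "m + p \<in> residue (mon_span S) p" "0 + p' \<in> residue (mon_span S) p'"
      unfolding residue_def using m(1) mon_span_0 by blast+
    ultimately show "x \<in> (\<Union>x\<in>residue (mon_span S) p. \<Union>y\<in>residue (mon_span S) p'. {x + y})" by blast
  qed
qed

locale parking_resolution =
  fixes G :: "('v, 'e) mgraph" and q :: 'v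
    and a :: "nat \<Rightarrow> int list"
    and d :: "nat \<Rightarrow> (nat \<Rightarrow> ('v, 'k::field) mpoly) \<Rightarrow> (nat \<Rightarrow> ('v, 'k) mpoly)"
    and \<epsilon> :: "(nat \<Rightarrow> ('v, 'k) mpoly) \<Rightarrow> ('v, 'k) mpoly set"
  assumes G: "multigraph G" and con: "connected_mgraph G" and q: "q \<in> verts G"
    and res: "graded_free_resolution (verts G) (parking_quotient G q) a d \<epsilon>"
begin

abbreviation M where "M \<equiv> parking_ideal G q :: ('v, 'k) mpoly set"

definition D :: "nat \<Rightarrow> nat \<Rightarrow> nat \<Rightarrow> ('v, 'k) mpoly" where
  "D i k = d i (evec k)"

lemma finV: "finite (verts G)"
  using G by (simp add: multigraph_def)

lemma M_eq: "M = mon_span (parking_monomials G q)"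
  by (rule parking_ideal_eq[OF finV])

lemma resolution:
  "\<epsilon> \<in> graded_hom (verts G) (free_gmodule (verts G) (a 0)) (parking_quotient G q)"
  "\<epsilon> ` carrier (free_gmodule (verts G) (a 0)) = carrier (parking_quotient G q :: (('v, 'k) mpoly, _) gmodule)"
  "d i \<in> graded_hom (verts G) (free_gmodule (verts G) (a (Suc i))) (free_gmodule (verts G) (a i))"
  "a_kernel (free_gmodule (verts G) (a 0)) (parking_quotient G q) \<epsilon> = d 0 ` carrier (free_gmodule (verts G) (a 1))"
  "a_kernel (free_gmodule (verts G) (a (Suc i))) (free_gmodule (verts G) (a i)) (d i) =
    d (Suc i) ` carrier (free_gmodule (verts G) (a (Suc (Suc i))))"
  using res unfolding graded_free_resolution_def Let_def by blast+

lemma evec_grade: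
  "k < length b \<Longrightarrow> evec k \<in> gmodule.grade (free_gmodule V b :: (('v, 'k) mpoly, _) gmodule) (b ! k)"
  using one_homogeneous by (auto simp: free_gmodule_def evec_def homogeneous_eq_mon_span)

sublocale free_complex "verts G" a D
proof
  fix k i l assume k: "k < length (a (Suc i))"
  have gr: "D i k \<in> gmodule.grade (free_gmodule (verts G) (a i)) (a (Suc i) ! k)"
    using resolution(3)[of i] evec_grade[OF k, of "verts G"] unfolding D_def graded_hom_def by blast
  show "D i k l \<in> homogeneous (verts G) (a (Suc i) ! k - a i ! l)" if "l < length (a i)"
    using gr that by (simp add: free_gmodule_def)
  show "D i k l = 0" if "length (a i) \<le> l"
    using gr that by (simp add: free_gmodule_def)
qed

text \<open>The given \<open>d i\<close> is constrained only on the carrier of the free module, so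
  it agrees with its matrix there and may differ elsewhere.\<close>

lemma d_eq_diff:
  assumes f: "f \<in> F (Suc i)"
  shows "d i f = diff i f"
proof
  fix l
  have h: "d i \<in> LinearCombinations.module_hom (poly_ring (verts G)) (free_gmodule (verts G) (a (Suc i))) (free_gmodule (verts G) (a i))"
    using resolution(3)[of i] by (simp add: graded_hom_def)
  \<comment> \<open>That 0 goes to 0 is drawn from compatibility with scalars, applied to the scalar
    0.\<close>
  have "d i (0 \<odot>\<^bsub>free_gmodule (verts G) (a (Suc i))\<^esub> f) = 0 \<odot>\<^bsub>free_gmodule (verts G) (a i)\<^esub> d i f"
    by (rule module_hom_smult[OF h]) (use f in \<open>simp_all add: carrier_free_gmodule\<close>)
  then have "d i (\<lambda>_. 0) = (\<lambda>_. 0)" by simp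
  then have "d i f l = vpair (length (a (Suc i))) f (\<lambda>k. D i k l)"
    by (intro free_gmodule_hom_induct[OF h, where rel = "\<lambda>x p. x l = p"])
      (use f in \<open>simp_all add: carrier_free_gmodule D_def\<close>)
  then show "d i f l = diff i f l" by (simp add: diff_def)
qed

text \<open>A homogeneous representative of the image of the \<open>k\<close>-th basis vector; one
  exists because the graded pieces of the quotient are the images of those of R.\<close>

definition ep :: "nat \<Rightarrow> ('v, 'k) mpoly" where
  "ep k = (SOME p. p \<in> homogeneous (verts G) (a 0 ! k) \<and> \<epsilon> (evec k) = residue M p)"

lemma ep:
  assumes k: "k < rk 0"
  shows "ep k \<in> homogeneous (verts G) (a 0 ! k)" "\<epsilon> (evec k) = residue M (ep k)"
proof -
  have "\<epsilon> (evec k) \<in> gmodule.grade (parking_quotient G q) (a 0 ! k)"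
    using resolution(1) evec_grade[OF k, of "verts G"] unfolding graded_hom_def by blast
  then have "\<exists>p. p \<in> homogeneous (verts G) (a 0 ! k) \<and> \<epsilon> (evec k) = residue M p"
    by (auto simp: parking_quotient_def quotient_gmodule_def a_r_coset_regular) (auto simp: regular_gmodule_def)
  from someI_ex[OF this]
  show "ep k \<in> homogeneous (verts G) (a 0 ! k)" "\<epsilon> (evec k) = residue M (ep k)" by (simp_all add: ep_def)
qed

lemma M_ideal: "p \<in> M \<Longrightarrow> r \<in> R \<Longrightarrow> r * p \<in> M"
  unfolding M_eq by (rule carrier_mult_parking)

text \<open>Scalar multiplication is a union over all representatives of the class, but they all
  yield the same coset because M_G is an ideal.\<close>

lemma smult_residue:
  assumes "r \<in> R"
  shows "r \<odot>\<^bsub>parking_quotient G q\<^esub> residue M p = residue M (r * p)"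
proof -
  have "r \<odot>\<^bsub>parking_quotient G q\<^esub> residue M p = (\<Union>m\<in>M. residue M (r * (m + p)))"
    by (simp add: parking_quotient_def quotient_gmodule_def a_r_coset_regular)
      (simp add: regular_gmodule_def residue_def)
  moreover have "residue M (r * (m + p)) = residue M (r * p)" if "m \<in> M" for m
    unfolding M_eq residue_eq_iff using M_ideal[OF that assms] unfolding M_eq by (simp only: distrib_left add_diff_cancel_right')
  moreover have "M \<noteq> {}" unfolding M_eq using mon_span_0 by blast
  ultimately show ?thesis by simp
qed

lemma \<epsilon>_eq:
  assumes f: "f \<in> F 0"
  shows "\<epsilon> f = residue M (vpair (rk 0) f ep)"
proof -
  have h: "\<epsilon> \<in> LinearCombinations.module_hom (poly_ring (verts G)) (free_gmodule (verts G) (a 0)) (parking_quotient G q)"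
    using resolution(1) by (simp add: graded_hom_def)
  have carrier_Q: "x \<in> carrier (parking_quotient G q :: (('v, 'k) mpoly, _) gmodule) \<Longrightarrow> \<exists>p. x = residue M p" for x
    unfolding carrier_parking_quotient by blast
  have "\<epsilon> (0 \<odot>\<^bsub>free_gmodule (verts G) (a 0)\<^esub> f) = 0 \<odot>\<^bsub>parking_quotient G q\<^esub> \<epsilon> f"
    by (rule module_hom_smult[OF h]) (use f in \<open>simp_all add: carrier_free_gmodule\<close>)
  moreover have "\<epsilon> f \<in> carrier (parking_quotient G q :: (('v, 'k) mpoly, _) gmodule)"
    using module_hom_closed[OF h] f unfolding carrier_free_gmodule by blast
  then obtain p where "\<epsilon> f = residue M p" using carrier_Q by blast
  ultimately have zero: "\<epsilon> (\<lambda>_. 0) = residue M 0" by (simp add: smult_residue)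
  show ?thesis
  proof (rule free_gmodule_hom_induct[OF h, where rel = "\<lambda>x p. x = residue M p"])
    show "x \<oplus>\<^bsub>parking_quotient G q\<^esub> y = residue M (p + p')" if "x = residue M p" "y = residue M p'" for x y p p'
      using that residue_add[of "verts G"] unfolding M_eq parking_quotient_def quotient_gmodule_def by simp
  qed (use f zero in \<open>simp_all add: carrier_free_gmodule smult_residue ep\<close>)
qed

sublocale free_res "verts G" a D ep M
proof
  show "diff i f = (\<lambda>_. 0) \<longleftrightarrow> f \<in> diff (Suc i) ` F (Suc (Suc i))" if f: "f \<in> F (Suc i)" for f i
  proof -
    have "d (Suc i) ` F (Suc (Suc i)) = diff (Suc i) ` F (Suc (Suc i))"
      by (rule image_cong) (simp_all add: d_eq_diff)
    moreover have "f \<in> d (Suc i) ` F (Suc (Suc i)) \<longleftrightarrow> d i f = (\<lambda>_. 0)"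
      using f unfolding resolution(5)[symmetric, unfolded carrier_free_gmodule]
      by (simp add: a_kernel_def kernel_def carrier_free_gmodule)
    ultimately show ?thesis using d_eq_diff[OF f] by simp
  qed
  show "vpair (rk 0) f ep \<in> M \<longleftrightarrow> f \<in> diff 0 ` F 1" if f: "f \<in> F 0" for f
  proof -
    have "d 0 ` F 1 = diff 0 ` F 1" by (rule image_cong) (simp_all add: d_eq_diff)
    moreover have "f \<in> d 0 ` F 1 \<longleftrightarrow> \<epsilon> f = M"
      using f unfolding resolution(4)[symmetric, unfolded carrier_free_gmodule]
      by (simp add: a_kernel_def kernel_def carrier_free_gmodule parking_quotient_def quotient_gmodule_def)
    moreover have "residue M 0 = M" by (simp add: residue_def)
    then have "\<epsilon> f = M \<longleftrightarrow> vpair (rk 0) f ep \<in> M"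
      unfolding \<epsilon>_eq[OF f] using residue_eq_iff[of "parking_monomials G q" "vpair (rk 0) f ep" 0] by (simp add: M_eq)
    ultimately show ?thesis by simp
  qed
  show "ep k \<in> homogeneous (verts G) (a 0 ! k)" if "k < rk 0" for k using ep(1)[OF that] .
  show "r * p \<in> M" if "p \<in> M" "r \<in> R" for p r using M_ideal[OF that] .
  show "\<exists>u\<in>grF 0 0. vpair (rk 0) u ep - 1 \<in> M"
  proof -
    have "residue M 1 \<in> carrier (parking_quotient G q :: (('v, 'k) mpoly, _) gmodule)"
      unfolding carrier_parking_quotient using R_1 by (rule imageI)
    then obtain u where u: "u \<in> F 0" "\<epsilon> u = residue M 1"
      unfolding resolution(2)[symmetric] carrier_free_gmodule by auto
    then have u1: "vpair (rk 0) u ep - 1 \<in> M"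
      using \<epsilon>_eq[OF u(1)] residue_eq_iff[of "parking_monomials G q" "vpair (rk 0) u ep" 1] by (simp add: M_eq)
    \<comment> \<open>The augmentation is onto, but a lift of 1 need not be homogeneous. Its degree
      0 component is still a lift, because M_G is spanned by monomials and so contains the
      components of its elements.\<close>
    define u' where "u' k = (if k < rk 0 then hom_comp (0 - a 0 ! k) (u k) else 0)" for k
    have "u' \<in> grF 0 0" using u(1) by (auto simp: grF_def u'_def F_def intro: hom_comp_in)
    moreover have "vpair (rk 0) u' ep = (\<Sum>k<rk 0. hom_comp 0 (u k * ep k))"
      unfolding vpair_def u'_def by (intro sum.cong) (auto simp: hom_comp_mult[OF ep(1)])
    then have "vpair (rk 0) u' ep = hom_comp 0 (vpair (rk 0) u ep)"
      unfolding vpair_def by (simp add: hom_comp_def mon_proj_sum)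
    then have "vpair (rk 0) u' ep - 1 = hom_comp 0 (vpair (rk 0) u ep - 1)"
      using hom_comp_id[OF one_homogeneous] by (simp add: hom_comp_def mon_proj_diff)
    then have "vpair (rk 0) u' ep - 1 \<in> M"
      using mon_span_mono[OF Int_lower2 mon_proj_in[OF u1[unfolded M_eq]]] by (simp only: M_eq hom_comp_def)
    ultimately show ?thesis by blast
  qed
qed

end

section \<open>The Ext module\<close>

context parking_resolution
begin

definition N :: nat where
  "N = card (verts G) - 1"

definition vs :: "nat \<Rightarrow> 'v" where
  "vs = (SOME f. bij_betw f {..<N} (verts G - {q}))"

text \<open>The exponent of the generator m_U for a singleton \<open>U\<close>: the number of edges
  from the vertex to other vertices, so loops are not counted.\<close>

definition e :: "nat \<Rightarrow> nat" where
  "e s = cut_degree G {vs s} (vs s)"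

lemma card_verts: "card (verts G) = Suc N"
proof -
  have "card (verts G) \<noteq> 0" using q finV by (auto simp: card_eq_0_iff)
  then show ?thesis by (simp add: N_def)
qed

lemma vs_bij: "bij_betw vs {..<N} (verts G - {q})"
proof -
  have "card (verts G - {q}) = N" using q finV by (simp add: N_def)
  then have "\<exists>f. bij_betw f {..<N} (verts G - {q})"
    using ex_bij_betw_nat_finite[of "verts G - {q}"] finV by (simp add: atLeast0LessThan)
  then show ?thesis unfolding vs_def by (rule someI_ex)
qed

sublocale regular_res "verts G" a D ep M N vs e
proof
  show "inj_on vs {..<N}" using vs_bij by (simp add: bij_betw_def)
  fix s assume "s < N"
  then have vs: "vs s \<in> verts G - {q}" using vs_bij by (auto simp: bij_betw_def)
  then show "vs s \<in> verts G" by simp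
  have "Poly_Mapping.single (vs s) (e s) \<in> parking_monomials G q"
    using vs unfolding parking_monomials_def e_def
    by (intro CollectI conjI exI[of _ "{vs s}"]) auto
  then show "Poly_Mapping.single (Poly_Mapping.single (vs s) (e s)) 1 \<in> M"
    unfolding M_eq by (rule single_in_mon_span)
qed

section \<open>Hom modules in coordinates\<close>

definition target :: "(('v, 'k) mpoly, ('v, 'k) mpoly) gmodule" where
  "target = twist (regular_gmodule (verts G)) (- int (card (verts G)))"

lemma target_simps [simp]:
  "ring.add target = (+)" "module.smult target = (*)" "ring.zero target = 0" "carrier target = R"
  "gmodule.grade target j = homogeneous (verts G) (j - int (card (verts G)))"
  by (simp_all add: target_def twist_def regular_gmodule_def)

abbreviation C where "C i \<equiv> Hom_gmodule (verts G) (free_gmodule (verts G) (a i)) target"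

text \<open>Passage from coordinate vectors to elements of the Hom module. Restriction to
  \<open>F i\<close> makes the functions extensional, as the Hom module demands, so each of its
  elements arises from exactly one vector of \<open>F i\<close>.\<close>

definition coch :: "nat \<Rightarrow> (nat \<Rightarrow> ('v, 'k) mpoly) \<Rightarrow> (nat \<Rightarrow> ('v, 'k) mpoly) \<Rightarrow> ('v, 'k) mpoly" where
  "coch i c = (\<lambda>f\<in>F i. vpair (rk i) f c)"

lemma Hom_simps [simp]:
  "ring.add (C i) = (\<lambda>f g. \<lambda>x\<in>F i. f x + g x)"
  "module.smult (C i) = (\<lambda>r f. \<lambda>x\<in>F i. r * f x)"
  "ring.zero (C i) = (\<lambda>x\<in>F i. 0)"
  by (simp_all add: Hom_gmodule_def Let_def carrier_free_gmodule)

lemma coch_add: "coch i c \<oplus>\<^bsub>C i\<^esub> coch i c' = coch i (\<lambda>k. c k + c' k)"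
  by (auto simp: coch_def vpair_def sum.distrib algebra_simps)

lemma coch_smult: "r \<odot>\<^bsub>C i\<^esub> coch i c = coch i (\<lambda>k. r * c k)"
  by (auto simp: coch_def vpair_def sum_distrib_left algebra_simps)

lemma coch_0: "coch i (\<lambda>_. 0) = \<zero>\<^bsub>C i\<^esub>"
  by (simp add: coch_def vpair_def)

lemma coch_evec: "k < rk i \<Longrightarrow> coch i c (evec k) = c k"
  using vpair_evec[of k "rk i" 1 c] by (simp add: coch_def evec_in_F)

lemma coch_inj:
  assumes "c \<in> F i" "c' \<in> F i" "coch i c = coch i c'"
  shows "c = c'"
proof
  fix k
  show "c k = c' k"
  proof (cases "k < rk i")
    case True
    then show ?thesis using coch_evec[OF True] assms(3) by metis
  next
    case False
    then show ?thesis using assms(1,2) by (simp add: F_def)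
  qed
qed

lemma coch_module_hom:
  assumes c: "c \<in> F i"
  shows "coch i c \<in> LinearCombinations.module_hom (poly_ring (verts G)) (free_gmodule (verts G) (a i)) target"
proof -
  have "vpair (rk i) f c \<in> R" if "f \<in> F i" for f
    using that c by (intro vpair_R) (auto simp: F_def)
  moreover have "(\<lambda>k. f k + g k) \<in> F i" if "f \<in> F i" "g \<in> F i" for f g
    using that by (auto simp: F_def intro: R_add)
  ultimately show ?thesis
    using F_mult[of _ _ i]
    by (auto simp: LinearCombinations.module_hom_def carrier_free_gmodule coch_def vpair_mult)
      (auto simp: vpair_def sum.distrib algebra_simps)
qed

lemma carrier_Hom: "carrier (C i) = coch i ` F i"
proof -
  have cC: "carrier (C i) = LinearCombinations.module_hom (poly_ring (verts G)) (free_gmodule (verts G) (a i)) target \<inter> extensional (F i)"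
    by (simp add: Hom_gmodule_def Let_def carrier_free_gmodule)
  show ?thesis
  proof (intro equalityI subsetI)
    fix h assume "h \<in> carrier (C i)"
    then have h: "h \<in> LinearCombinations.module_hom (poly_ring (verts G)) (free_gmodule (verts G) (a i)) target"
      and ext: "h \<in> extensional (F i)" by (simp_all add: cC)
    define c where "c k = (if k < rk i then h (evec k) else 0)" for k
    have "h (evec k) \<in> R" if "k < rk i" for k
      using module_hom_closed[OF h] evec_in_F[OF that] by (auto simp: carrier_free_gmodule)
    then have cF: "c \<in> F i" by (auto simp: c_def F_def)
    have "h f = vpair (rk i) f c" if f: "f \<in> F i" for f
    proof (rule free_gmodule_hom_induct[OF h, where rel = "(=)"])
      have "h (0 \<odot>\<^bsub>free_gmodule (verts G) (a i)\<^esub> f) = 0 \<odot>\<^bsub>target\<^esub> h f"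
        by (rule module_hom_smult[OF h]) (use f in \<open>simp_all add: carrier_free_gmodule\<close>)
      then show "h (\<lambda>_. 0) = 0" by simp
    qed (use f in \<open>simp_all add: carrier_free_gmodule c_def\<close>)
    then have "h = coch i c" using ext by (intro extensionalityI[OF ext]) (auto simp: coch_def)
    then show "h \<in> coch i ` F i" using cF by blast
  next
    fix h assume "h \<in> coch i ` F i"
    then show "h \<in> carrier (C i)" unfolding cC using coch_module_hom by (auto simp: coch_def)
  qed
qed

text \<open>The target is R(-n), so degree \<open>j\<close> here is degree \<open>j - n\<close> for
  maps into R.\<close>

lemma grade_Hom: "gmodule.grade (C i) j = coch i ` cochain i (j - int (card (verts G)))"
proof -
  have gC: "gmodule.grade (C i) j = {h \<in> carrier (C i). \<forall>t. h ` grF i t \<subseteq> homogeneous (verts G) (t + j - int (card (verts G)))}"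
    by (simp add: Hom_gmodule_def Let_def grade_free_gmodule)
  show ?thesis
  proof (intro equalityI subsetI)
    fix h assume "h \<in> gmodule.grade (C i) j"
    then have h: "\<And>t f. f \<in> grF i t \<Longrightarrow> h f \<in> homogeneous (verts G) (t + j - int (card (verts G)))"
      and "h \<in> carrier (C i)" unfolding gC by auto
    then obtain c where c: "c \<in> F i" "h = coch i c" unfolding carrier_Hom by auto
    have "c k \<in> homogeneous (verts G) (j - int (card (verts G)) + a i ! k)" if k: "k < rk i" for k
      using h[OF evec_grade[OF k, of "verts G", unfolded grade_free_gmodule]] coch_evec[OF k, of c]
      by (simp add: c(2) algebra_simps)
    then show "h \<in> coch i ` cochain i (j - int (card (verts G)))"
      using c by (auto simp: cochain_def F_def)
  next
    fix h assume "h \<in> coch i ` cochain i (j - int (card (verts G)))"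
    then obtain c where c: "c \<in> cochain i (j - int (card (verts G)))" "h = coch i c" by auto
    have "coch i c f \<in> homogeneous (verts G) (t + j - int (card (verts G)))" if f: "f \<in> grF i t" for f t
    proof -
      have "vpair (rk i) f c \<in> homogeneous (verts G) (t + (j - int (card (verts G))))"
        using f c(1) by (intro vpair_hom[where u = "\<lambda>k. a i ! k"]) (auto simp: grF_def cochain_def)
      then show ?thesis using grF_subset[OF f] by (simp add: coch_def algebra_simps)
    qed
    then show "h \<in> gmodule.grade (C i) j"
      unfolding gC using c cochain_subset[OF c(1)] by (auto simp: carrier_Hom)
  qed
qed

lemma coboundary_coch:
  assumes c: "c \<in> F i"
  shows "coboundary (verts G) a d i (coch i c) = coch (Suc i) (delta i c)"
  unfolding coboundary_def coch_def[of "Suc i"] carrier_free_gmodule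
proof (rule restrict_ext)
  fix f assume f: "f \<in> F (Suc i)"
  show "coch i c (d i f) = vpair (rk (Suc i)) f (delta i c)"
    using diff_in_F[OF f] by (simp add: d_eq_diff[OF f] coch_def vpair_delta)
qed

section \<open>Cosets of coboundaries and the graded pieces of Ext\<close>

definition cocycles :: "nat \<Rightarrow> (nat \<Rightarrow> ('v, 'k) mpoly) set" where
  "cocycles i = {c \<in> F i. delta i c = (\<lambda>_. 0)}"

definition coboundaries :: "nat \<Rightarrow> (nat \<Rightarrow> ('v, 'k) mpoly) set" where
  "coboundaries i = (case i of 0 \<Rightarrow> {\<lambda>_. 0} | Suc i' \<Rightarrow> delta i' ` F i')"

lemma kernel_coboundary: "a_kernel (C i) (C (Suc i)) (coboundary (verts G) a d i) = coch i ` cocycles i"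
proof -
  have F0: "(\<lambda>_. 0) \<in> F (Suc i)" by (simp add: F_def)
  have "coboundary (verts G) a d i (coch i c) = \<zero>\<^bsub>C (Suc i)\<^esub> \<longleftrightarrow> delta i c = (\<lambda>_. 0)" if "c \<in> F i" for c
    unfolding coboundary_coch[OF that] coch_0[symmetric]
    using coch_inj[OF delta_in_F[OF that] F0] by auto
  then show ?thesis unfolding a_kernel_def kernel_def cocycles_def by (auto simp: carrier_Hom)
qed

lemma coch_coboundaries:
  "(case i of 0 \<Rightarrow> {\<zero>\<^bsub>C 0\<^esub>} | Suc j \<Rightarrow> coboundary (verts G) a d j ` carrier (C j)) = coch i ` coboundaries i"
proof (cases i)
  case 0
  then show ?thesis by (simp add: coboundaries_def coch_0 restrict_def)
next
  case (Suc j)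
  have "coboundary (verts G) a d j ` coch j ` F j = coch (Suc j) ` delta j ` F j"
    unfolding image_image by (rule image_cong) (simp_all add: coboundary_coch)
  then show ?thesis by (simp add: Suc coboundaries_def carrier_Hom)
qed

lemma coboundaries_F: "g \<in> coboundaries i \<Longrightarrow> g \<in> F i"
  by (auto simp: coboundaries_def F_def[of 0] intro: delta_in_F split: nat.splits)

lemma coboundaries_0: "(\<lambda>_. 0) \<in> coboundaries i"
proof (cases i)
  case (Suc j)
  have "delta j (\<lambda>_. 0) \<in> delta j ` F j" by (rule imageI) (simp add: F_def)
  then show ?thesis by (simp add: coboundaries_def Suc)
qed (simp add: coboundaries_def)

lemma coboundaries_add:
  assumes "g \<in> coboundaries i" "g' \<in> coboundaries i"
  shows "(\<lambda>k. g k + g' k) \<in> coboundaries i"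
proof (cases i)
  case (Suc j)
  then obtain h h' where "h \<in> F j" "g = delta j h" "h' \<in> F j" "g' = delta j h'"
    using assms by (auto simp: coboundaries_def)
  moreover from this have "(\<lambda>k. h k + h' k) \<in> F j" by (auto simp: F_def intro: R_add)
  ultimately show ?thesis by (auto simp: coboundaries_def Suc delta_add[symmetric])
qed (use assms in \<open>simp add: coboundaries_def\<close>)

lemma coboundaries_mult:
  assumes "r \<in> R" "g \<in> coboundaries i"
  shows "(\<lambda>k. r * g k) \<in> coboundaries i"
proof (cases i)
  case (Suc j)
  then obtain h where "h \<in> F j" "g = delta j h" using assms by (auto simp: coboundaries_def)
  then show ?thesis using F_mult[OF assms(1)] by (auto simp: coboundaries_def Suc delta_mult[symmetric])
qed (use assms in \<open>simp add: coboundaries_def\<close>)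

lemma coboundaries_uminus: "g \<in> coboundaries i \<Longrightarrow> (\<lambda>k. - g k) \<in> coboundaries i"
  using coboundaries_mult[of "- 1" g i] R_diff[OF R_0 R_1] by simp

text \<open>Ext is formed with all coboundaries, the dimension count with those of homogeneous
  cochains. Taking homogeneous components of a primitive reconciles the two.\<close>

lemma coboundaries_graded:
  assumes "g \<in> coboundaries i" "g \<in> cochain i j"
  shows "g \<in> bnd i j"
proof (cases i)
  case 0
  then show ?thesis using assms by (simp add: coboundaries_def bnd_def)
next
  case (Suc i')
  then obtain h where h: "h \<in> F i'" "g = delta i' h" using assms by (auto simp: coboundaries_def)
  define h' where "h' k = (if k < rk i' then hom_comp (j + a i' ! k) (h k) else 0)" for k
  have "h' \<in> cochain i' j" using h(1) by (auto simp: cochain_def h'_def F_def intro: hom_comp_in)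
  moreover have "delta i' h' = g"
  proof
    fix k
    show "delta i' h' k = g k"
    proof (cases "k < rk (Suc i')")
      case k: True
      have "D i' k l * hom_comp (j + a i' ! l) (h l) = hom_comp (j + a (Suc i') ! k) (D i' k l * h l)"
        if "l < rk i'" for l
        using hom_comp_mult[OF D_homogeneous[OF k that], of "j + a (Suc i') ! k" "h l"]
        by (simp add: mult.commute algebra_simps)
      then have "delta i' h' k = (\<Sum>l<rk i'. hom_comp (j + a (Suc i') ! k) (D i' k l * h l))"
        using k by (auto simp: delta_def vpair_def h'_def intro!: sum.cong)
      also have "\<dots> = hom_comp (j + a (Suc i') ! k) (g k)"
        using k by (simp add: h(2) delta_def vpair_def hom_comp_def mon_proj_sum)
      also have "\<dots> = g k" using assms(2) k by (intro hom_comp_id) (auto simp: cochain_def Suc)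
      finally show ?thesis .
    next
      case False
      then show ?thesis by (simp add: h(2) delta_def)
    qed
  qed
  ultimately show ?thesis by (auto simp: bnd_def Suc)
qed

lemma bnd_subset_coboundaries: "g \<in> bnd i j \<Longrightarrow> g \<in> coboundaries i"
  by (cases i) (auto simp: bnd_def coboundaries_def intro: cochain_subset)

definition coset :: "nat \<Rightarrow> (nat \<Rightarrow> ('v, 'k) mpoly) \<Rightarrow> ((nat \<Rightarrow> ('v, 'k) mpoly) \<Rightarrow> ('v, 'k) mpoly) set" where
  "coset i c = (\<lambda>g. coch i (\<lambda>k. g k + c k)) ` coboundaries i"

lemma coset_eqI:
  assumes "(\<lambda>k. c k - c' k) \<in> coboundaries i"
  shows "coset i c = coset i c'"
proof -
  have "coset i c \<subseteq> coset i c'" if b: "(\<lambda>k. c k - c' k) \<in> coboundaries i" for c c'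
  proof
    fix x assume "x \<in> coset i c"
    then obtain g where g: "g \<in> coboundaries i" "x = coch i (\<lambda>k. g k + c k)" by (auto simp: coset_def)
    have "x = coch i (\<lambda>k. (g k + (c k - c' k)) + c' k)" by (simp add: g(2))
    then show "x \<in> coset i c'" unfolding coset_def using coboundaries_add[OF g(1) b] by (rule image_eqI)
  qed
  from this[OF assms] this[of c' c] coboundaries_uminus[OF assms] show ?thesis by auto
qed

lemma coset_eqD:
  assumes "coset i c = coset i c'" "c \<in> F i" "c' \<in> F i"
  shows "(\<lambda>k. c k - c' k) \<in> coboundaries i"
proof -
  have "coch i (\<lambda>k. 0 + c k) \<in> coset i c" unfolding coset_def using coboundaries_0 by (rule imageI)
  then obtain g where g: "g \<in> coboundaries i" "coch i c = coch i (\<lambda>k. g k + c' k)"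
    unfolding assms(1) by (auto simp: coset_def)
  have "(\<lambda>k. g k + c' k) \<in> F i" using coboundaries_F[OF g(1)] assms(3) by (auto simp: F_def intro: R_add)
  from coch_inj[OF assms(2) this g(2)] have "(\<lambda>k. c k - c' k) = g" by auto
  then show ?thesis using g(1) by simp
qed

definition E :: "nat \<Rightarrow> (('v, 'k) mpoly, ((nat \<Rightarrow> ('v, 'k) mpoly) \<Rightarrow> ('v, 'k) mpoly) set) gmodule" where
  "E i = Ext_gmodule (verts G) a d i target"

lemma E_eq: "E i = quotient_gmodule (restrict_gmodule (C i) (coch i ` cocycles i)) (coch i ` coboundaries i)"
  unfolding E_def Ext_gmodule_def Let_def kernel_coboundary coch_coboundaries ..

lemma a_r_coset_E:
  "coch i ` coboundaries i +>\<^bsub>restrict_gmodule (C i) Y\<^esub> coch i c = coset i c"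
proof -
  have "coch i ` coboundaries i +>\<^bsub>restrict_gmodule (C i) Y\<^esub> coch i c =
      (\<Union>g\<in>coboundaries i. {coch i g \<oplus>\<^bsub>C i\<^esub> coch i c})"
    by (simp add: a_r_coset_def r_coset_def restrict_gmodule_def)
  then show ?thesis unfolding coch_add coset_def by auto
qed

lemma E_add: "coset i c \<oplus>\<^bsub>E i\<^esub> coset i c' = coset i (\<lambda>k. c k + c' k)"
proof -
  have "coset i c \<oplus>\<^bsub>E i\<^esub> coset i c' = (\<Union>x\<in>coset i c. \<Union>y\<in>coset i c'. {x \<oplus>\<^bsub>C i\<^esub> y})"
    by (simp add: E_eq quotient_gmodule_def set_add_def set_mult_def restrict_gmodule_def)
  also have "\<dots> = (\<Union>g\<in>coboundaries i. \<Union>g'\<in>coboundaries i. {coch i (\<lambda>k. (g k + c k) + (g' k + c' k))})"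
    unfolding coset_def by (simp only: UN_simps coch_add)
  also have "\<dots> = coset i (\<lambda>k. c k + c' k)"
  proof (intro equalityI subsetI)
    fix x assume "x \<in> (\<Union>g\<in>coboundaries i. \<Union>g'\<in>coboundaries i. {coch i (\<lambda>k. (g k + c k) + (g' k + c' k))})"
    then obtain g g' where g: "g \<in> coboundaries i" "g' \<in> coboundaries i"
      and x: "x = coch i (\<lambda>k. (g k + c k) + (g' k + c' k))" by blast
    have "x = coch i (\<lambda>k. (g k + g' k) + (c k + c' k))" by (simp add: x algebra_simps)
    then show "x \<in> coset i (\<lambda>k. c k + c' k)" unfolding coset_def using coboundaries_add[OF g] by (rule image_eqI)
  next
    fix x assume "x \<in> coset i (\<lambda>k. c k + c' k)"
    then obtain g where g: "g \<in> coboundaries i" "x = coch i (\<lambda>k. g k + (c k + c' k))" by (auto simp: coset_def)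
    have "x = coch i (\<lambda>k. (g k + c k) + (0 + c' k))" by (simp add: g(2) algebra_simps)
    then show "x \<in> (\<Union>g\<in>coboundaries i. \<Union>g'\<in>coboundaries i. {coch i (\<lambda>k. (g k + c k) + (g' k + c' k))})"
      using g(1) coboundaries_0[of i] by blast
  qed
  finally show ?thesis .
qed

lemma E_zero: "\<zero>\<^bsub>E i\<^esub> = coset i (\<lambda>_. 0)"
  by (simp add: E_eq quotient_gmodule_def coset_def)

lemma E_smult:
  assumes r: "r \<in> R"
  shows "r \<odot>\<^bsub>E i\<^esub> coset i c = coset i (\<lambda>k. r * c k)"
proof -
  have "r \<odot>\<^bsub>E i\<^esub> coset i c = (\<Union>x\<in>coset i c. coch i ` coboundaries i
      +>\<^bsub>restrict_gmodule (C i) (coch i ` cocycles i)\<^esub> (r \<odot>\<^bsub>C i\<^esub> x))"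
    by (simp add: E_eq quotient_gmodule_def restrict_gmodule_def)
  also have "\<dots> = (\<Union>g\<in>coboundaries i. coset i (\<lambda>k. r * (g k + c k)))"
    unfolding coset_def[of i c] by (simp only: UN_simps coch_smult a_r_coset_E)
  also have "\<dots> = (\<Union>g\<in>coboundaries i. coset i (\<lambda>k. r * c k))"
  proof (rule SUP_cong[OF refl])
    fix g assume "g \<in> coboundaries i"
    from coboundaries_mult[OF r this]
    show "coset i (\<lambda>k. r * (g k + c k)) = coset i (\<lambda>k. r * c k)"
      by (intro coset_eqI) (simp add: algebra_simps)
  qed
  also have "\<dots> = coset i (\<lambda>k. r * c k)" using coboundaries_0[of i] by auto
  finally show ?thesis .
qed

text \<open>The graded piece arises from an intersection of two images under \<open>coch\<close>;
  injectivity turns it into the image of the homogeneous cocycles.\<close>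

lemma E_grade:
  "gmodule.grade (E i) j = coset i ` {c \<in> cochain i (j - int (card (verts G))). delta i c = (\<lambda>_. 0)}"
proof -
  have "coch i ` cochain i (j - int (card (verts G))) \<inter> coch i ` cocycles i =
      coch i ` {c \<in> cochain i (j - int (card (verts G))). delta i c = (\<lambda>_. 0)}" (is "?L = coch i ` ?S")
  proof (intro equalityI subsetI)
    fix x assume "x \<in> ?L"
    then obtain c c' where c: "c \<in> cochain i (j - int (card (verts G)))" "x = coch i c"
      and c': "c' \<in> cocycles i" "x = coch i c'" by auto
    have "c = c'" using coch_inj[OF cochain_subset[OF c(1)], of c'] c(2) c' by (auto simp: cocycles_def)
    then show "x \<in> coch i ` ?S" using c c' by (auto simp: cocycles_def)
  next
    fix x assume "x \<in> coch i ` ?S"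
    then show "x \<in> ?L" using cochain_subset by (auto simp: cocycles_def)
  qed
  then have "gmodule.grade (E i) j = (\<lambda>x. coch i ` coboundaries i
      +>\<^bsub>restrict_gmodule (C i) (coch i ` cocycles i)\<^esub> x) ` coch i ` ?S"
    by (simp add: E_eq quotient_gmodule_def grade_Hom[symmetric]) (simp add: restrict_gmodule_def grade_Hom)
  then show ?thesis unfolding image_image a_r_coset_E .
qed

end

section \<open>The Hilbert series\<close>

context parking_resolution
begin

abbreviation W where "W \<equiv> verts G - {q}"

definition ev :: "'v \<Rightarrow> nat" where
  "ev v = cut_degree G {v} v"

text \<open>The monomials of degree \<open>t\<close> in (J_N : M_G) that are not in J_N, hence a
  basis of that degree of the quotient.\<close>

definition colon_monomials :: "int \<Rightarrow> ('v \<Rightarrow>\<^sub>0 nat) set" where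
  "colon_monomials t = {m. Poly_Mapping.keys m \<subseteq> verts G \<and> int (mon_degree m) = t \<and> m \<notin> Jm N \<and>
     (\<forall>m'\<in>parking_monomials G q. m' + m \<in> Jm N)}"

lemma finW: "finite W"
  using finV by simp

lemma Jm_N: "Jm N = {m. Poly_Mapping.keys m \<subseteq> verts G \<and> (\<exists>v\<in>W. ev v \<le> Poly_Mapping.lookup m v)}"
proof -
  have "W = vs ` {..<N}" using vs_bij by (simp add: bij_betw_def)
  then show ?thesis unfolding Jm_def by (simp add: e_def ev_def Bex_def)
qed

lemma sum_e: "(\<Sum>s<N. int (e s)) = (\<Sum>v\<in>W. int (ev v))"
  using sum.reindex_bij_betw[OF vs_bij, of "\<lambda>v. int (ev v)"] by (simp add: e_def ev_def)

lemma sum_verts: "(\<Sum>v\<in>verts G. h v) = h q + (\<Sum>v\<in>W. h v)"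
  by (rule sum.remove[OF finV q])

lemma sum_parking: "f \<in> parking G {q} \<Longrightarrow> sum f (verts G) = sum f W"
  using parking_eq_0[of f G "{q}" q] by (simp add: sum_verts)

text \<open>Complementation \<open>m v = ev v - 1 - f v\<close>; the exponent of \<open>q\<close> is determined by the degree.\<close>

lemma colon_monomials_bij:
  "bij_betw (\<lambda>m v. if v \<in> W then ev v - 1 - Poly_Mapping.lookup m v else 0)
     (colon_monomials (t + (\<Sum>s<N. int (e s)))) {f \<in> parking G {q}. 0 \<le> t + int N + int (sum f (verts G))}"
  (is "bij_betw ?\<phi> ?I ?P")
proof -
  \<comment> \<open>The inverse map: the exponent at \<open>q\<close> is what the prescribed total
    degree leaves over. The inequality in the definition of the target set makes this number
    nonnegative, so \<open>nat\<close> does not alter it.\<close>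
  define x where "x f v = (if v = q then nat (t + int N + int (sum f W)) else ev v - 1 - f v)" for f v
  define \<psi> where "\<psi> f = (\<Sum>v\<in>verts G. Poly_Mapping.single v (x f v))" for f
  have lookup_\<psi>: "Poly_Mapping.lookup (\<psi> f) v = (if v \<in> verts G then x f v else 0)" for f v
    unfolding \<psi>_def by (rule lookup_sum_single[OF finV])
  have keys_\<psi>: "Poly_Mapping.keys (\<psi> f) \<subseteq> verts G" for f
    unfolding \<psi>_def by (rule keys_sum_single[OF finV])
  have card_W: "card W = N" using finV q by (simp add: N_def)
  have I_less: "Poly_Mapping.lookup m v < ev v" if "m \<in> ?I" "v \<in> W" for m v
  proof (rule ccontr)
    assume "\<not> Poly_Mapping.lookup m v < ev v"
    then have "ev v \<le> Poly_Mapping.lookup m v" by simp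
    moreover have "Poly_Mapping.keys m \<subseteq> verts G" "m \<notin> Jm N"
      using that(1) unfolding colon_monomials_def by blast+
    ultimately show False using that(2) unfolding Jm_N by blast
  qed
  \<comment> \<open>The exponents at the other vertices sum to the total of the \<open>ev v\<close>,
    less \<open>N\<close>, less |f|. Comparison with the degree gives the exponent at
    \<open>q\<close>, whose nonnegativity is the inequality required of f.\<close>
  have I_q: "int (Poly_Mapping.lookup m q) = t + int N + int (sum (?\<phi> m) W)" if m: "m \<in> ?I" for m
  proof -
    have "int (ev v) = int (Poly_Mapping.lookup m v) + 1 + int (?\<phi> m v)" if "v \<in> W" for v
      using I_less[OF m that] that by simp
    then have "(\<Sum>v\<in>W. int (ev v)) = (\<Sum>v\<in>W. int (Poly_Mapping.lookup m v) + 1 + int (?\<phi> m v))"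
      by (rule sum.cong[OF refl])
    also have "\<dots> = (\<Sum>v\<in>W. int (Poly_Mapping.lookup m v)) + int N + int (sum (?\<phi> m) W)"
      by (simp only: sum.distrib of_nat_sum sum_constant card_W mult_1_right)
    finally have "(\<Sum>v\<in>W. int (ev v)) = (\<Sum>v\<in>W. int (Poly_Mapping.lookup m v)) + int N + int (sum (?\<phi> m) W)" .
    moreover have "Poly_Mapping.keys m \<subseteq> verts G" "int (mon_degree m) = t + (\<Sum>v\<in>W. int (ev v))"
      using m by (auto simp: colon_monomials_def sum_e)
    then have "int (Poly_Mapping.lookup m q) + (\<Sum>v\<in>W. int (Poly_Mapping.lookup m v)) = t + (\<Sum>v\<in>W. int (ev v))"
      using mon_degree_eq_sum[OF finV] sum_verts[of "Poly_Mapping.lookup m"] by simp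
    ultimately show ?thesis by linarith
  qed
  have \<phi>: "?\<phi> m \<in> ?P" if m: "m \<in> ?I" for m
  proof -
    have park: "?\<phi> m \<in> parking G {q}"
    proof (rule parkingI)
      show "?\<phi> m v = 0" if "v \<notin> verts G - {q}" for v using that by auto
      show "\<exists>v\<in>U. ?\<phi> m v < cut_degree G U v" if U: "U \<noteq> {}" "U \<subseteq> verts G - {q}" for U
      proof -
        have finU: "finite U" using U(2) finW finite_subset by blast
        \<comment> \<open>The colon condition is tested on the generator m_U. As \<open>m\<close> is
          below every pure power, the product can reach one only at a vertex of \<open>U\<close>,
          and there the condition reads f(v) < cut degree.\<close>
        let ?m' = "\<Sum>v\<in>U. Poly_Mapping.single v (cut_degree G U v)"
        have "?m' \<in> parking_monomials G q"
          unfolding parking_monomials_def using U keys_sum_single[OF finU, of "cut_degree G U"]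
          by (intro CollectI conjI exI[of _ U]) (auto simp: lookup_sum_single[OF finU])
        then have "?m' + m \<in> Jm N" using m by (auto simp: colon_monomials_def)
        then obtain v where v: "v \<in> W" "ev v \<le> Poly_Mapping.lookup (?m' + m) v" unfolding Jm_N by auto
        have l: "ev v \<le> (if v \<in> U then cut_degree G U v else 0) + Poly_Mapping.lookup m v"
          using v(2) by (simp only: lookup_add lookup_sum_single[OF finU])
        then have "v \<in> U" using I_less[OF m v(1)] by (auto split: if_splits)
        then have "?\<phi> m v < cut_degree G U v" using l I_less[OF m v(1)] v(1) by simp
        then show ?thesis using \<open>v \<in> U\<close> by blast
      qed
    qed
    have "0 \<le> t + int N + int (sum (?\<phi> m) W)" unfolding I_q[OF m, symmetric] by simp
    then show ?thesis using park unfolding sum_parking[OF park, symmetric] by (intro CollectI conjI)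
  qed
  have \<psi>: "\<psi> f \<in> ?I" if "f \<in> ?P" for f
  proof -
    have f: "f \<in> parking G {q}" and "0 \<le> t + int N + int (sum f (verts G))"
      using that by (simp_all only: mem_Collect_eq)
    then have deg: "0 \<le> t + int N + int (sum f W)" by (simp only: sum_parking)
    have less: "f v < ev v" if "v \<in> W" for v
      using parking_less_cut_degree[OF f that] by (simp add: ev_def)
    have "(\<Sum>v\<in>W. int (x f v)) = (\<Sum>v\<in>W. int (ev v) - 1 - int (f v))"
    proof (rule sum.cong[OF refl])
      fix v assume v: "v \<in> W"
      obtain k where "ev v = Suc (f v + k)" using less_imp_Suc_add[OF less[OF v]] by blast
      then show "int (x f v) = int (ev v) - 1 - int (f v)" using v by (simp add: x_def)
    qed
    also have "\<dots> = (\<Sum>v\<in>W. int (ev v)) - int N - int (sum f W)"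
      by (simp only: sum_subtractf of_nat_sum sum_constant card_W mult_1_right)
    finally have sW: "(\<Sum>v\<in>W. int (x f v)) = (\<Sum>v\<in>W. int (ev v)) - int N - int (sum f W)" .
    have "mon_degree (\<psi> f) = (\<Sum>v\<in>verts G. x f v)"
      unfolding mon_degree_eq_sum[OF finV keys_\<psi>] by (rule sum.cong) (simp_all add: lookup_\<psi>)
    then have "int (mon_degree (\<psi> f)) = int (x f q) + (\<Sum>v\<in>W. int (x f v))"
      by (simp only: sum_verts of_nat_add of_nat_sum)
    also have "int (x f q) = t + int N + int (sum f W)" using deg by (simp add: x_def)
    finally have "int (mon_degree (\<psi> f)) = t + (\<Sum>s<N. int (e s))" unfolding sum_e sW by simp
    moreover have "\<psi> f \<notin> Jm N"
    proof
      assume "\<psi> f \<in> Jm N"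
      then obtain v where v: "v \<in> W" "ev v \<le> Poly_Mapping.lookup (\<psi> f) v" unfolding Jm_N by blast
      then have "ev v \<le> ev v - 1 - f v" by (simp add: lookup_\<psi> x_def)
      then show False using less[OF v(1)] by linarith
    qed
    moreover have "m' + \<psi> f \<in> Jm N" if m': "m' \<in> parking_monomials G q" for m'
    proof -
      obtain U where U: "U \<noteq> {}" "U \<subseteq> W" "\<And>v. v \<in> U \<Longrightarrow> cut_degree G U v \<le> Poly_Mapping.lookup m' v"
        and k: "Poly_Mapping.keys m' \<subseteq> verts G"
        using m' unfolding parking_monomials_def by blast
      obtain v where v: "v \<in> U" "f v < cut_degree G U v" by (rule parkingE[OF f U(1,2)])
      have vW: "v \<in> W" using v U by blast
      \<comment> \<open>The exponent of \<open>m'\<close> at \<open>v\<close> is at least f(v) + 1,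
        just enough to fill the gap between the complement of f and the pure power.\<close>
      have "ev v \<le> Poly_Mapping.lookup m' v + (ev v - 1 - f v)"
        using U(3)[OF v(1)] v(2) less[OF vW] by linarith
      then have "ev v \<le> Poly_Mapping.lookup (m' + \<psi> f) v"
        using vW by (simp add: lookup_add lookup_\<psi> x_def)
      moreover have "Poly_Mapping.keys (m' + \<psi> f) \<subseteq> verts G" using k keys_\<psi>[of f] by (simp add: keys_add_nat)
      ultimately show ?thesis using vW unfolding Jm_N by blast
    qed
    ultimately show ?thesis using keys_\<psi>[of f] unfolding colon_monomials_def by blast
  qed
  have \<psi>\<phi>: "\<psi> (?\<phi> m) = m" if m: "m \<in> ?I" for m
  proof (rule poly_mapping_eqI)
    fix v
    consider "v = q" | "v \<in> W" | "v \<notin> verts G" by blast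
    then show "Poly_Mapping.lookup (\<psi> (?\<phi> m)) v = Poly_Mapping.lookup m v"
    proof cases
      case 1
      have "x (?\<phi> m) q = Poly_Mapping.lookup m q" unfolding x_def I_q[OF m, symmetric] by simp
      then show ?thesis using 1 q by (simp only: lookup_\<psi> if_True)
    next
      case 2
      then show ?thesis using I_less[OF m 2] by (simp add: lookup_\<psi> x_def)
    next
      case 3
      then have "v \<notin> Poly_Mapping.keys m" using m by (auto simp: colon_monomials_def)
      then show ?thesis using 3 by (simp add: lookup_\<psi> in_keys_iff)
    qed
  qed
  have \<phi>\<psi>: "?\<phi> (\<psi> f) = f" if "f \<in> ?P" for f
  proof
    fix v
    have f: "f \<in> parking G {q}" using that by simp
    show "?\<phi> (\<psi> f) v = f v"
    proof (cases "v \<in> W")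
      case True
      then show ?thesis using parking_less_cut_degree[OF f True] by (simp add: lookup_\<psi> x_def ev_def)
    next
      case False
      then show ?thesis using parking_eq_0[OF f False] by auto
    qed
  qed
  show ?thesis
    by (rule bij_betw_byWitness[where f' = \<psi>]) (use \<phi> \<psi> \<psi>\<phi> \<phi>\<psi> in blast)+
qed

lemma Z_0: "Z i 0 t = {c \<in> cochain i t. delta i c = (\<lambda>_. 0)}"
  by (auto simp: Z_def inJ_def J_def Jm_def mon_span_def)

lemma B_0: "B i 0 t = bnd i t"
proof -
  have "inJ 0 (\<lambda>k. c k - g k) \<longleftrightarrow> c = g" for c g
    by (auto simp: inJ_def J_def Jm_def mon_span_def)
  then show ?thesis using bnd_cochain by (auto simp: B_def)
qed

text \<open>The dimension in degree \<open>j\<close> of Ext^N is carried down to degree 0 cohomology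
  modulo J_N, where a basis is indexed by monomials, and from there to parking functions.\<close>

lemma hilbert_function_CPark:
  "hilbert_function (CPark G a d) j =
    card {f \<in> parking G {q}. 1 - int (card (loops G)) - int (sum f (verts G)) \<le> j}"
proof -
  \<comment> \<open>The loop twist adds l and the target R(-n) subtracts n, so degree
    \<open>j\<close> of the critical module is degree \<open>t\<close> of Ext^N(R/M, R).\<close>
  define t where "t = int (card (loops G)) + j - int (card (verts G))"
  define I where "I = colon_monomials (t + (\<Sum>s<N. int (e s)))"
  define n where "n = card I"
  have P: "{f \<in> parking G {q}. 1 - int (card (loops G)) - int (sum f (verts G)) \<le> j} =
      {f \<in> parking G {q}. 0 \<le> t + int N + int (sum f (verts G))}"
    by (auto simp: t_def card_verts)
  have n: "card {f \<in> parking G {q}. 1 - int (card (loops G)) - int (sum f (verts G)) \<le> j} = n"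
    unfolding P n_def I_def using bij_betw_same_card[OF colon_monomials_bij] by metis
  have finI: "finite I"
    using bij_betw_finite[OF colon_monomials_bij[of t]] finite_parking[OF G, of "{q}"] by (simp add: I_def)
  have "parking_monomials G q \<subseteq> {m. Poly_Mapping.keys m \<subseteq> verts G}" by (auto simp: parking_monomials_def)
  from quotient_basis_colon[OF M_eq this, of I "t + (\<Sum>s<N. int (e s))"] finI
  obtain z0 where "quotient_basis (Z 0 N (t + (\<Sum>s<N. int (e s)))) (B 0 N (t + (\<Sum>s<N. int (e s)))) I z0"
    by (auto simp: I_def colon_monomials_def)
  from quotient_basis_top[OF this] obtain z where z: "quotient_basis (Z N 0 t) (B N 0 t) I z" by blast
  have zZ: "z x \<in> cochain N t" "delta N (z x) = (\<lambda>_. 0)" if "x \<in> I" for x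
    using z that unfolding quotient_basis_def Z_0 by auto
  have comb_c: "comb I \<alpha> z \<in> cochain N t" for \<alpha> using zZ by (intro comb_cochain)
  have comb_Z: "comb I \<alpha> z \<in> Z N 0 t" for \<alpha>
    unfolding Z_0 using comb_c zZ(2) by (auto simp: delta_comb) (auto simp: comb_def)
  obtain b where b: "bij_betw b {..<n} I"
    using ex_bij_betw_nat_finite[OF finI] by (auto simp: n_def atLeast0LessThan)
  define \<beta> where "\<beta> = inv_into {..<n} b"
  have \<beta>: "\<beta> x < n" "b (\<beta> x) = x" if "x \<in> I" for x
    using b that bij_betwE[OF bij_betw_inv_into[OF b]] bij_betw_inv_into_right[OF b] by (auto simp: \<beta>_def)
  have \<beta>b: "b i \<in> I" "\<beta> (b i) = i" if "i < n" for i
    using that bij_betwE[OF b] bij_betw_inv_into_left[OF b] by (auto simp: \<beta>_def)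
  define \<phi> where "\<phi> v = coset N (comb I (\<lambda>x. vec_index v (\<beta> x)) z)" for v :: "'k Matrix.vec"
  let ?W = "graded_piece (CPark G a d) j"
  have CPark: "CPark G a d = twist (E N) (int (card (loops G)))"
    by (simp add: CPark_def canonical_gmodule_def E_def target_def N_def)
  have W: "carrier ?W = coset N ` Z N 0 t" "ring.add ?W = ring.add (E N)" "\<zero>\<^bsub>?W\<^esub> = \<zero>\<^bsub>E N\<^esub>"
    "module.smult ?W = (\<lambda>c m. const_poly c \<odot>\<^bsub>E N\<^esub> m)"
    unfolding CPark graded_piece_def twist_def Z_0 t_def by (simp_all add: E_grade)
  have comb_add: "comb I (\<lambda>x. \<alpha> x + \<alpha>' x) z = (\<lambda>k. comb I \<alpha> z k + comb I \<alpha>' z k)" for \<alpha> \<alpha>'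
    by (simp add: comb_def const_poly_add distrib_right sum.distrib)
  have comb_scale: "comb I (\<lambda>x. r * \<alpha> x) z = (\<lambda>k. const_poly r * comb I \<alpha> z k)" for r \<alpha>
    by (simp add: comb_def const_poly_mult sum_distrib_left mult.assoc)
  have comb_diff: "comb I (\<lambda>x. \<alpha> x - \<alpha>' x) z = (\<lambda>k. comb I \<alpha> z k - comb I \<alpha>' z k)" for \<alpha> \<alpha>'
    using comb_add[of "\<lambda>x. \<alpha> x - \<alpha>' x" \<alpha>'] by (simp add: fun_eq_iff)
  have comb_cong: "comb I \<alpha> z = comb I \<alpha>' z" if "\<And>x. x \<in> I \<Longrightarrow> \<alpha> x = \<alpha>' x" for \<alpha> \<alpha>'
    using that by (simp add: comb_def)
  have "vectorspace.dim class_ring ?W = n"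
  proof (rule dim_eq_of_linear_bij)
    show "bij_betw \<phi> (carrier_vec n) (carrier ?W)"
      unfolding bij_betw_def
    proof
      show "inj_on \<phi> (carrier_vec n)"
      proof (rule inj_onI)
        fix u v :: "'k Matrix.vec"
        assume uv: "u \<in> carrier_vec n" "v \<in> carrier_vec n" and eq: "\<phi> u = \<phi> v"
        let ?\<alpha> = "\<lambda>x. vec_index u (\<beta> x) - vec_index v (\<beta> x)"
        have "comb I ?\<alpha> z \<in> coboundaries N"
          unfolding comb_diff using eq unfolding \<phi>_def by (rule coset_eqD) (rule cochain_subset[OF comb_c])+
        then have "comb I ?\<alpha> z \<in> B N 0 t" unfolding B_0 using comb_c by (rule coboundaries_graded)
        then have \<alpha>: "?\<alpha> x = 0" if "x \<in> I" for x using z that unfolding quotient_basis_def by blast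
        show "u = v"
        proof (rule eq_vecI)
          fix i assume "i < dim_vec v"
          then have "i < n" using uv by simp
          then show "vec_index u i = vec_index v i" using \<alpha>[OF \<beta>b(1)] \<beta>b(2) by simp
        qed (use uv in simp)
      qed
      show "\<phi> ` carrier_vec n = carrier ?W"
      proof (intro equalityI subsetI)
        fix x assume "x \<in> \<phi> ` carrier_vec n"
        then show "x \<in> carrier ?W" unfolding W \<phi>_def using comb_Z by blast
      next
        fix x assume "x \<in> carrier ?W"
        then obtain c where c: "c \<in> Z N 0 t" "x = coset N c" unfolding W by blast
        then obtain \<alpha> where "(\<lambda>k. c k - comb I \<alpha> z k) \<in> B N 0 t" using z unfolding quotient_basis_def by blast
        then have "x = coset N (comb I \<alpha> z)"
          unfolding c(2) B_0 by (intro coset_eqI bnd_subset_coboundaries)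
        also have "\<dots> = \<phi> (vec n (\<lambda>i. \<alpha> (b i)))"
          unfolding \<phi>_def using \<beta> by (intro arg_cong[where f = "coset N"] comb_cong) simp
        finally show "x \<in> \<phi> ` carrier_vec n" by simp
      qed
    qed
    show "\<phi> (u + v) = \<phi> u \<oplus>\<^bsub>?W\<^esub> \<phi> v" if "u \<in> carrier_vec n" "v \<in> carrier_vec n" for u v
      unfolding W \<phi>_def E_add comb_add[symmetric] using that \<beta>
      by (intro arg_cong[where f = "coset N"] comb_cong) simp
    show "\<phi> (0\<^sub>v n) = \<zero>\<^bsub>?W\<^esub>"
    proof -
      have "comb I (\<lambda>x. vec_index (0\<^sub>v n) (\<beta> x)) z = (\<lambda>_. 0)"
        using \<beta> by (simp add: comb_def)
      then show ?thesis unfolding W \<phi>_def E_zero by simp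
    qed
    show "\<phi> (r \<cdot>\<^sub>v v) = r \<odot>\<^bsub>?W\<^esub> \<phi> v" if "v \<in> carrier_vec n" for r v
      unfolding W \<phi>_def E_smult[OF const_R] comb_scale[symmetric] using that \<beta>
      by (intro arg_cong[where f = "coset N"] comb_cong) simp
  qed
  then show ?thesis unfolding hilbert_function_def n .
qed

end

context parking_resolution
begin

abbreviation loop_count where "loop_count \<equiv> card (loops G)"

lemma sum_parking_le: "f \<in> parking G {q} \<Longrightarrow> Suc N + sum f (verts G) \<le> card (edges G) + 1"
  using parking_sum_le[OF G q] by (simp add: card_verts)

text \<open>\<open>Abs_fls\<close> returns the given coefficients only if they vanish in all
  sufficiently negative degrees; this is ensured by the bound on |f|.\<close>

lemma hilbert_series_nth:
  "fls_nth (hilbert_series (CPark G a d)) j =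
    int (card {f \<in> parking G {q}. 1 - int loop_count - int (sum f (verts G)) \<le> j})"
proof -
  have "{f \<in> parking G {q}. 1 - int loop_count - int (sum f (verts G)) \<le> j} = {}"
    if "j < - int loop_count - int (card (edges G))" for j
  proof -
    have "\<not> 1 - int loop_count - int (sum f (verts G)) \<le> j" if "f \<in> parking G {q}" for f
      using sum_parking_le[OF that] \<open>j < _\<close> by linarith
    then show ?thesis by blast
  qed
  then have "\<forall>j < - int loop_count - int (card (edges G)).
      int (card {f \<in> parking G {q}. 1 - int loop_count - int (sum f (verts G)) \<le> j}) = 0"
    by (intro allI impI) (simp only: card.empty of_nat_0)
  then show ?thesis
    unfolding hilbert_series_def hilbert_function_CPark by (rule nth_Abs_fls_lower_bound)
qed

lemma tutte_eq:
  "tutte G 1 fls_X = (\<Sum>f\<in>parking G {q}. fls_X_intpow (int (card (edges G) - N - sum f (verts G))) :: int fls)"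
  unfolding tutte_1_eq_parking_sum[OF G con q] N_def[symmetric] fls_X_power_conv_shift_1 ..

text \<open>Multiplication by 1 - t takes differences of consecutive coefficients, so the step
  contributed by a parking function f becomes the single monomial t^(1 - l - |f|).\<close>

lemma hilbert_series_mult:
  "hilbert_series (CPark G a d) * (1 - fls_X) =
    fls_X_intpow (int (card (verts G)) - int (card (edges G)) - int loop_count) * tutte G 1 fls_X"
proof (rule fls_eqI)
  fix j
  let ?P = "parking G {q}" and ?k = "int (card (verts G)) - int (card (edges G)) - int loop_count"
  let ?d = "\<lambda>f. 1 - int loop_count - int (sum f (verts G))"
  have fin: "finite ?P" by (rule finite_parking[OF G])
  have "fls_nth (hilbert_series (CPark G a d) * (1 - fls_X)) j =
      int (card {f \<in> ?P. ?d f \<le> j}) - int (card {f \<in> ?P. ?d f \<le> j - 1})"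
    by (simp add: right_diff_distrib fls_X_times_conv_shift hilbert_series_nth)
  also have "{f \<in> ?P. ?d f \<le> j} = {f \<in> ?P. ?d f \<le> j - 1} \<union> {f \<in> ?P. ?d f = j}" by auto
  also have "card \<dots> = card {f \<in> ?P. ?d f \<le> j - 1} + card {f \<in> ?P. ?d f = j}"
    using fin by (intro card_Un_disjoint) auto
  also have "int \<dots> - int (card {f \<in> ?P. ?d f \<le> j - 1}) = int (card {f \<in> ?P. ?d f = j})" by simp
  also have "\<dots> = (\<Sum>f\<in>?P. if ?d f = j then 1 else 0)"
    using fin by (simp add: sum.If_cases Int_def)
  also have "\<dots> = (\<Sum>f\<in>?P. fls_nth (fls_X_intpow (?k + int (card (edges G) - N - sum f (verts G)))) j)"
  proof (rule sum.cong)
    fix f assume f: "f \<in> ?P"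
    \<comment> \<open>The origin of the shift: (|V| - |E| - l) + (g - |f|) = 1 - l - |f|. The bound
      on |f| makes the natural difference exact.\<close>
    have "?k + int (card (edges G) - N - sum f (verts G)) = ?d f"
      using sum_parking_le[OF f] by (simp add: card_verts of_nat_diff)
    then show "(if ?d f = j then 1 else 0) =
        fls_nth (fls_X_intpow (?k + int (card (edges G) - N - sum f (verts G)))) j"
      by auto
  qed simp
  also have "\<dots> = fls_nth (fls_X_intpow ?k * tutte G 1 fls_X) j"
    unfolding tutte_eq sum_distrib_left fls_X_intpow_times_fls_X_intpow by (simp add: fls_nth_sum)
  finally show "fls_nth (hilbert_series (CPark G a d) * (1 - fls_X)) j =
      fls_nth (fls_X_intpow ?k * tutte G 1 fls_X) j" .
qed

text \<open>From degree 1 on every coefficient counts at least the zero parking function.\<close>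

lemma hilbert_series_not_laurent_poly: "hilbert_series (CPark G a d) \<notin> laurent_polys"
proof
  assume "hilbert_series (CPark G a d) \<in> laurent_polys"
  then have fin: "finite {j. fls_nth (hilbert_series (CPark G a d)) j \<noteq> 0}" by (simp add: laurent_polys_def)
  have "fls_nth (hilbert_series (CPark G a d)) j \<noteq> 0" if "j \<in> {1..}" for j
  proof -
    have "(\<lambda>_. 0) \<in> {f \<in> parking G {q}. 1 - int loop_count - int (sum f (verts G)) \<le> j}"
      using zero_in_parking[OF G con q] that by simp
    moreover have "finite {f \<in> parking G {q}. 1 - int loop_count - int (sum f (verts G)) \<le> j}"
      using finite_parking[OF G] by simp
    ultimately show ?thesis unfolding hilbert_series_nth by (auto simp: card_eq_0_iff)
  qed
  then have "finite {1::int..}" by (intro finite_subset[OF _ fin]) auto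
  then show False using infinite_Ici by blast
qed

end

section \<open>Integer Laurent polynomials and factorizations of 1 - t\<close>

lemma laurent_polys_intpow: "(fls_X_intpow k :: int fls) \<in> laurent_polys"
proof -
  have "{j. fls_nth (fls_X_intpow k :: int fls) j \<noteq> 0} \<subseteq> {k}" by auto
  then show ?thesis unfolding laurent_polys_def by (auto intro: finite_subset)
qed

lemma laurent_polys_shift:
  assumes "f \<in> laurent_polys"
  shows "fls_shift k f \<in> laurent_polys"
proof -
  have "{j. fls_nth (fls_shift k f) j \<noteq> 0} = (\<lambda>j. j - k) ` {j. fls_nth f j \<noteq> 0}"
    by (auto simp: image_iff) (metis add_diff_cancel)
  then show ?thesis using assms by (simp add: laurent_polys_def)
qed

lemma laurent_polys_const_mult:
  assumes "f \<in> laurent_polys"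
  shows "fls_const c * f \<in> laurent_polys"
  using assms by (auto simp: laurent_polys_def elim!: rev_finite_subset)

lemma laurent_polys_diff:
  assumes "f \<in> laurent_polys" "g \<in> laurent_polys"
  shows "f - g \<in> laurent_polys"
proof -
  have "{j. fls_nth (f - g) j \<noteq> 0} \<subseteq> {j. fls_nth f j \<noteq> 0} \<union> {j. fls_nth g j \<noteq> 0}" by auto
  then show ?thesis using assms by (auto simp: laurent_polys_def elim: finite_subset)
qed

lemma laurent_polys_sum:
  "(\<And>x. x \<in> A \<Longrightarrow> f x \<in> laurent_polys) \<Longrightarrow> sum f A \<in> laurent_polys"
proof (induction A rule: infinite_finite_induct)
  case (insert x A)
  have "{j. fls_nth (f x + sum f A) j \<noteq> 0} \<subseteq> {j. fls_nth (f x) j \<noteq> 0} \<union> {j. fls_nth (sum f A) j \<noteq> 0}" by auto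
  then show ?case using insert by (auto simp: laurent_polys_def elim: finite_subset)
qed (simp_all add: laurent_polys_def)

text \<open>Dividing a Laurent polynomial by its lowest power of t leaves an ordinary polynomial, to
  which degree arguments apply.\<close>

lemma laurent_poly_base_factor:
  assumes "f \<in> laurent_polys"
  shows "\<exists>p. fps_of_poly p = fls_base_factor_to_fps f"
proof -
  let ?b = "fls_base_factor_to_fps f"
  have "{n. fps_nth ?b n \<noteq> 0} \<subseteq> nat ` (\<lambda>j. j - fls_subdegree f) ` {j. fls_nth f j \<noteq> 0}"
  proof
    fix n assume "n \<in> {n. fps_nth ?b n \<noteq> 0}"
    then have "fls_nth f (fls_subdegree f + int n) \<noteq> 0" by (simp add: add.commute)
    then have "nat ((fls_subdegree f + int n) - fls_subdegree f) \<in> nat ` (\<lambda>j. j - fls_subdegree f) ` {j. fls_nth f j \<noteq> 0}"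
      by blast
    then show "n \<in> nat ` (\<lambda>j. j - fls_subdegree f) ` {j. fls_nth f j \<noteq> 0}" by simp
  qed
  then have "finite {n. fps_nth ?b n \<noteq> 0}" using assms by (auto simp: laurent_polys_def elim: finite_subset)
  then have "\<forall>\<^sub>\<infinity>n. fps_nth ?b n = 0" by (simp add: eventually_cofinite)
  then have "poly.coeff (Abs_poly (fps_nth ?b)) = fps_nth ?b" by (rule poly.Abs_poly_inverse[OF CollectI])
  then have "fps_of_poly (Abs_poly (fps_nth ?b)) = ?b" by (simp add: fps_eq_iff)
  then show ?thesis ..
qed

lemma fls_subdegree_one_minus_X: "fls_subdegree (1 - fls_X :: int fls) = 0"
  by (intro fls_subdegree_eqI) auto

text \<open>The widths of the two factors add up to 1, so one of them is a unit.\<close>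

lemma laurent_factor_of_one_minus_X:
  fixes D B :: "int fls"
  assumes D: "D \<in> laurent_polys" and B: "B \<in> laurent_polys"
    and DB: "D * B = fls_X_intpow k * (1 - fls_X)"
  shows "(\<exists>E\<in>laurent_polys. D * E = 1) \<or> (\<exists>c m. B * (fls_const c * fls_X_intpow m) = 1)"
proof -
  obtain p r where p: "fps_of_poly p = fls_base_factor_to_fps D" and r: "fps_of_poly r = fls_base_factor_to_fps B"
    using laurent_poly_base_factor[OF D] laurent_poly_base_factor[OF B] by blast
  have one_X: "(1 - fls_X :: int fls) = fps_to_fls (fps_of_poly [:1, -1:])"
    by (rule fls_eqI) (auto simp: nat_eq_iff coeff_pCons split: nat.split)
  have nz: "D * B \<noteq> 0"
    unfolding DB fls_X_intpow_times_conv_shift one_X by (simp add: fls_shift_eq0_iff)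
  \<comment> \<open>Base factors are multiplicative and unaffected by powers of t, so the
    factorization descends to one of 1 - X in the integer polynomials.\<close>
  have "fps_of_poly (p * r) = fls_base_factor_to_fps (D * B)"
    unfolding fps_of_poly_mult p r by (rule fls_base_factor_to_fps_mult[symmetric])
  also have "\<dots> = fls_base_factor_to_fps (1 - fls_X :: int fls)"
    unfolding DB fls_X_intpow_times_conv_shift fls_base_factor_to_fps_shift ..
  also have "\<dots> = fls_regpart (1 - fls_X)" by (simp only: fls_base_factor_def fls_subdegree_one_minus_X fls_shift_0)
  also have "\<dots> = fps_of_poly [:1, -1:]" unfolding one_X by simp
  finally have pr: "p * r = [:1, -1:]" by (simp only: fps_of_poly_eq_iff)
  have unit: "\<exists>c' m. f * (fls_const c' * fls_X_intpow m) = 1"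
    if f: "fps_of_poly s = fls_base_factor_to_fps f" "Polynomial.degree s = 0" "s dvd [:1, -1:]" for f :: "int fls" and s
  proof -
    obtain c where c: "s = [:c:]" using f(2) degree_eq_zeroE by blast
    \<comment> \<open>A constant dividing 1 - X divides its constant coefficient 1 and is therefore
      invertible in the integers.\<close>
    then have "\<exists>c'. 1 = c * c'" unfolding dvd_def[symmetric] using f(3) const_poly_dvd_iff[of c "[:1, -1:]"] by (metis coeff_pCons_0)
    then obtain c' where c': "c * c' = 1" by metis
    have "f = fls_shift (- fls_subdegree f) (fps_to_fls (fps_of_poly s))"
      unfolding f(1) fps_to_fls_base_factor_to_fps by simp
    also have "\<dots> = fls_X_intpow (fls_subdegree f) * fls_const c"
      by (simp add: c fps_of_poly_const fls_X_intpow_times_conv_shift)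
    finally obtain m where m: "f = fls_X_intpow m * fls_const c" by blast
    have "f * (fls_const c' * fls_X_intpow (- m)) =
        (fls_X_intpow m * fls_X_intpow (- m)) * (fls_const c * fls_const c')"
      unfolding m by (simp only: ac_simps)
    also have "\<dots> = 1" unfolding fls_X_intpow_times_fls_X_intpow by (simp add: c' fls_const_mult_const)
    finally show ?thesis by blast
  qed
  have "p \<noteq> 0" "r \<noteq> 0" using pr by auto
  then have "Polynomial.degree p + Polynomial.degree r = 1" using degree_mult_eq[of p r] by (simp add: pr)
  then consider "Polynomial.degree p = 0" | "Polynomial.degree r = 0" by linarith
  then show ?thesis
  proof cases
    case 1
    have "p dvd [:1, -1:]" unfolding pr[symmetric] by simp
    then obtain c m where "D * (fls_const c * fls_X_intpow m) = 1" using unit[OF p 1] by blast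
    then show ?thesis using laurent_polys_const_mult[OF laurent_polys_intpow] by blast
  next
    case 2
    have "r dvd [:1, -1:]" unfolding pr[symmetric] by simp
    then show ?thesis using unit[OF r 2] by blast
  qed
qed

text \<open>The reduced form fixes the numerator only up to a power of t. The second conjunct
  removes this freedom by giving the Hilbert series itself: the factor is t^(1 - g - l).\<close>

theorem theorem1p6:
  fixes G :: "('v, 'e) mgraph" and q :: 'v
    and a :: "nat \<Rightarrow> int list"
    and d :: "nat \<Rightarrow> (nat \<Rightarrow> ('v, 'k::field) mpoly) \<Rightarrow> (nat \<Rightarrow> ('v, 'k) mpoly)"
    and \<epsilon> :: "(nat \<Rightarrow> ('v, 'k) mpoly) \<Rightarrow> ('v, 'k) mpoly set"
  assumes "multigraph G" and "connected_mgraph G" and "q \<in> verts G"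
    and "graded_free_resolution (verts G) (parking_quotient G q) a d \<epsilon>"
  shows "is_K_polynomial (CPark G a d) (tutte G 1 fls_X) \<and>
         hilbert_series (CPark G a d) * (1 - fls_X) =
           fls_X_intpow (int (card (verts G)) - int (card (edges G)) - int (card (loops G)))
             * tutte G 1 fls_X"
proof -
  interpret parking_resolution G q a d \<epsilon>
    using assms by unfold_locales
  let ?H = "hilbert_series (CPark G a d)" and ?T = "tutte G 1 fls_X :: int fls"
  define k where "k = int (card (verts G)) - int (card (edges G)) - int (card (loops G))"
  have HT: "?H * (1 - fls_X) = fls_X_intpow k * ?T" unfolding k_def by (rule hilbert_series_mult)
  have TL: "?T \<in> laurent_polys"
    unfolding tutte_eq by (intro laurent_polys_sum laurent_polys_intpow)
  \<comment> \<open>The denominator takes up the inverse of the shift, so that the numerator becomes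
    the Tutte evaluation itself.\<close>
  let ?Q = "fls_X_intpow (- k) * (1 - fls_X) :: int fls"
  have one_X: "(1 - fls_X :: int fls) \<in> laurent_polys"
    using laurent_polys_diff[OF laurent_polys_intpow[of 0] laurent_polys_intpow[of 1]]
    by (simp add: fls_X_conv_shift_1)
  have QL: "?Q \<in> laurent_polys"
    unfolding fls_X_intpow_times_conv_shift by (rule laurent_polys_shift[OF one_X])
  have "?H * ?Q = fls_X_intpow (- k) * (?H * (1 - fls_X))" by (simp only: mult.left_commute)
  also have "\<dots> = (fls_X_intpow (- k) * fls_X_intpow k) * ?T" unfolding HT by (simp only: mult.assoc)
  also have "\<dots> = ?T" unfolding fls_X_intpow_times_fls_X_intpow by simp
  finally have HQ: "?H * ?Q = ?T" .
  have nz: "(1 - fls_X :: int fls) \<noteq> 0"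
  proof
    assume "(1 - fls_X :: int fls) = 0"
    then have "fls_nth (1 - fls_X :: int fls) 0 = 0" by simp
    then show False by simp
  qed
  have lead: "fls_nth ?Q (fls_subdegree ?Q) = 1"
    unfolding fls_subdegree_mult_fls_X_intpow[OF nz] fls_subdegree_one_minus_X
    unfolding fls_X_intpow_times_conv_shift by simp
  have red: "\<exists>E\<in>laurent_polys. D * E = 1"
    if D: "D \<in> laurent_polys" and A: "A \<in> laurent_polys" and B: "B \<in> laurent_polys"
      and TA: "?T = D * A" and QB: "?Q = D * B" for D A B
  proof (rule ccontr)
    assume no: "\<not> ?thesis"
    then obtain c m where cm: "B * (fls_const c * fls_X_intpow m) = 1"
      using laurent_factor_of_one_minus_X[OF D B QB[symmetric]] by blast
    have "D \<noteq> 0"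
    proof
      assume "D = 0"
      then have "?Q = 0" by (simp only: QB mult_zero_left)
      then show False using fls_mult_fls_X_intpow_nonzero(1)[OF nz] by blast
    qed
    \<comment> \<open>If D is no unit, then B is invertible by a constant multiple of a power of t.
      Cancelling D gives H * B = A, which would make the Hilbert series a Laurent
      polynomial.\<close>
    moreover have "D * (?H * B) = D * A" using HQ unfolding QB TA by (simp only: mult.left_commute)
    ultimately have "?H * B = A" by simp
    then have "?H * (B * (fls_const c * fls_X_intpow m)) = fls_const c * (A * fls_X_intpow m)"
      by (simp only: mult.assoc[symmetric]) (simp only: mult.commute mult.left_commute)
    then have "?H = fls_const c * (A * fls_X_intpow m)"
      unfolding cm by (simp only: mult_1_right)
    then have "?H = fls_const c * fls_shift (- m) A"
      by (simp only: fls_X_intpow_times_conv_shift)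
    then have "?H \<in> laurent_polys"
      using laurent_polys_const_mult[OF laurent_polys_shift[OF A]] by simp
    then show False using hilbert_series_not_laurent_poly by blast
  qed
  have "is_K_polynomial (CPark G a d) ?T"
    unfolding is_K_polynomial_def using TL QL HQ lead red by blast
  then show ?thesis using HT unfolding k_def by blast
qed

end
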